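(* Let $F$ be a homogeneous Finsler metric on $M=G/H$, in which $G$ is a closed subgroup of $I(M,F)$, and $\mathfrak{g}=\mathfrak{h}+\mathfrak{m}$ a reductive decomposition. Then the spray vector field $\eta$ and the connection operator $N$ for the geodesic spray $\mathbf{G}$ of $F$ satisfy $$g_y(\eta(y),u)=g_y(y,[u,y]_\mathfrak{m}),\quad\forall y\in\mathfrak{m}\backslash\{0\},\ u\in\mathfrak{m},$$ and $$2g_y(N(y,v),u)=g_y([u,v]_\mathfrak{m},y)+g_y([u,y]_\mathfrak{m},v)+g_y([v,y]_\mathfrak{m},u)-2\mathbf{C}_y(u,v,\eta(y)),\quad\forall y\in\mathfrak{m}\backslash\{0\},\ u,v\in\mathfrak{m},$$ in which the inner product $g_y(\cdot,\cdot)$ and the Cartan tensor $\mathbf{C}_y(\cdot,\cdot,\cdot)$ are for the Minkowski norm $F=F(o,\cdot)$ on $\mathfrak{m}$.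
   Context: A Finsler metric on a smooth manifold $M$ is a continuous function $F:TM\to[0,\infty)$ that is positive and smooth on $TM\backslash0$, satisfies $F(x,\lambda y)=\lambda F(x,y)$ for $\lambda\ge0$, and whose Hessian $(g_{ij}(x,y))=([\frac12F^2]_{y^iy^j})$ is positive definite for $y\ne0$; its restriction to a tangent space is a Minkowski norm. For $y\neq0$, $g_y(u,v)=\frac12\frac{\partial^2}{\partial s\partial t}|_{s=t=0}F^2(y+su+tv)$ and the Cartan tensor is $\mathbf{C}_y(u,v,w)=\frac14\frac{\partial^3}{\partial r\partial s\partial t}|_{r=s=t=0}F^2(y+ru+sv+tw)$. The geodesic spray of $F$ is the vector field $\mathbf{G}=y^i\partial_{x^i}-2\mathbf{G}^i\partial_{y^i}$ on $TM\backslash0$ with $\mathbf{G}^i=\frac14g^{il}([F^2]_{x^ky^l}y^k-[F^2]_{x^l})$ in standard local coordinates $(x^i,y^j)$. A geodesic is a smooth curve $c(t)$ with nowhere-vanishing $\dot c(t)$ such that $(c(t),\dot c(t))$ is an integral curve of $\mathbf{G}$. $I(M,F)$ is the isometry group of $(M,F)$ (a Lie transformation group); $F$ is homogeneous if it acts transitively. Here $G$ is a closed Lie subgroup of $I(M,F)$ acting transitively on $M$, $H$ is the isotropy subgroup at $o=eH$. A reductive decomposition $\mathfrak{g}=\mathfrak{h}+\mathfrak{m}$ is an $\mathrm{Ad}(H)$-invariant direct sum of vector spaces ($\mathfrak{g}=\mathrm{Lie}(G)=T_eG$, $\mathfrak{h}=\mathrm{Lie}(H)$); $\mathfrak{m}$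 is identified with $T_o(G/H)$ via the differential at $e$ of $g\mapsto g\cdot o$; $[\cdot,\cdot]_\mathfrak{m}$ is the Lie bracket of $\mathfrak{g}$ followed by projection to $\mathfrak{m}$. $L_g$ is left translation on $G$. Spray vector field of the $G$-invariant spray structure $\mathbf{G}$: any smooth curve $c(t)$ on $G/H$ with $c(0)=o$ and nowhere-vanishing $\dot c(t)$ has a unique lift $\overline{c}(t)$ to $G$, defined around $t=0$, with $\overline{c}(0)=e$, $c(t)=\overline{c}(t)\cdot o$ and $(L_{\overline{c}(t)^{-1}})_*(\dot{\overline{c}}(t))\in\mathfrak{m}\backslash\{0\}$. For $y\in\mathfrak{m}\backslash\{0\}$ let $c_y(t)$ be the geodesic with $c_y(0)=o$, $\dot c_y(0)=y$, and $\overline{c}_y(t)$ its lift; then $\eta(y)=-\frac{\mathrm{d}}{\mathrm{d}t}|_{t=0}(L_{\overline{c}_y(t)^{-1}})_*(\dot{\overline{c}}_y(t))$, a smooth map $\mathfrak{m}\backslash\{0\}\to\mathfrak{m}$. Connection operator: $N(y,u)=\frac12D\eta(y,u)-\frac12[y,u]_\mathfrak{m}$ with $D\eta(y,u)=\frac{\mathrm{d}}{\mathrm{d}t}|_{t=0}\eta(y+tu)$. *)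

theory Defs
  imports "HOL-Analysis.Analysis"
begin

subsection \<open>Smooth maps between normed spaces\<close>

text \<open>\<open>Ck_on k f S\<close> and \<open>smooth_on f S\<close> are meant for open sets \<open>S\<close> in finite-dimensional spaces.\<close>

primrec Ck_on :: "nat \<Rightarrow> ('a::real_normed_vector \<Rightarrow> 'b::real_normed_vector) \<Rightarrow> 'a set \<Rightarrow> bool" where
  "Ck_on 0 f S \<longleftrightarrow> continuous_on S f"
| "Ck_on (Suc k) f S \<longleftrightarrow>
     (\<forall>x\<in>S. f differentiable (at x)) \<and> (\<forall>v. Ck_on k (\<lambda>x. frechet_derivative f (at x) v) S)"

definition smooth_on :: "('a::real_normed_vector \<Rightarrow> 'b::real_normed_vector) \<Rightarrow> 'a set \<Rightarrow> bool" where
  "smooth_on f S \<longleftrightarrow> (\<forall>k. Ck_on k f S)"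


subsection \<open>Smooth manifolds\<close>

type_synonym ('x, 'e) chart = "'x set \<times> ('x \<Rightarrow> 'e)"

definition chart_inv :: "('x, 'e) chart \<Rightarrow> 'e \<Rightarrow> 'x" where
  "chart_inv \<kappa> = inv_into (fst \<kappa>) (snd \<kappa>)"

definition is_chart :: "'x topology \<Rightarrow> ('x, 'e::euclidean_space) chart \<Rightarrow> bool" where
  "is_chart X \<kappa> \<longleftrightarrow> openin X (fst \<kappa>) \<and> open (snd \<kappa> ` fst \<kappa>) \<and>
     homeomorphic_map (subtopology X (fst \<kappa>)) (top_of_set (snd \<kappa> ` fst \<kappa>)) (snd \<kappa>)"

definition smooth_manifold :: "'x topology \<Rightarrow> ('x, 'e::euclidean_space) chart set \<Rightarrow> bool" where
  "smooth_manifold X A \<longleftrightarrow>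
     Hausdorff_space X \<and>
     (\<exists>\<B>. countable \<B> \<and> openin X = arbitrary union_of (\<lambda>U. U \<in> \<B>)) \<and>
     (\<forall>\<kappa>\<in>A. is_chart X \<kappa>) \<and> \<Union>(fst ` A) = topspace X \<and>
     (\<forall>\<kappa>\<in>A. \<forall>\<kappa>'\<in>A. smooth_on (snd \<kappa>' \<circ> chart_inv \<kappa>) (snd \<kappa> ` (fst \<kappa> \<inter> fst \<kappa>')))"

definition smooth_map ::
  "'x topology \<Rightarrow> ('x, 'e::euclidean_space) chart set \<Rightarrow>
   'y topology \<Rightarrow> ('y, 'd::euclidean_space) chart set \<Rightarrow> ('x \<Rightarrow> 'y) \<Rightarrow> bool" where
  "smooth_map X A Y B f \<longleftrightarrow> continuous_map X Y f \<and>
     (\<forall>\<kappa>\<in>A. \<forall>\<kappa>'\<in>B. smooth_on (snd \<kappa>' \<circ> f \<circ> chart_inv \<kappa>) (snd \<kappa> ` (fst \<kappa> \<inter> f -` fst \<kappa>')))"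

definition prod_atlas :: "('x, 'e) chart set \<Rightarrow> ('y, 'd) chart set \<Rightarrow> ('x \<times> 'y, 'e \<times> 'd) chart set" where
  "prod_atlas A B = {(fst \<kappa> \<times> fst \<kappa>', map_prod (snd \<kappa>) (snd \<kappa>')) | \<kappa> \<kappa>'. \<kappa> \<in> A \<and> \<kappa>' \<in> B}"

definition smooth_curve ::
  "'x topology \<Rightarrow> ('x, 'e::euclidean_space) chart set \<Rightarrow> real set \<Rightarrow> (real \<Rightarrow> 'x) \<Rightarrow> bool" where
  "smooth_curve X A I c \<longleftrightarrow> continuous_map (top_of_set I) X c \<and>
     (\<forall>\<kappa>\<in>A. smooth_on (snd \<kappa> \<circ> c) {t \<in> I. c t \<in> fst \<kappa>})"

text \<open>Every point \<open>p\<close> has a preferred chart \<open>chart_at A p\<close>, and the tangent space at \<open>p\<close> is the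
  model space: a tangent vector at \<open>p\<close> is given by its components with respect to \<open>chart_at A p\<close>.
  If \<open>v\<close> is the vector of components of a tangent vector at \<open>p\<close> with respect to \<open>\<kappa>\<close>, then
  \<open>coord_change \<kappa> \<kappa>' p v\<close> is the vector of its components with respect to \<open>\<kappa>'\<close>.\<close>

definition chart_at :: "('x, 'e) chart set \<Rightarrow> 'x \<Rightarrow> ('x, 'e) chart" where
  "chart_at A p = (SOME \<kappa>. \<kappa> \<in> A \<and> p \<in> fst \<kappa>)"

definition coord_change ::
  "('x, 'e::euclidean_space) chart \<Rightarrow> ('x, 'e) chart \<Rightarrow> 'x \<Rightarrow> 'e \<Rightarrow> 'e" where
  "coord_change \<kappa> \<kappa>' p = frechet_derivative (snd \<kappa>' \<circ> chart_inv \<kappa>) (at (snd \<kappa> p))"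

definition tangent_map ::
  "('x, 'e::euclidean_space) chart set \<Rightarrow> ('y, 'd::euclidean_space) chart set \<Rightarrow>
   ('x \<Rightarrow> 'y) \<Rightarrow> 'x \<Rightarrow> 'e \<Rightarrow> 'd" where
  "tangent_map A B f p =
     frechet_derivative (snd (chart_at B (f p)) \<circ> f \<circ> chart_inv (chart_at A p))
       (at (snd (chart_at A p) p))"

definition velocity :: "('x, 'e::euclidean_space) chart set \<Rightarrow> (real \<Rightarrow> 'x) \<Rightarrow> real \<Rightarrow> 'e" where
  "velocity A c t = vector_derivative (snd (chart_at A (c t)) \<circ> c) (at t)"

text \<open>A vector field assigns to each point \<open>p\<close> a vector of components with respect to
  \<open>chart_at A p\<close>; \<open>field_rep\<close> is its expression in the local coordinates of a single chart \<open>\<kappa>\<close>.\<close>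

definition field_rep ::
  "('x, 'e::euclidean_space) chart set \<Rightarrow> ('x, 'e) chart \<Rightarrow> ('x \<Rightarrow> 'e) \<Rightarrow> 'e \<Rightarrow> 'e" where
  "field_rep A \<kappa> V x =
     (let p = chart_inv \<kappa> x in coord_change (chart_at A p) \<kappa> p (V p))"

definition field_bracket ::
  "('x, 'e::euclidean_space) chart set \<Rightarrow> ('x \<Rightarrow> 'e) \<Rightarrow> ('x \<Rightarrow> 'e) \<Rightarrow> 'x \<Rightarrow> 'e" where
  "field_bracket A V W p =
     (let \<kappa> = chart_at A p; x = snd \<kappa> p; v = field_rep A \<kappa> V; w = field_rep A \<kappa> W
      in frechet_derivative w (at x) (v x) - frechet_derivative v (at x) (w x))"


subsection \<open>Finsler metrics and geodesics\<close>

definition fundamental_tensor :: "('v::real_vector \<Rightarrow> real) \<Rightarrow> 'v \<Rightarrow> 'v \<Rightarrow> 'v \<Rightarrow> real" where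
  "fundamental_tensor f y u v =
     1/2 * deriv (\<lambda>s. deriv (\<lambda>t. (f (y + s *\<^sub>R u + t *\<^sub>R v))\<^sup>2) 0) 0"

definition cartan_tensor :: "('v::real_vector \<Rightarrow> real) \<Rightarrow> 'v \<Rightarrow> 'v \<Rightarrow> 'v \<Rightarrow> 'v \<Rightarrow> real" where
  "cartan_tensor f y u v w =
     1/4 * deriv (\<lambda>r. deriv (\<lambda>s. deriv (\<lambda>t. (f (y + r *\<^sub>R u + s *\<^sub>R v + t *\<^sub>R w))\<^sup>2) 0) 0) 0"

text \<open>\<open>F p v\<close> is the value at the tangent vector with components \<open>v\<close> in \<open>chart_at A p\<close>;
  \<open>local_F A F \<kappa> (x, y)\<close> is \<open>F\<close> in the standard local coordinates of the tangent bundle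
  induced by \<open>\<kappa>\<close>.\<close>

definition local_F ::
  "('m, 'e::euclidean_space) chart set \<Rightarrow> ('m \<Rightarrow> 'e \<Rightarrow> real) \<Rightarrow> ('m, 'e) chart \<Rightarrow> 'e \<times> 'e \<Rightarrow> real" where
  "local_F A F \<kappa> = (\<lambda>(x, y). let p = chart_inv \<kappa> x in F p (coord_change \<kappa> (chart_at A p) p y))"

definition finsler_metric ::
  "('m, 'e::euclidean_space) chart set \<Rightarrow> ('m \<Rightarrow> 'e \<Rightarrow> real) \<Rightarrow> bool" where
  "finsler_metric A F \<longleftrightarrow>
     (\<forall>p v. 0 \<le> F p v) \<and> (\<forall>p v. v \<noteq> 0 \<longrightarrow> 0 < F p v) \<and>
     (\<forall>\<kappa>\<in>A. continuous_on (snd \<kappa> ` fst \<kappa> \<times> UNIV) (local_F A F \<kappa>)) \<and>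
     (\<forall>\<kappa>\<in>A. smooth_on (local_F A F \<kappa>) (snd \<kappa> ` fst \<kappa> \<times> (UNIV - {0}))) \<and>
     (\<forall>p v. \<forall>l\<ge>0. F p (l *\<^sub>R v) = l * F p v) \<and>
     (\<forall>p y v. y \<noteq> 0 \<longrightarrow> v \<noteq> 0 \<longrightarrow> 0 < fundamental_tensor (F p) y v v)"

definition partial_x ::
  "'n \<Rightarrow> ((real^'n::finite) \<times> (real^'n) \<Rightarrow> real) \<Rightarrow> (real^'n) \<times> (real^'n) \<Rightarrow> real" where
  "partial_x i L = (\<lambda>(x, y). deriv (\<lambda>t. L (x + t *\<^sub>R axis i 1, y)) 0)"

definition partial_y ::
  "'n \<Rightarrow> ((real^'n::finite) \<times> (real^'n) \<Rightarrow> real) \<Rightarrow> (real^'n) \<times> (real^'n) \<Rightarrow> real" where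
  "partial_y i L = (\<lambda>(x, y). deriv (\<lambda>t. L (x, y + t *\<^sub>R axis i 1)) 0)"

definition spray_coeff ::
  "('m, real^'n::finite) chart set \<Rightarrow> ('m \<Rightarrow> real^'n \<Rightarrow> real) \<Rightarrow> ('m, real^'n) chart \<Rightarrow>
   (real^'n) \<times> (real^'n) \<Rightarrow> real^'n" where
  "spray_coeff A F \<kappa> = (\<lambda>(x, y).
     let F2 = (\<lambda>z. (local_F A F \<kappa> z)\<^sup>2);
         g = (\<chi> i j. partial_y j (partial_y i (\<lambda>z. 1/2 * F2 z)) (x, y))
     in \<chi> i. 1/4 * (\<Sum>l\<in>UNIV. matrix_inv g $ i $ l *
          ((\<Sum>k\<in>UNIV. partial_y l (partial_x k F2) (x, y) * y $ k) - partial_x l F2 (x, y))))"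

definition geodesic_spray ::
  "('m, real^'n::finite) chart set \<Rightarrow> ('m \<Rightarrow> real^'n \<Rightarrow> real) \<Rightarrow> ('m, real^'n) chart \<Rightarrow>
   (real^'n) \<times> (real^'n) \<Rightarrow> (real^'n) \<times> (real^'n)" where
  "geodesic_spray A F \<kappa> = (\<lambda>(x, y). (y, - 2 *\<^sub>R spray_coeff A F \<kappa> (x, y)))"

text \<open>The spray is a vector field on the slit tangent bundle, i.e. its local expressions
  \<open>geodesic_spray A F \<kappa>\<close> agree on overlaps, so that being an integral curve at the time \<open>t\<close> may be
  tested in any one chart around \<open>c t\<close>.\<close>

definition geodesic_on ::
  "('m::topological_space, real^'n::finite) chart set \<Rightarrow> ('m \<Rightarrow> real^'n \<Rightarrow> real) \<Rightarrow>
   real set \<Rightarrow> (real \<Rightarrow> 'm) \<Rightarrow> bool" where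
  "geodesic_on A F I c \<longleftrightarrow>
     smooth_curve euclidean A I c \<and> (\<forall>t\<in>I. velocity A c t \<noteq> 0) \<and>
     (\<forall>t\<in>I. \<exists>\<kappa>\<in>A. c t \<in> fst \<kappa> \<and>
        (let z = (\<lambda>s. (snd \<kappa> (c s), vector_derivative (snd \<kappa> \<circ> c) (at s)))
         in (z has_vector_derivative geodesic_spray A F \<kappa> (z t)) (at t)))"

definition geodesic ::
  "('m::topological_space, real^'n::finite) chart set \<Rightarrow> ('m \<Rightarrow> real^'n \<Rightarrow> real) \<Rightarrow>
   'm \<Rightarrow> real^'n \<Rightarrow> real \<Rightarrow> 'm" where
  "geodesic A F p v =
     (SOME c. \<exists>\<epsilon>>0. geodesic_on A F {-\<epsilon><..<\<epsilon>} c \<and> c 0 = p \<and> velocity A c 0 = v)"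


subsection \<open>Isometries and transformation groups\<close>

definition isometry_group ::
  "('m::topological_space, 'e::euclidean_space) chart set \<Rightarrow> ('m \<Rightarrow> 'e \<Rightarrow> real) \<Rightarrow> ('m \<Rightarrow> 'm) set" where
  "isometry_group A F =
     {f. bij f \<and> smooth_map euclidean A euclidean A f \<and> smooth_map euclidean A euclidean A (inv f) \<and>
         (\<forall>p v. F (f p) (tangent_map A A f p v) = F p v)}"

definition compact_open_topology :: "('m::topological_space \<Rightarrow> 'm) topology" where
  "compact_open_topology =
     topology_generated_by {{f. f ` K \<subseteq> V} | K V. compact K \<and> open V}"

abbreviation group_topology :: "('m::topological_space \<Rightarrow> 'm) set \<Rightarrow> ('m \<Rightarrow> 'm) topology" where
  "group_topology G \<equiv> subtopology compact_open_topology G"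

text \<open>The elements of \<open>G\<close> are transformations of \<open>M\<close>, the product is composition, and \<open>g \<cdot> p\<close> is
  \<open>g p\<close>. The atlas \<open>B\<close> is compatible with the compact-open topology; since a topological group
  carries at most one Lie group structure, \<open>B\<close> is determined by \<open>G\<close> up to equivalence.\<close>

definition lie_transformation_group ::
  "('m::topological_space, 'e::euclidean_space) chart set \<Rightarrow> ('m \<Rightarrow> 'm) set \<Rightarrow>
   ('m \<Rightarrow> 'm, 'b::euclidean_space) chart set \<Rightarrow> bool" where
  "lie_transformation_group A G B \<longleftrightarrow>
     (\<forall>g\<in>G. bij g) \<and> id \<in> G \<and> (\<forall>g\<in>G. \<forall>h\<in>G. g \<circ> h \<in> G) \<and> (\<forall>g\<in>G. inv g \<in> G) \<and>
     smooth_manifold (group_topology G) B \<and>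
     smooth_map (prod_topology (group_topology G) (group_topology G)) (prod_atlas B B)
       (group_topology G) B (\<lambda>(g, h). g \<circ> h) \<and>
     smooth_map (group_topology G) B (group_topology G) B inv \<and>
     smooth_map (prod_topology (group_topology G) euclidean) (prod_atlas B A)
       euclidean A (\<lambda>(g, p). g p)"

definition closed_isometry_subgroup ::
  "('m::topological_space, 'e::euclidean_space) chart set \<Rightarrow> ('m \<Rightarrow> 'e \<Rightarrow> real) \<Rightarrow>
   ('m \<Rightarrow> 'm) set \<Rightarrow> ('m \<Rightarrow> 'm, 'b::euclidean_space) chart set \<Rightarrow> bool" where
  "closed_isometry_subgroup A F G B \<longleftrightarrow>
     closedin (group_topology (isometry_group A F)) G \<and> lie_transformation_group A G B"

definition isotropy :: "('m \<Rightarrow> 'm) set \<Rightarrow> 'm \<Rightarrow> ('m \<Rightarrow> 'm) set" where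
  "isotropy G x0 = {g \<in> G. g x0 = x0}"


subsection \<open>Lie algebra and reductive decompositions\<close>

text \<open>The Lie algebra of \<open>G\<close> is the tangent space at the identity, that is, the model space \<open>'b\<close>.\<close>

definition lie_bracket ::
  "('m \<Rightarrow> 'm, 'b::euclidean_space) chart set \<Rightarrow> 'b \<Rightarrow> 'b \<Rightarrow> 'b" where
  "lie_bracket B X Y =
     field_bracket B (\<lambda>g. tangent_map B B (\<lambda>h. g \<circ> h) id X) (\<lambda>g. tangent_map B B (\<lambda>h. g \<circ> h) id Y) id"

text \<open>For a closed subgroup \<open>H\<close> of \<open>G\<close> (which is an embedded submanifold), this is the tangent
  space of \<open>H\<close> at the identity.\<close>

definition lie_subalgebra ::
  "('m::topological_space \<Rightarrow> 'm) set \<Rightarrow> ('m \<Rightarrow> 'm, 'b::euclidean_space) chart set \<Rightarrow>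
   ('m \<Rightarrow> 'm) set \<Rightarrow> 'b set" where
  "lie_subalgebra G B H =
     {velocity B c 0 | c. \<exists>\<epsilon>>0. smooth_curve (group_topology G) B {-\<epsilon><..<\<epsilon>} c \<and>
        c 0 = id \<and> (\<forall>t\<in>{-\<epsilon><..<\<epsilon>}. c t \<in> H)}"

definition Ad :: "('m \<Rightarrow> 'm, 'b::euclidean_space) chart set \<Rightarrow> ('m \<Rightarrow> 'm) \<Rightarrow> 'b \<Rightarrow> 'b" where
  "Ad B k = tangent_map B B (\<lambda>g. k \<circ> g \<circ> inv k) id"

definition reductive_decomposition ::
  "('m::topological_space \<Rightarrow> 'm) set \<Rightarrow> ('m \<Rightarrow> 'm, 'b::euclidean_space) chart set \<Rightarrow>
   'm \<Rightarrow> 'b set \<Rightarrow> bool" where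
  "reductive_decomposition G B x0 m \<longleftrightarrow>
     (let H = isotropy G x0; h = lie_subalgebra G B H
      in subspace h \<and> subspace m \<and> h \<inter> m = {0} \<and> (\<forall>X. \<exists>Y\<in>h. \<exists>Z\<in>m. X = Y + Z) \<and>
         (\<forall>k\<in>H. Ad B k ` h \<subseteq> h \<and> Ad B k ` m \<subseteq> m))"

definition proj_m ::
  "('m::topological_space \<Rightarrow> 'm) set \<Rightarrow> ('m \<Rightarrow> 'm, 'b::euclidean_space) chart set \<Rightarrow>
   'm \<Rightarrow> 'b set \<Rightarrow> 'b \<Rightarrow> 'b" where
  "proj_m G B x0 m X = (THE Z. Z \<in> m \<and> X - Z \<in> lie_subalgebra G B (isotropy G x0))"

definition bracket_m ::
  "('m::topological_space \<Rightarrow> 'm) set \<Rightarrow> ('m \<Rightarrow> 'm, 'b::euclidean_space) chart set \<Rightarrow>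
   'm \<Rightarrow> 'b set \<Rightarrow> 'b \<Rightarrow> 'b \<Rightarrow> 'b" where
  "bracket_m G B x0 m X Y = proj_m G B x0 m (lie_bracket B X Y)"

text \<open>The identification of \<open>m\<close> with the tangent space of \<open>M\<close> at \<open>x0\<close> is the restriction to \<open>m\<close>
  of \<open>orbit_differential\<close>; by means of it the Minkowski norm \<open>F x0\<close> is regarded as a norm
  on \<open>m\<close>.\<close>

definition orbit_differential ::
  "('m, 'e::euclidean_space) chart set \<Rightarrow> ('m \<Rightarrow> 'm, 'b::euclidean_space) chart set \<Rightarrow>
   'm \<Rightarrow> 'b \<Rightarrow> 'e" where
  "orbit_differential A B x0 = tangent_map B A (\<lambda>g. g x0) id"

definition norm_m ::
  "('m, 'e::euclidean_space) chart set \<Rightarrow> ('m \<Rightarrow> 'e \<Rightarrow> real) \<Rightarrow>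
   ('m \<Rightarrow> 'm, 'b::euclidean_space) chart set \<Rightarrow> 'm \<Rightarrow> 'b \<Rightarrow> real" where
  "norm_m A F B x0 y = F x0 (orbit_differential A B x0 y)"


subsection \<open>Spray vector field and connection operator\<close>

definition left_velocity ::
  "('m \<Rightarrow> 'm, 'b::euclidean_space) chart set \<Rightarrow> (real \<Rightarrow> 'm \<Rightarrow> 'm) \<Rightarrow> real \<Rightarrow> 'b" where
  "left_velocity B cb t = tangent_map B B (\<lambda>g. inv (cb t) \<circ> g) (cb t) (velocity B cb t)"

definition curve_lift ::
  "('m::topological_space \<Rightarrow> 'm) set \<Rightarrow> ('m \<Rightarrow> 'm, 'b::euclidean_space) chart set \<Rightarrow>
   'm \<Rightarrow> 'b set \<Rightarrow> (real \<Rightarrow> 'm) \<Rightarrow> real \<Rightarrow> 'm \<Rightarrow> 'm" where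
  "curve_lift G B x0 m c =
     (SOME cb. \<exists>\<epsilon>>0. smooth_curve (group_topology G) B {-\<epsilon><..<\<epsilon>} cb \<and> cb 0 = id \<and>
        (\<forall>t\<in>{-\<epsilon><..<\<epsilon>}. c t = cb t x0 \<and> left_velocity B cb t \<in> m - {0}))"

definition spray_vector_field ::
  "('m::topological_space, real^'n::finite) chart set \<Rightarrow> ('m \<Rightarrow> real^'n \<Rightarrow> real) \<Rightarrow>
   ('m \<Rightarrow> 'm) set \<Rightarrow> ('m \<Rightarrow> 'm, 'b::euclidean_space) chart set \<Rightarrow> 'm \<Rightarrow> 'b set \<Rightarrow> 'b \<Rightarrow> 'b" where
  "spray_vector_field A F G B x0 m y =
     - vector_derivative
         (left_velocity B (curve_lift G B x0 m (geodesic A F x0 (orbit_differential A B x0 y))))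
         (at 0)"

definition connection_operator ::
  "('m::topological_space, real^'n::finite) chart set \<Rightarrow> ('m \<Rightarrow> real^'n \<Rightarrow> real) \<Rightarrow>
   ('m \<Rightarrow> 'm) set \<Rightarrow> ('m \<Rightarrow> 'm, 'b::euclidean_space) chart set \<Rightarrow> 'm \<Rightarrow> 'b set \<Rightarrow> 'b \<Rightarrow> 'b \<Rightarrow> 'b" where
  "connection_operator A F G B x0 m y u =
     (1/2) *\<^sub>R vector_derivative (\<lambda>t. spray_vector_field A F G B x0 m (y + t *\<^sub>R u)) (at 0)
     - (1/2) *\<^sub>R bracket_m G B x0 m y u"

end

theory Submission
  imports Defs
begin

text \<open>
  The first formula is Noether's theorem at time \<open>0\<close>. Let \<open>c\<close> be a geodesic starting at \<open>x0\<close> with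
  velocity \<open>y\<close>, \<open>cb\<close> its lift and \<open>Y\<close> the left velocity of the lift, so that \<open>Y 0 = y\<close> and
  \<open>\<eta> y = - Y' 0\<close>. Every \<open>u\<close> in the Lie algebra generates a Killing field on \<open>M\<close>, and pairing it with
  the fibre derivative of \<open>F\<^sup>2\<close> along \<open>c\<close> gives a conserved quantity: its derivative is the sum of
  the two terms of the Killing equation once the geodesic equation is written in Euler--Lagrange
  form (\<open>euler_lagrange\<close>, \<open>killing_equation\<close>). Translating by the isometry \<open>cb t\<close> back to \<open>x0\<close> turns
  this quantity into \<open>D q (Y t) (W t)\<close>, where \<open>q\<close> is the squared Minkowski norm and
  \<open>W t = Ad (inv (cb t)) u\<close> (\<open>D_E_orb\<close>, \<open>D_orb_right\<close>). Since \<open>W' 0 = [u, y]\<close>, differentiation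
  at \<open>0\<close> yields \<open>g\<^sub>y (Y' 0) u + g\<^sub>y y [u, y] = 0\<close>, which is \<open>spray_equation\<close>. The derivation applies to
  every geodesic and every lift with the given initial data, so it does not matter which ones the
  definition of \<open>\<eta>\<close> selects.

  The second formula follows by differentiating the first one along \<open>y + t v\<close>
  (\<open>connection_formula\<close>): the derivative of \<open>g\<^sub>y\<close> contributes the Cartan tensor, and the derivative of
  \<open>\<eta>\<close> exists because the first formula is a regular linear system for \<open>\<eta> y\<close> whose coefficients
  depend smoothly on \<open>y\<close> (\<open>spray_derivative\<close>).

  Both arguments need that the objects in the definition of \<open>\<eta>\<close> exist. Geodesics, curves in the
  isotropy group and lifts are solutions of ordinary differential equations (\<open>ode_solution\<close>). To
  solve the equation of the lift, the differential \<open>\<delta>\<close> of the orbit map must map \<open>m\<close> bijectively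
  onto the tangent space. It is injective since its kernel is the isotropy algebra (\<open>\<hh>_eq\<close>). It
  is onto by a measure argument (\<open>\<delta>_surj\<close>): otherwise the orbit map would send a neighbourhood of
  the identity to a null set, whereas countably many translates of that neighbourhood cover \<open>G\<close>,
  whose orbit is all of \<open>M\<close>.

  All computations take place in one chart of \<open>G\<close> at the identity and one chart of \<open>M\<close> at \<open>x0\<close>,
  where \<open>D f x v\<close> is the derivative of \<open>f\<close> at \<open>x\<close> in the direction \<open>v\<close>.
\<close>

section \<open>Smooth maps\<close>

abbreviation D :: "('a::real_normed_vector \<Rightarrow> 'b::real_normed_vector) \<Rightarrow> 'a \<Rightarrow> 'a \<Rightarrow> 'b" where
  "D f x \<equiv> frechet_derivative f (at x)"

lemma D_eq: "(f has_derivative f') (at x) \<Longrightarrow> D f x = f'"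
  by (rule frechet_derivative_at[symmetric])

lemma has_D: "f differentiable (at x) \<Longrightarrow> (f has_derivative D f x) (at x)"
  by (simp add: frechet_derivative_works[symmetric])

lemma linear_has_derivative:
  fixes L :: "'a::euclidean_space \<Rightarrow> 'b::real_normed_vector"
  shows "linear L \<Longrightarrow> (L has_derivative L) F"
  by (simp add: bounded_linear_imp_has_derivative linear_conv_bounded_linear)

lemma D_cong_open:
  assumes "open S" "x \<in> S" "\<And>y. y \<in> S \<Longrightarrow> f y = g y"
  shows "D f x = D g x"
proof -
  have "(f has_derivative f') (at x) \<longleftrightarrow> (g has_derivative f') (at x)" for f'
    using assms by (metis has_derivative_transform_within_open)
  thus ?thesis by (simp add: frechet_derivative_def)
qed

lemma Ck_on_cong:
  assumes "open S" "\<And>x. x \<in> S \<Longrightarrow> f x = g x"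
  shows "Ck_on k f S \<longleftrightarrow> Ck_on k g S"
  using assms(2)
proof (induction k arbitrary: f g)
  case 0 thus ?case by (simp cong: continuous_on_cong)
next
  case (Suc k)
  have "f differentiable (at x) \<longleftrightarrow> g differentiable (at x)" if "x \<in> S" for x
    unfolding differentiable_def using assms(1) Suc.prems that
    by (metis has_derivative_transform_within_open)
  moreover have "Ck_on k (\<lambda>x. D f x v) S \<longleftrightarrow> Ck_on k (\<lambda>x. D g x v) S" for v
    by (rule Suc.IH) (metis D_cong_open assms(1) Suc.prems)
  ultimately show ?case by auto
qed

lemma Ck_on_subset: "Ck_on k f S \<Longrightarrow> T \<subseteq> S \<Longrightarrow> Ck_on k f T"
  by (induction k arbitrary: f) (auto intro: continuous_on_subset)

lemma Ck_on_Suc_D: "Ck_on (Suc k) f S \<Longrightarrow> Ck_on k f S"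
proof (induction k arbitrary: f)
  case 0 thus ?case
    by (auto intro!: continuous_at_imp_continuous_on differentiable_imp_continuous_within)
next
  case (Suc k)
  hence "\<forall>v. Ck_on k (\<lambda>x. D f x v) S" using Suc.IH by (metis Ck_on.simps(2))
  thus ?case using Suc.prems by simp
qed

lemma Ck_on_SucI:
  assumes "open S" "\<And>x. x \<in> S \<Longrightarrow> (f has_derivative f' x) (at x)"
    "\<And>v. Ck_on k (\<lambda>x. f' x v) S"
  shows "Ck_on (Suc k) f S"
proof -
  have "D f x = f' x" if "x \<in> S" for x using assms(2)[OF that] by (rule D_eq)
  hence "Ck_on k (\<lambda>x. D f x v) S" for v
    using Ck_on_cong[OF assms(1), of "\<lambda>x. D f x v" "\<lambda>x. f' x v" k] assms(3) by simp
  thus ?thesis using assms(2) by (auto simp: differentiable_def)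
qed

lemma Ck_on_const: "open S \<Longrightarrow> Ck_on k (\<lambda>_. c) S"
proof (induction k arbitrary: c)
  case (Suc k) show ?case
    by (rule Ck_on_SucI[where f'="\<lambda>_ _. 0"]) (use Suc in auto)
qed simp

lemma Ck_on_bounded_linear: "bounded_linear L \<Longrightarrow> open S \<Longrightarrow> Ck_on k L S"
proof (cases k)
  case (Suc j) assume "bounded_linear L" "open S"
  thus ?thesis unfolding Suc
    by (intro Ck_on_SucI[where f'="\<lambda>_. L"]) (auto intro: bounded_linear_imp_has_derivative Ck_on_const)
qed (auto intro: linear_continuous_on)

lemma Ck_on_linear_compose:
  assumes "bounded_linear L" "open S"
  shows "Ck_on k f S \<Longrightarrow> Ck_on k (\<lambda>x. L (f x)) S"
proof (induction k arbitrary: f)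
  case 0 thus ?case
    using bounded_linear.continuous_on[OF assms(1)] by auto
next
  case (Suc k)
  show ?case
  proof (rule Ck_on_SucI[OF assms(2)])
    show "((\<lambda>x. L (f x)) has_derivative (\<lambda>v. L (D f x v))) (at x)" if "x \<in> S" for x
      using Suc.prems that by (auto intro!: bounded_linear.has_derivative[OF assms(1)] has_D)
    show "Ck_on k (\<lambda>x. L (D f x v)) S" for v using Suc by auto
  qed
qed

lemma Ck_on_add:
  assumes "open S"
  shows "Ck_on k f S \<Longrightarrow> Ck_on k g S \<Longrightarrow> Ck_on k (\<lambda>x. f x + g x) S"
proof (induction k arbitrary: f g)
  case 0 thus ?case by (auto intro: continuous_on_add)
next
  case (Suc k)
  show ?case
  proof (rule Ck_on_SucI[OF assms])
    show "((\<lambda>x. f x + g x) has_derivative (\<lambda>v. D f x v + D g x v)) (at x)" if "x \<in> S" for x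
      using Suc.prems that by (auto intro!: has_derivative_add has_D)
    show "Ck_on k (\<lambda>x. D f x v + D g x v) S" for v using Suc by auto
  qed
qed

lemma Ck_on_bilinear:
  assumes "bounded_bilinear p" "open S"
  shows "Ck_on k f S \<Longrightarrow> Ck_on k g S \<Longrightarrow> Ck_on k (\<lambda>x. p (f x) (g x)) S"
proof (induction k arbitrary: f g)
  case 0 thus ?case by (auto intro: bounded_bilinear.continuous_on[OF assms(1)])
next
  case (Suc k)
  show ?case
  proof (rule Ck_on_SucI[OF assms(2)])
    show "((\<lambda>x. p (f x) (g x)) has_derivative (\<lambda>v. p (f x) (D g x v) + p (D f x v) (g x))) (at x)"
      if "x \<in> S" for x
      using Suc.prems that by (auto intro!: bounded_bilinear.FDERIV[OF assms(1)] has_D)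
    show "Ck_on k (\<lambda>x. p (f x) (D g x v) + p (D f x v) (g x)) S" for v
      using Suc.prems Suc.IH Ck_on_Suc_D[OF Suc.prems(1)] Ck_on_Suc_D[OF Suc.prems(2)]
      by (intro Ck_on_add[OF assms(2)]) auto
  qed
qed

lemma Ck_on_sum:
  assumes "open S"
  shows "(\<And>i. i \<in> I \<Longrightarrow> Ck_on k (f i) S) \<Longrightarrow> Ck_on k (\<lambda>x. \<Sum>i\<in>I. f i x) S"
  by (induction I rule: infinite_finite_induct) (auto intro: Ck_on_const assms Ck_on_add)

text \<open>Smoothness only speaks of derivatives in a fixed direction. Where the direction varies with the
  point, as in the chain rule, it is expanded in a basis.\<close>

lemma D_euclidean_sum:
  fixes f :: "'a::euclidean_space \<Rightarrow> 'b::real_normed_vector"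
  assumes "f differentiable (at x)"
  shows "D f x v = (\<Sum>b\<in>Basis. (v \<bullet> b) *\<^sub>R D f x b)"
proof -
  have "linear (D f x)" using has_D[OF assms] by (rule has_derivative_linear)
  hence "D f x (\<Sum>b\<in>Basis. (v \<bullet> b) *\<^sub>R b) = (\<Sum>b\<in>Basis. (v \<bullet> b) *\<^sub>R D f x b)"
    by (simp add: linear_sum linear_cmul)
  thus ?thesis by (simp add: euclidean_representation)
qed

lemma Ck_on_compose:
  fixes f :: "'b::euclidean_space \<Rightarrow> 'c::real_normed_vector" and g :: "'a::real_normed_vector \<Rightarrow> 'b"
  assumes "open S" "\<And>x. x \<in> S \<Longrightarrow> g x \<in> T"
  shows "Ck_on k f T \<Longrightarrow> Ck_on k g S \<Longrightarrow> Ck_on k (\<lambda>x. f (g x)) S"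
proof (induction k arbitrary: f)
  case 0 thus ?case using assms(2) by (auto intro: continuous_on_compose2[of T f])
next
  case (Suc k)
  show ?case
  proof (rule Ck_on_SucI[OF assms(1)])
    show "((\<lambda>x. f (g x)) has_derivative (\<lambda>v. \<Sum>b\<in>Basis. (D g x v \<bullet> b) *\<^sub>R D f (g x) b)) (at x)"
      if "x \<in> S" for x
    proof -
      have f: "f differentiable (at (g x))" and g: "g differentiable (at x)"
        using Suc.prems that assms(2) by auto
      have "((\<lambda>x. f (g x)) has_derivative (\<lambda>v. D f (g x) (D g x v))) (at x)"
        using has_derivative_compose[OF has_D[OF g] has_D[OF f]] .
      thus ?thesis by (simp only: D_euclidean_sum[OF f, symmetric])
    qed
    show "Ck_on k (\<lambda>x. \<Sum>b\<in>Basis. (D g x v \<bullet> b) *\<^sub>R D f (g x) b) S" for v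
    proof (rule Ck_on_sum[OF assms(1)])
      fix b :: 'b
      have "Ck_on k (\<lambda>x. D g x v) S" "Ck_on k (\<lambda>y. D f y b) T" using Suc.prems by auto
      from Ck_on_linear_compose[OF bounded_linear_inner_left assms(1) this(1)]
        Suc.IH[OF this(2) Ck_on_Suc_D[OF Suc.prems(2)]]
      show "Ck_on k (\<lambda>x. (D g x v \<bullet> b) *\<^sub>R D f (g x) b) S"
        by (rule Ck_on_bilinear[OF bounded_bilinear_scaleR assms(1)])
    qed
  qed
qed

lemma smooth_onD: "smooth_on f S \<Longrightarrow> Ck_on k f S" by (simp add: smooth_on_def)

lemma smooth_on_cong:
  "open S \<Longrightarrow> (\<And>x. x \<in> S \<Longrightarrow> f x = g x) \<Longrightarrow> smooth_on f S \<longleftrightarrow> smooth_on g S"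
  unfolding smooth_on_def using Ck_on_cong by blast

lemma smooth_on_subset: "smooth_on f S \<Longrightarrow> T \<subseteq> S \<Longrightarrow> smooth_on f T"
  unfolding smooth_on_def using Ck_on_subset by blast

lemma smooth_on_const: "open S \<Longrightarrow> smooth_on (\<lambda>_. c) S"
  by (simp add: smooth_on_def Ck_on_const)

lemma smooth_on_bounded_linear: "bounded_linear L \<Longrightarrow> open S \<Longrightarrow> smooth_on L S"
  by (simp add: smooth_on_def Ck_on_bounded_linear)

lemma smooth_on_id: "open S \<Longrightarrow> smooth_on (\<lambda>x. x) S"
  by (rule smooth_on_bounded_linear) auto

lemma smooth_on_linear:
  fixes L :: "'a::euclidean_space \<Rightarrow> 'b::real_normed_vector"
  shows "linear L \<Longrightarrow> open S \<Longrightarrow> smooth_on L S"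
  using smooth_on_bounded_linear linear_conv_bounded_linear by blast

lemma smooth_on_linear_compose:
  "bounded_linear L \<Longrightarrow> open S \<Longrightarrow> smooth_on f S \<Longrightarrow> smooth_on (\<lambda>x. L (f x)) S"
  by (simp add: smooth_on_def Ck_on_linear_compose)

lemma smooth_on_add: "open S \<Longrightarrow> smooth_on f S \<Longrightarrow> smooth_on g S \<Longrightarrow> smooth_on (\<lambda>x. f x + g x) S"
  by (simp add: smooth_on_def Ck_on_add)

lemma smooth_on_bilinear:
  "bounded_bilinear p \<Longrightarrow> open S \<Longrightarrow> smooth_on f S \<Longrightarrow> smooth_on g S \<Longrightarrow> smooth_on (\<lambda>x. p (f x) (g x)) S"
  by (simp add: smooth_on_def Ck_on_bilinear)

lemmas smooth_on_mult = smooth_on_bilinear[OF bounded_bilinear_mult]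
lemmas smooth_on_scaleR = smooth_on_bilinear[OF bounded_bilinear_scaleR]

lemma smooth_on_uminus: "open S \<Longrightarrow> smooth_on f S \<Longrightarrow> smooth_on (\<lambda>x. - f x) S"
  by (rule smooth_on_linear_compose[OF bounded_linear_minus[OF bounded_linear_ident]])

lemma smooth_on_diff:
  "open S \<Longrightarrow> smooth_on f S \<Longrightarrow> smooth_on g S \<Longrightarrow> smooth_on (\<lambda>x. f x - g x) S"
  using smooth_on_add[of S f "\<lambda>x. - g x"] smooth_on_uminus[of S g] by simp

lemma smooth_on_sum:
  "open S \<Longrightarrow> (\<And>i. i \<in> I \<Longrightarrow> smooth_on (f i) S) \<Longrightarrow> smooth_on (\<lambda>x. \<Sum>i\<in>I. f i x) S"
  by (simp add: smooth_on_def Ck_on_sum)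

lemma smooth_on_prod:
  fixes f :: "'i \<Rightarrow> 'a::real_normed_vector \<Rightarrow> real"
  assumes "open S"
  shows "(\<And>i. i \<in> I \<Longrightarrow> smooth_on (f i) S) \<Longrightarrow> smooth_on (\<lambda>x. \<Prod>i\<in>I. f i x) S"
proof (induction I rule: infinite_finite_induct)
  case (insert i I)
  hence "smooth_on (\<lambda>x. f i x * (\<Prod>i\<in>I. f i x)) S"
    by (intro smooth_on_mult[OF assms]) auto
  thus ?case using insert by simp
qed (auto intro: smooth_on_const assms)

lemma smooth_on_compose:
  fixes f :: "'b::euclidean_space \<Rightarrow> 'c::real_normed_vector" and g :: "'a::real_normed_vector \<Rightarrow> 'b"
  assumes "smooth_on f T" "smooth_on g S" "open S" "\<And>x. x \<in> S \<Longrightarrow> g x \<in> T"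
  shows "smooth_on (\<lambda>x. f (g x)) S"
  unfolding smooth_on_def
proof
  show "Ck_on k (\<lambda>x. f (g x)) S" for k
    by (rule Ck_on_compose[OF assms(3,4) smooth_onD[OF assms(1)] smooth_onD[OF assms(2)]])
qed

lemma smooth_on_Pair:
  assumes "open S" "smooth_on f S" "smooth_on g S"
  shows "smooth_on (\<lambda>x. (f x, g x)) S"
proof -
  have "smooth_on (\<lambda>x. (f x, 0) + (0, g x)) S"
    by (rule smooth_on_add[OF assms(1)
        smooth_on_linear_compose[OF bounded_linear_Pair[OF bounded_linear_ident bounded_linear_zero] assms(1,2)]
        smooth_on_linear_compose[OF bounded_linear_Pair[OF bounded_linear_zero bounded_linear_ident] assms(1,3)]])
  thus ?thesis by simp
qed

lemma smooth_on_fst: "open S \<Longrightarrow> smooth_on f S \<Longrightarrow> smooth_on (\<lambda>x. fst (f x)) S"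
  by (rule smooth_on_linear_compose[OF bounded_linear_fst])

lemma smooth_on_snd: "open S \<Longrightarrow> smooth_on f S \<Longrightarrow> smooth_on (\<lambda>x. snd (f x)) S"
  by (rule smooth_on_linear_compose[OF bounded_linear_snd])

lemma smooth_on_differentiable: "smooth_on f S \<Longrightarrow> x \<in> S \<Longrightarrow> f differentiable (at x)"
  using smooth_onD[of f S "Suc 0"] by simp

lemma smooth_on_continuous: "smooth_on f S \<Longrightarrow> continuous_on S f"
  using smooth_onD[of f S 0] by simp

lemma smooth_on_has_D: "smooth_on f S \<Longrightarrow> x \<in> S \<Longrightarrow> (f has_derivative D f x) (at x)"
  by (intro has_D smooth_on_differentiable)

lemma smooth_on_D: "smooth_on f S \<Longrightarrow> smooth_on (\<lambda>x. D f x v) S"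
  unfolding smooth_on_def using Ck_on.simps(2) by blast

lemma linear_D: "smooth_on f S \<Longrightarrow> x \<in> S \<Longrightarrow> linear (D f x)"
  by (rule has_derivative_linear[OF smooth_on_has_D])

lemma
  fixes f :: "'a::real_normed_vector \<times> 'b::real_normed_vector \<Rightarrow> 'c::real_normed_vector"
  assumes "smooth_on f S" "z \<in> S"
  shows linear_D_fst: "linear (\<lambda>v. D f z (v, 0))" and linear_D_snd: "linear (\<lambda>w. D f z (0, w))"
proof -
  have "linear (\<lambda>v :: 'a. (v, 0 :: 'b))" "linear (\<lambda>w :: 'b. (0 :: 'a, w))" by (auto intro!: linearI)
  from linear_compose[OF this(1) linear_D[OF assms]] linear_compose[OF this(2) linear_D[OF assms]]
  show "linear (\<lambda>v. D f z (v, 0))" "linear (\<lambda>w. D f z (0, w))" by (simp_all add: o_def)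
qed

lemma smooth_on_D_apply:
  fixes f :: "'b::euclidean_space \<Rightarrow> 'c::real_normed_vector" and g h :: "'a::real_normed_vector \<Rightarrow> 'b"
  assumes "smooth_on f T" "open S" "smooth_on g S" "smooth_on h S" "\<And>x. x \<in> S \<Longrightarrow> g x \<in> T"
  shows "smooth_on (\<lambda>x. D f (g x) (h x)) S"
proof -
  have "smooth_on (\<lambda>x. \<Sum>b\<in>Basis. (h x \<bullet> b) *\<^sub>R D f (g x) b) S"
    by (rule smooth_on_sum[OF assms(2) smooth_on_scaleR[OF assms(2)
        smooth_on_linear_compose[OF bounded_linear_inner_left assms(2,4)]
        smooth_on_compose[OF smooth_on_D[OF assms(1)] assms(3,2,5)]]])
  moreover have "(\<Sum>b\<in>Basis. (h x \<bullet> b) *\<^sub>R D f (g x) b) = D f (g x) (h x)" if "x \<in> S" for x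
    by (rule D_euclidean_sum[OF smooth_on_differentiable[OF assms(1) assms(5)[OF that]], symmetric])
  ultimately show ?thesis
    using smooth_on_cong[OF assms(2), of "\<lambda>x. D f (g x) (h x)"] by (metis (no_types, lifting))
qed

lemma Ck_on_inverse: "Ck_on k (inverse :: real \<Rightarrow> real) (- {0})"
proof (induction k)
  case 0 thus ?case by (auto intro!: continuous_intros)
next
  case (Suc k)
  show ?case
  proof (rule Ck_on_SucI)
    show "(inverse has_derivative (\<lambda>v. - (inverse x * v * inverse x))) (at x)"
      if "x \<in> - {0}" for x :: real
      using that by (intro has_derivative_inverse') auto
    have "Ck_on k (\<lambda>x. (- v) * (inverse x * inverse x :: real)) (- {0})" for v
      by (intro Ck_on_bilinear[OF bounded_bilinear_mult] Suc.IH Ck_on_const) auto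
    thus "Ck_on k (\<lambda>x. - (inverse x * v * inverse x) :: real) (- {0})" for v
      by (simp add: mult.commute mult.left_commute)
  qed auto
qed

lemma smooth_on_divide:
  fixes f g :: "'a::real_normed_vector \<Rightarrow> real"
  assumes "open S" "smooth_on f S" "smooth_on g S" "\<And>x. x \<in> S \<Longrightarrow> g x \<noteq> 0"
  shows "smooth_on (\<lambda>x. f x / g x) S"
proof -
  have "smooth_on inverse (- {0::real})" by (simp add: smooth_on_def Ck_on_inverse)
  from smooth_on_compose[OF this assms(3,1)] assms(4)
  have "smooth_on (\<lambda>x. inverse (g x)) S" by simp
  from smooth_on_mult[OF assms(1,2) this] show ?thesis by (simp add: divide_inverse)
qed

lemma smooth_on_det:
  fixes M :: "'a::real_normed_vector \<Rightarrow> real^'n^'n"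
  assumes "open S" "\<And>i j. smooth_on (\<lambda>x. M x $ i $ j) S"
  shows "smooth_on (\<lambda>x. det (M x)) S"
  unfolding det_def using assms
  by (intro smooth_on_sum[OF assms(1)] smooth_on_mult[OF assms(1)] smooth_on_const[OF assms(1)]
      smooth_on_prod[OF assms(1)] assms(2))

lemma smooth_on_vec:
  fixes f :: "'a::real_normed_vector \<Rightarrow> real^'n"
  assumes "open S" "\<And>i. smooth_on (\<lambda>x. f x $ i) S"
  shows "smooth_on f S"
proof -
  have eq: "(\<Sum>i\<in>UNIV. (f x $ i) *\<^sub>R axis i (1::real)) = f x" for x
    using basis_expansion[of "f x"] by (simp add: scalar_mult_eq_scaleR)
  have "smooth_on (\<lambda>x. \<Sum>i\<in>UNIV. (f x $ i) *\<^sub>R axis i (1::real)) S"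
    by (rule smooth_on_sum[OF assms(1) smooth_on_scaleR[OF assms smooth_on_const[OF assms(1)]]])
  thus ?thesis by (simp only: eq)
qed

lemma smooth_on_nth:
  fixes f :: "'a::real_normed_vector \<Rightarrow> real^'n"
  shows "open S \<Longrightarrow> smooth_on f S \<Longrightarrow> smooth_on (\<lambda>x. f x $ i) S"
  by (rule smooth_on_linear_compose[OF bounded_linear_vec_nth])

text \<open>By Cramer's rule the solution of a regular linear system is a rational function of the
  coefficients and the right-hand side.\<close>

lemma smooth_on_linear_system:
  fixes M :: "'a::real_normed_vector \<Rightarrow> real^'n^'n" and r s :: "'a \<Rightarrow> real^'n"
  assumes "open S" "\<And>i j. smooth_on (\<lambda>x. M x $ i $ j) S" "smooth_on r S"
    and "\<And>x. x \<in> S \<Longrightarrow> det (M x) \<noteq> 0" "\<And>x. x \<in> S \<Longrightarrow> M x *v s x = r x"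
  shows "smooth_on s S"
proof -
  have "smooth_on (\<lambda>x. \<chi> k. det (\<chi> i j. if j = k then r x $ i else M x $ i $ j) / det (M x)) S"
  proof (rule smooth_on_vec[OF assms(1)], unfold vec_lambda_beta, rule smooth_on_divide[OF assms(1)])
    fix k
    have "smooth_on (\<lambda>x. if j = k then r x $ i else M x $ i $ j) S" for i j
      using smooth_on_nth[OF assms(1,3)] assms(2) by (cases "j = k") auto
    thus "smooth_on (\<lambda>x. det (\<chi> i j. if j = k then r x $ i else M x $ i $ j)) S"
      by (intro smooth_on_det[OF assms(1)]) simp
    show "smooth_on (\<lambda>x. det (M x)) S" by (rule smooth_on_det[OF assms(1,2)])
  qed (use assms(4) in auto)
  moreover have "s x = (\<chi> k. det (\<chi> i j. if j = k then r x $ i else M x $ i $ j) / det (M x))"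
    if "x \<in> S" for x
    using cramer[OF assms(4)[OF that]] assms(5)[OF that] by blast
  ultimately show ?thesis using smooth_on_cong[OF assms(1), of s] by auto
qed

lemma D_compose:
  assumes "f differentiable (at (g x))" "g differentiable (at x)"
  shows "D (\<lambda>x. f (g x)) x v = D f (g x) (D g x v)"
  using D_eq[OF has_derivative_compose[OF has_D[OF assms(2)] has_D[OF assms(1)]]] by simp

text \<open>For a real-valued function both mixed second derivatives approximate the same second
  difference quotient; by two applications of the mean value theorem they take a common value
  at points arbitrarily close to \<open>x\<close>.\<close>

lemma second_difference:
  fixes f :: "'a::real_normed_vector \<Rightarrow> real"
  assumes "smooth_on f S" "0 < s"
    and S: "\<And>a b. 0 \<le> a \<Longrightarrow> a \<le> s \<Longrightarrow> 0 \<le> b \<Longrightarrow> b \<le> s \<Longrightarrow> x + a *\<^sub>R u + b *\<^sub>R v \<in> S"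
  shows "\<exists>a b. 0 < a \<and> a < s \<and> 0 < b \<and> b < s \<and>
    f (x + s *\<^sub>R u + s *\<^sub>R v) - f (x + s *\<^sub>R u) - f (x + s *\<^sub>R v) + f x =
      s\<^sup>2 * D (\<lambda>x. D f x u) (x + a *\<^sub>R u + b *\<^sub>R v) v"
proof -
  have d1: "((\<lambda>a. f (x + a *\<^sub>R u + b *\<^sub>R v)) has_real_derivative D f (x + a *\<^sub>R u + b *\<^sub>R v) u) (at a)"
    if "0 \<le> a" "a \<le> s" "0 \<le> b" "b \<le> s" for a b
  proof -
    have "((\<lambda>a. x + a *\<^sub>R u + b *\<^sub>R v) has_derivative (\<lambda>h. h *\<^sub>R u)) (at a)"
      by (auto intro!: derivative_eq_intros)
    from has_derivative_compose[OF this smooth_on_has_D[OF assms(1) S[OF that]]]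
    have "((\<lambda>a. f (x + a *\<^sub>R u + b *\<^sub>R v)) has_derivative (\<lambda>h. D f (x + a *\<^sub>R u + b *\<^sub>R v) (h *\<^sub>R u))) (at a)" .
    thus ?thesis
      using linear_cmul[OF linear_D[OF assms(1) S[OF that]]]
      by (simp add: has_field_derivative_def mult.commute[of _ "D f _ _"])
  qed
  have d2: "((\<lambda>b. D f (x + a *\<^sub>R u + b *\<^sub>R v) u) has_real_derivative
      D (\<lambda>x. D f x u) (x + a *\<^sub>R u + b *\<^sub>R v) v) (at b)"
    if "0 \<le> a" "a \<le> s" "0 \<le> b" "b \<le> s" for a b
  proof -
    have "((\<lambda>b. x + a *\<^sub>R u + b *\<^sub>R v) has_derivative (\<lambda>h. h *\<^sub>R v)) (at b)"
      by (auto intro!: derivative_eq_intros)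
    from has_derivative_compose[OF this smooth_on_has_D[OF smooth_on_D[OF assms(1)] S[OF that]]]
    have "((\<lambda>b. D f (x + a *\<^sub>R u + b *\<^sub>R v) u) has_derivative
      (\<lambda>h. D (\<lambda>x. D f x u) (x + a *\<^sub>R u + b *\<^sub>R v) (h *\<^sub>R v))) (at b)" .
    thus ?thesis
      using linear_cmul[OF linear_D[OF smooth_on_D[OF assms(1)] S[OF that]]]
      by (simp add: has_field_derivative_def mult.commute[of _ "D _ _ _"])
  qed
  define \<phi> where "\<phi> a = f (x + a *\<^sub>R u + s *\<^sub>R v) - f (x + a *\<^sub>R u + 0 *\<^sub>R v)" for a
  have "(\<phi> has_real_derivative D f (x + a *\<^sub>R u + s *\<^sub>R v) u - D f (x + a *\<^sub>R u + 0 *\<^sub>R v) u) (at a)"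
    if "0 \<le> a" "a \<le> s" for a
    unfolding \<phi>_def using that assms(2) by (intro DERIV_diff d1) auto
  from MVT2[OF assms(2) this] obtain a where a: "0 < a" "a < s"
    "\<phi> s - \<phi> 0 = (s - 0) * (D f (x + a *\<^sub>R u + s *\<^sub>R v) u - D f (x + a *\<^sub>R u + 0 *\<^sub>R v) u)"
    by auto
  have "\<exists>b. 0 < b \<and> b < s \<and> D f (x + a *\<^sub>R u + s *\<^sub>R v) u - D f (x + a *\<^sub>R u + 0 *\<^sub>R v) u
      = (s - 0) * D (\<lambda>x. D f x u) (x + a *\<^sub>R u + b *\<^sub>R v) v"
    using a by (intro MVT2[OF assms(2) d2]) auto
  then obtain b where b: "0 < b" "b < s" "D f (x + a *\<^sub>R u + s *\<^sub>R v) u - D f (x + a *\<^sub>R u + 0 *\<^sub>R v) u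
      = s * D (\<lambda>x. D f x u) (x + a *\<^sub>R u + b *\<^sub>R v) v" by auto
  have "\<phi> s - \<phi> 0 = s\<^sup>2 * D (\<lambda>x. D f x u) (x + a *\<^sub>R u + b *\<^sub>R v) v"
    using a(3) b(3) by (simp add: power2_eq_square)
  thus ?thesis using a b unfolding \<phi>_def by (intro exI[of _ a] exI[of _ b]) auto
qed

lemma second_derivative_symmetric_real:
  fixes f :: "'a::real_normed_vector \<Rightarrow> real"
  assumes "smooth_on f S" "open S" "x \<in> S"
  shows "D (\<lambda>x. D f x u) x v = D (\<lambda>x. D f x v) x u"
proof (rule ccontr)
  define P where "P = (\<lambda>x. D (\<lambda>x. D f x u) x v)"
  define Q where "Q = (\<lambda>x. D (\<lambda>x. D f x v) x u)"
  assume "\<not> ?thesis"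
  hence e: "0 < \<bar>P x - Q x\<bar> / 2" (is "0 < ?e") by (auto simp: P_def Q_def)
  have "continuous_on S P" "continuous_on S Q" unfolding P_def Q_def
    by (intro smooth_on_continuous smooth_on_D assms(1))+
  hence "isCont P x" "isCont Q x" using assms by (auto simp: continuous_on_eq_continuous_at)
  then obtain d1 d2 where d: "d1 > 0" "\<And>y. dist y x < d1 \<Longrightarrow> dist (P y) (P x) < ?e"
      "d2 > 0" "\<And>y. dist y x < d2 \<Longrightarrow> dist (Q y) (Q x) < ?e"
    using e unfolding continuous_at_eps_delta by metis
  obtain d3 where d3: "d3 > 0" "ball x d3 \<subseteq> S" using assms openE by blast
  define d where "d = min d1 (min d2 d3)"
  define s where "s = d / (2 * (norm u + norm v + 1))"
  have dpos: "d > 0" using d d3 by (simp add: d_def)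
  have npos: "norm u + norm v + 1 > 0" by (smt (verit) norm_ge_zero)
  have s: "s > 0" using dpos npos by (simp add: s_def)
  have near: "dist (x + a *\<^sub>R u + b *\<^sub>R v) x < d" if "0 \<le> a" "a \<le> s" "0 \<le> b" "b \<le> s" for a b
  proof -
    have "dist (x + a *\<^sub>R u + b *\<^sub>R v) x = norm (a *\<^sub>R u + b *\<^sub>R v)"
      by (simp add: dist_norm algebra_simps)
    also have "\<dots> \<le> a * norm u + b * norm v" using that norm_triangle_ineq[of "a *\<^sub>R u" "b *\<^sub>R v"] by simp
    also have "\<dots> \<le> s * norm u + s * norm v" using that by (intro add_mono mult_right_mono) auto
    also have "\<dots> < 2 * (s * (norm u + norm v + 1))"
    proof -
      have "s * norm u \<ge> 0" "s * norm v \<ge> 0" using s by auto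
      moreover have "2 * (s * (norm u + norm v + 1)) = 2 * (s * norm u) + 2 * (s * norm v) + 2 * s"
        by (simp add: algebra_simps)
      ultimately show ?thesis using s by linarith
    qed
    also have "\<dots> = d"
    proof -
      have "2 * (d / (2 * N) * N) = d" if "N > 0" for N :: real using that by simp
      from this[OF npos] show ?thesis by (simp only: s_def)
    qed
    finally show ?thesis .
  qed
  have S: "x + a *\<^sub>R u + b *\<^sub>R v \<in> S" if "0 \<le> a" "a \<le> s" "0 \<le> b" "b \<le> s" for a b
    using near[OF that] d3 by (auto simp: d_def dist_commute subset_iff)
  have S': "x + b *\<^sub>R v + a *\<^sub>R u \<in> S" if "0 \<le> b" "b \<le> s" "0 \<le> a" "a \<le> s" for a b
    using S[OF that(3,4,1,2)] by (simp add: algebra_simps)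
  obtain a b where ab: "0 < a" "a < s" "0 < b" "b < s"
    "f (x + s *\<^sub>R u + s *\<^sub>R v) - f (x + s *\<^sub>R u) - f (x + s *\<^sub>R v) + f x = s\<^sup>2 * P (x + a *\<^sub>R u + b *\<^sub>R v)"
    using second_difference[OF assms(1) s S] unfolding P_def by blast
  obtain b' a' where ab': "0 < a'" "a' < s" "0 < b'" "b' < s"
    "f (x + s *\<^sub>R v + s *\<^sub>R u) - f (x + s *\<^sub>R v) - f (x + s *\<^sub>R u) + f x = s\<^sup>2 * Q (x + b' *\<^sub>R v + a' *\<^sub>R u)"
    using second_difference[OF assms(1) s S'] unfolding Q_def by blast
  have "s\<^sup>2 * P (x + a *\<^sub>R u + b *\<^sub>R v) = s\<^sup>2 * Q (x + a' *\<^sub>R u + b' *\<^sub>R v)"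
    using ab(5) ab'(5) by (simp add: algebra_simps)
  hence eq: "P (x + a *\<^sub>R u + b *\<^sub>R v) = Q (x + a' *\<^sub>R u + b' *\<^sub>R v)" using s by simp
  have "dist (P (x + a *\<^sub>R u + b *\<^sub>R v)) (P x) < ?e" "dist (Q (x + a' *\<^sub>R u + b' *\<^sub>R v)) (Q x) < ?e"
    using near[of a b] near[of a' b'] ab ab' by (intro d(2) d(4); simp add: d_def)+
  thus False using eq by (auto simp: dist_real_def abs_if split: if_splits)
qed

lemma second_derivative_symmetric:
  fixes f :: "'a::real_normed_vector \<Rightarrow> 'b::euclidean_space"
  assumes "smooth_on f S" "open S" "x \<in> S"
  shows "D (\<lambda>x. D f x u) x v = D (\<lambda>x. D f x v) x u"
proof (rule euclidean_eqI)
  fix b :: 'b assume "b \<in> Basis"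
  have s: "smooth_on (\<lambda>x. f x \<bullet> b) S"
    by (rule smooth_on_linear_compose[OF bounded_linear_inner_left assms(2,1)])
  have 1: "D (\<lambda>x. f x \<bullet> b) y w = D f y w \<bullet> b" if "y \<in> S" for y w
    using D_eq[OF bounded_linear.has_derivative[OF bounded_linear_inner_left smooth_on_has_D[OF assms(1) that]]]
    by metis
  have 2: "D (\<lambda>x. D (\<lambda>x. f x \<bullet> b) x w) x w' = D (\<lambda>x. D f x w) x w' \<bullet> b" for w w'
  proof -
    have "D (\<lambda>x. D (\<lambda>x. f x \<bullet> b) x w) x w' = D (\<lambda>x. D f x w \<bullet> b) x w'"
      using D_cong_open[OF assms(2,3), of "\<lambda>x. D (\<lambda>x. f x \<bullet> b) x w" "\<lambda>x. D f x w \<bullet> b"] 1 by simp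
    also have "\<dots> = D (\<lambda>x. D f x w) x w' \<bullet> b"
      using D_eq[OF bounded_linear.has_derivative[OF bounded_linear_inner_left
          smooth_on_has_D[OF smooth_on_D[OF assms(1)] assms(3)]]]
      by metis
    finally show ?thesis .
  qed
  show "D (\<lambda>x. D f x u) x v \<bullet> b = D (\<lambda>x. D f x v) x u \<bullet> b"
    using second_derivative_symmetric_real[OF s assms(2,3), of u v] 2 by simp
qed

section \<open>Ordinary differential equations\<close>

lemma vector_derivative_bound:
  fixes f :: "real \<Rightarrow> 'a::real_normed_vector"
  assumes "convex S" "\<And>t. t \<in> S \<Longrightarrow> (f has_vector_derivative f' t) (at t within S)"
    and "\<And>t. t \<in> S \<Longrightarrow> norm (f' t) \<le> B" "s \<in> S" "t \<in> S"
  shows "norm (f t - f s) \<le> B * \<bar>t - s\<bar>"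
proof -
  have "onorm (\<lambda>h. h *\<^sub>R f' t) \<le> B" if "t \<in> S" for t
  proof (rule onorm_le)
    fix h :: real
    show "norm (h *\<^sub>R f' t) \<le> B * norm h"
      using mult_right_mono[OF assms(3)[OF that], of "\<bar>h\<bar>"] by (simp add: mult.commute)
  qed
  moreover have "(f has_derivative (\<lambda>h. h *\<^sub>R f' t)) (at t within S)" if "t \<in> S" for t
    using assms(2)[OF that] by (simp add: has_vector_derivative_def)
  ultimately have "norm (f t - f s) \<le> B * norm (t - s)"
    by (intro differentiable_bound[OF assms(1), where f'="\<lambda>t h. h *\<^sub>R f' t"] assms(4,5))
  thus ?thesis by simp
qed

lemma smooth_on_locally_Lipschitz:
  fixes f :: "'a::euclidean_space \<Rightarrow> 'b::euclidean_space"
  assumes "smooth_on f S" "cball x r \<subseteq> S"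
  obtains L where "0 \<le> L" "\<And>a b. a \<in> cball x r \<Longrightarrow> b \<in> cball x r \<Longrightarrow> norm (f a - f b) \<le> L * norm (a - b)"
proof -
  have "\<exists>K. 0 \<le> K \<and> (\<forall>y\<in>cball x r. norm (D f y b) \<le> K)" for b
  proof -
    have "continuous_on (cball x r) (\<lambda>y. D f y b)"
      using smooth_on_continuous[OF smooth_on_D[OF assms(1)]] assms(2) by (rule continuous_on_subset)
    from compact_continuous_image[OF this compact_cball]
    obtain K where "0 < K" "\<forall>z\<in>(\<lambda>y. D f y b) ` cball x r. norm z \<le> K"
      using compact_imp_bounded bounded_pos by metis
    thus ?thesis by (intro exI[of _ K]) auto
  qed
  then obtain K where K: "\<And>b. 0 \<le> K b" "\<And>b y. y \<in> cball x r \<Longrightarrow> norm (D f y b) \<le> K b" by metis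
  show thesis
  proof (rule that)
    show "0 \<le> (\<Sum>b\<in>Basis. K b)" by (rule sum_nonneg) (rule K(1))
    fix a b assume ab: "a \<in> cball x r" "b \<in> cball x r"
    show "norm (f a - f b) \<le> (\<Sum>b\<in>Basis. K b) * norm (a - b)"
    proof (rule differentiable_bound[OF convex_cball _ _ ab])
      fix y assume y: "y \<in> cball x r"
      have d: "f differentiable (at y)" using smooth_on_differentiable[OF assms(1)] y assms(2) by blast
      show "(f has_derivative D f y) (at y within cball x r)"
        using has_derivative_at_withinI[OF has_D[OF d]] .
      show "onorm (D f y) \<le> (\<Sum>b\<in>Basis. K b)"
      proof (rule onorm_le)
        fix v
        have "norm (D f y v) \<le> (\<Sum>b\<in>Basis. norm ((v \<bullet> b) *\<^sub>R D f y b))"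
          unfolding D_euclidean_sum[OF d, of v] by (rule norm_sum)
        also have "\<dots> \<le> (\<Sum>b\<in>Basis. norm v * K b)"
          using K y by (intro sum_mono) (auto intro!: mult_mono Basis_le_norm)
        finally show "norm (D f y v) \<le> (\<Sum>b\<in>Basis. K b) * norm v"
          by (simp add: sum_distrib_left mult.commute)
      qed
    qed
  qed
qed

text \<open>The solution is the fixed point of the Picard operator. The integral from \<open>0\<close> to \<open>t\<close> is
  written as a difference of integrals from \<open>-\<epsilon>\<close>, so that negative times need no separate
  treatment, and the time is clamped to \<open>[-\<epsilon>, \<epsilon>]\<close> so that the operator acts on the complete
  metric space of bounded continuous functions on the real line. A solution is as smooth as its
  own derivative \<open>X \<circ> x\<close>, hence smooth.\<close>

lemma ode_solution:
  fixes X :: "'a::euclidean_space \<Rightarrow> 'a"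
  assumes "smooth_on X S" "open S" "x0 \<in> S"
  obtains \<epsilon> x where "0 < \<epsilon>" "x 0 = x0" "smooth_on x {-\<epsilon><..<\<epsilon>}"
    "\<And>t. t \<in> {-\<epsilon><..<\<epsilon>} \<Longrightarrow> x t \<in> S"
    "\<And>t. t \<in> {-\<epsilon><..<\<epsilon>} \<Longrightarrow> (x has_vector_derivative X (x t)) (at t)"
proof -
  obtain r where r: "0 < r" "cball x0 r \<subseteq> S" using assms(2,3) open_contains_cball by blast
  obtain L where L: "0 \<le> L"
    "\<And>a b. a \<in> cball x0 r \<Longrightarrow> b \<in> cball x0 r \<Longrightarrow> norm (X a - X b) \<le> L * norm (a - b)"
    using smooth_on_locally_Lipschitz[OF assms(1) r(2)] by blast
  have contX: "continuous_on (cball x0 r) X"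
    using smooth_on_continuous[OF assms(1)] r(2) by (rule continuous_on_subset)
  obtain M where M: "0 < M" "\<And>a. a \<in> cball x0 r \<Longrightarrow> norm (X a) \<le> M"
    using compact_imp_bounded[OF compact_continuous_image[OF contX compact_cball]]
    by (auto simp: bounded_pos)
  define \<epsilon> where "\<epsilon> = min (r / M) (1 / (2 * (L + 1)))"
  have \<epsilon>: "0 < \<epsilon>" using r M L by (auto simp: \<epsilon>_def)
  have \<epsilon>M: "M * \<epsilon> \<le> r"
  proof -
    have "M * \<epsilon> \<le> M * (r / M)" using M by (intro mult_left_mono) (auto simp: \<epsilon>_def)
    thus ?thesis using M by simp
  qed
  have \<epsilon>L: "L * \<epsilon> \<le> 1/2"
  proof -
    have "L * \<epsilon> \<le> (L + 1) * (1 / (2 * (L + 1)))" using L \<epsilon> by (intro mult_mono) (auto simp: \<epsilon>_def)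
    also have "\<dots> = 1/2"
    proof -
      have "c * (1 / (2 * c)) = 1/2" if "c \<noteq> 0" for c :: real using that by simp
      from this[of "L + 1"] L show ?thesis by simp
    qed
    finally show ?thesis .
  qed
  define cl where "cl t = max (-\<epsilon>) (min \<epsilon> t)" for t
  have cl: "cl t \<in> {-\<epsilon>..\<epsilon>}" for t using \<epsilon> by (auto simp: cl_def)
  have contcl: "continuous_on UNIV cl" unfolding cl_def by (intro continuous_intros)
  define J where "J h t = integral {-\<epsilon>..t} h" for h :: "real \<Rightarrow> 'a" and t
  have J': "(J h has_vector_derivative h t) (at t within {-\<epsilon>..\<epsilon>})"
    if "continuous_on {-\<epsilon>..\<epsilon>} h" "t \<in> {-\<epsilon>..\<epsilon>}" for h t
    unfolding J_def by (rule integral_has_vector_derivative[OF that])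
  have Jbound: "norm (J h t - J h 0) \<le> B * \<epsilon>"
    if "continuous_on {-\<epsilon>..\<epsilon>} h" "\<And>t. t \<in> {-\<epsilon>..\<epsilon>} \<Longrightarrow> norm (h t) \<le> B" "t \<in> {-\<epsilon>..\<epsilon>}" for h t B
  proof -
    have z: "0 \<in> {-\<epsilon>..\<epsilon>}" using \<epsilon> by auto
    have "norm (J h t - J h 0) \<le> B * \<bar>t - 0\<bar>"
      by (rule vector_derivative_bound[where S="{-\<epsilon>..\<epsilon>}" and f'=h]) (use that z J' in auto)
    also have "\<dots> \<le> B * \<epsilon>"
      using that(3) order_trans[OF norm_ge_zero that(2)[OF z]] by (intro mult_left_mono) auto
    finally show ?thesis .
  qed
  define \<phi> where "\<phi> u t = x0 + (J (\<lambda>s. X (u s)) (cl t) - J (\<lambda>s. X (u s)) 0)" for u t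
  define C where "C = {u :: real \<Rightarrow>\<^sub>C 'a. \<forall>t. apply_bcontfun u t \<in> cball x0 r}"
  have contXu: "continuous_on UNIV (\<lambda>s. X (apply_bcontfun u s))" if "u \<in> C" for u
    using that by (intro continuous_on_compose2[OF contX]) (auto simp: C_def)
  have contXu': "continuous_on {-\<epsilon>..\<epsilon>} (\<lambda>s. X (apply_bcontfun u s))" if "u \<in> C" for u
    using contXu[OF that] by (rule continuous_on_subset) simp
  have \<phi>_ball: "\<phi> (apply_bcontfun u) t \<in> cball x0 r" if "u \<in> C" for u t
  proof -
    have "norm (J (\<lambda>s. X (u s)) (cl t) - J (\<lambda>s. X (u s)) 0) \<le> M * \<epsilon>"
      using that M(2) by (intro Jbound contXu' cl) (auto simp: C_def)
    thus ?thesis using \<epsilon>M by (simp add: \<phi>_def dist_norm norm_minus_commute)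
  qed
  have \<phi>_cont: "\<phi> (apply_bcontfun u) \<in> bcontfun" if "u \<in> C" for u
  proof (rule bcontfun_normI)
    have "continuous_on {-\<epsilon>..\<epsilon>} (J (\<lambda>s. X (u s)))"
      by (rule continuous_on_vector_derivative[OF J'[OF contXu'[OF that]]])
      moreover have "range cl \<subseteq> {-\<epsilon>..\<epsilon>}" using cl by blast
    ultimately have "continuous_on UNIV (\<lambda>t. J (\<lambda>s. X (apply_bcontfun u s)) (cl t))"
      by (rule continuous_on_compose2[OF _ contcl])
    thus "continuous_on UNIV (\<phi> (apply_bcontfun u))"
      unfolding \<phi>_def by (intro continuous_intros)
    show "norm (\<phi> (apply_bcontfun u) t) \<le> norm x0 + r" for t
      using \<phi>_ball[OF that, of t] norm_triangle_sub[of "\<phi> (apply_bcontfun u) t" x0]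
      by (simp add: dist_norm norm_minus_commute)
  qed
  define T where "T u = Bcontfun (\<phi> (apply_bcontfun u))" for u
  have T: "apply_bcontfun (T u) = \<phi> (apply_bcontfun u)" if "u \<in> C" for u
    unfolding T_def by (rule Bcontfun_inverse[OF \<phi>_cont[OF that]])
  have "\<exists>!u\<in>C. T u = u"
  proof (rule Banach_fix)
    have "C = PiC UNIV (\<lambda>_. cball x0 r)" by (auto simp: C_def mem_PiC_iff Pi_iff)
    thus "complete C" by (simp add: complete_eq_closed closed_PiC)
    have "const_bcontfun x0 \<in> C" using r by (simp add: C_def)
    thus "C \<noteq> {}" by blast
    show "T ` C \<subseteq> C" using T \<phi>_ball by (auto simp: C_def)
    show "(0::real) \<le> 1/2" "(1/2::real) < 1" by auto
    fix u v assume uv: "u \<in> C" "v \<in> C"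
    show "dist (T u) (T v) \<le> 1/2 * dist u v"
    proof (rule dist_bound)
      fix t
      let ?h = "\<lambda>s. X (apply_bcontfun u s) - X (apply_bcontfun v s)"
      have int: "(\<lambda>s. X (apply_bcontfun w s)) integrable_on {-\<epsilon>..t}" if "w \<in> C" "t \<in> {-\<epsilon>..\<epsilon>}" for w t
        using continuous_on_subset[OF contXu'[OF that(1)], of "{-\<epsilon>..t}"] that(2)
        by (intro integrable_continuous_real) auto
      have Jd: "J ?h t = J (\<lambda>s. X (u s)) t - J (\<lambda>s. X (v s)) t" if "t \<in> {-\<epsilon>..\<epsilon>}" for t
        unfolding J_def using int uv that by (intro integral_diff) auto
      have z: "0 \<in> {-\<epsilon>..\<epsilon>}" using \<epsilon> by auto
      have "norm (J ?h (cl t) - J ?h 0) \<le> (L * dist u v) * \<epsilon>"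
      proof (rule Jbound[OF _ _ cl])
        show "continuous_on {-\<epsilon>..\<epsilon>} ?h" using contXu' uv by (intro continuous_intros) auto
        fix s
        have "norm (?h s) \<le> L * norm (apply_bcontfun u s - apply_bcontfun v s)"
          using uv by (intro L) (auto simp: C_def)
        also have "\<dots> \<le> L * dist u v"
          using L dist_bounded[of u s v] by (intro mult_left_mono) (auto simp: dist_norm)
        finally show "norm (?h s) \<le> L * dist u v" .
      qed
      also have "\<dots> = (L * \<epsilon>) * dist u v" by simp
      also have "\<dots> \<le> 1/2 * dist u v" using \<epsilon>L by (intro mult_right_mono) auto
      finally show "dist (apply_bcontfun (T u) t) (apply_bcontfun (T v) t) \<le> 1/2 * dist u v"
        using Jd[OF cl] Jd[OF z] by (simp add: T uv \<phi>_def dist_norm algebra_simps)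
    qed
  qed
  then obtain u where u: "u \<in> C" "T u = u" by auto
  define x where "x = apply_bcontfun u"
  have x: "x t = \<phi> x t" for t using T[OF u(1)] u(2) by (simp add: x_def)
  have xS: "x t \<in> cball x0 r" for t using u(1) by (simp add: x_def C_def)
  have x': "(x has_vector_derivative X (x t)) (at t)" if t: "t \<in> {-\<epsilon><..<\<epsilon>}" for t
  proof -
    have "(J (\<lambda>s. X (x s)) has_vector_derivative X (x t)) (at t within {-\<epsilon>..\<epsilon>})"
      using J'[OF contXu'[OF u(1)], of t] t unfolding x_def by auto
    hence "(J (\<lambda>s. X (x s)) has_vector_derivative X (x t)) (at t)"
      using at_within_interior[of t "{-\<epsilon>..\<epsilon>}"] t by (simp add: interior_atLeastAtMost_real)
    hence "((\<lambda>t. x0 + (J (\<lambda>s. X (x s)) t - J (\<lambda>s. X (x s)) 0)) has_vector_derivative X (x t)) (at t)"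
      by (auto intro!: derivative_eq_intros)
    moreover have "x0 + (J (\<lambda>s. X (x s)) t - J (\<lambda>s. X (x s)) 0) = x t" if "t \<in> {-\<epsilon><..<\<epsilon>}" for t
    proof -
      have "cl t = t" using that by (auto simp: cl_def)
      thus ?thesis using x[of t] by (simp add: \<phi>_def)
    qed
    ultimately show ?thesis
      by (rule has_vector_derivative_transform_within_open[OF _ open_greaterThanLessThan t])
  qed
  have Ck: "Ck_on k x {-\<epsilon><..<\<epsilon>}" for k
  proof (induction k)
    case 0
    have "isCont x t" if "t \<in> {-\<epsilon><..<\<epsilon>}" for t
      using x'[OF that] has_vector_derivative_continuous by blast
    thus ?case by (auto intro: continuous_at_imp_continuous_on)
  next
    case (Suc k)
    show ?case
    proof (rule Ck_on_SucI)
      show "(x has_derivative (\<lambda>h. h *\<^sub>R X (x t))) (at t)" if "t \<in> {-\<epsilon><..<\<epsilon>}" for t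
        using x'[OF that] by (simp add: has_vector_derivative_def)
      have "Ck_on k (\<lambda>t. X (x t)) {-\<epsilon><..<\<epsilon>}"
        using xS r(2) by (intro Ck_on_compose[OF _ _ smooth_onD[OF assms(1)] Suc.IH]) auto
      thus "Ck_on k (\<lambda>t. h *\<^sub>R X (x t)) {-\<epsilon><..<\<epsilon>}" for h
        by (rule Ck_on_linear_compose[OF bounded_linear_scaleR_right, rotated]) simp
    qed simp
  qed
  have "cl 0 = 0" using \<epsilon> by (simp add: cl_def)
  hence x_0: "x 0 = x0" using x[of 0] by (simp add: \<phi>_def)
  show thesis
  proof (rule that[of \<epsilon> x])
    show "smooth_on x {-\<epsilon><..<\<epsilon>}" unfolding smooth_on_def using Ck by blast
    show "x t \<in> S" for t using xS r(2) by blast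
    show "(x has_vector_derivative X (x t)) (at t)" if "t \<in> {-\<epsilon><..<\<epsilon>}" for t
      using that by (rule x')
    show "0 < \<epsilon>" by (rule \<epsilon>)
    show "x 0 = x0" by (rule x_0)
  qed
qed

lemma equal_derivatives_imp_equal:
  fixes f g :: "real \<Rightarrow> 'a::real_normed_vector"
  assumes "\<And>t. t \<in> {a<..<b} \<Longrightarrow> (f has_vector_derivative h t) (at t)"
    and "\<And>t. t \<in> {a<..<b} \<Longrightarrow> (g has_vector_derivative h t) (at t)"
    and "s \<in> {a<..<b}" "f s = g s" "t \<in> {a<..<b}"
  shows "f t = g t"
proof -
  have "((\<lambda>t. f t - g t) has_vector_derivative h t - h t) (at t within {a<..<b})"
    if "t \<in> {a<..<b}" for t
    using has_vector_derivative_at_within[OF has_vector_derivative_diff[OF assms(1)[OF that] assms(2)[OF that]]] .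
  hence "norm ((f t - g t) - (f s - g s)) \<le> 0 * \<bar>t - s\<bar>"
    using assms(3,5)
    by (intro vector_derivative_bound[where S="{a<..<b}" and f'="\<lambda>_. 0"]) auto
  thus ?thesis using assms(4) by simp
qed

section \<open>Charts, tangent maps and curves\<close>

lemma
  assumes "is_chart X \<kappa>"
  shows chart_openin: "openin X (fst \<kappa>)"
    and chart_open: "open (snd \<kappa> ` fst \<kappa>)"
    and chart_inj: "inj_on (snd \<kappa>) (fst \<kappa>)"
    and chart_homeo: "homeomorphic_map (subtopology X (fst \<kappa>)) (top_of_set (snd \<kappa> ` fst \<kappa>)) (snd \<kappa>)"
    and chart_subset: "fst \<kappa> \<subseteq> topspace X"
proof -
  show 1: "openin X (fst \<kappa>)" "open (snd \<kappa> ` fst \<kappa>)"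
    "homeomorphic_map (subtopology X (fst \<kappa>)) (top_of_set (snd \<kappa> ` fst \<kappa>)) (snd \<kappa>)"
    using assms by (auto simp: is_chart_def)
  show 2: "fst \<kappa> \<subseteq> topspace X" using openin_subset[OF 1(1)] .
  have "topspace (subtopology X (fst \<kappa>)) = fst \<kappa>" using 2 by (auto simp: topspace_subtopology)
  thus "inj_on (snd \<kappa>) (fst \<kappa>)" using homeomorphic_imp_injective_map[OF 1(3)] by simp
qed

lemma chart_inv_snd: "is_chart X \<kappa> \<Longrightarrow> p \<in> fst \<kappa> \<Longrightarrow> chart_inv \<kappa> (snd \<kappa> p) = p"
  by (simp add: chart_inv_def chart_inj inv_into_f_f)

lemma snd_chart_inv: "x \<in> snd \<kappa> ` fst \<kappa> \<Longrightarrow> snd \<kappa> (chart_inv \<kappa> x) = x"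
  by (simp add: chart_inv_def f_inv_into_f)

lemma chart_inv_in: "x \<in> snd \<kappa> ` fst \<kappa> \<Longrightarrow> chart_inv \<kappa> x \<in> fst \<kappa>"
  by (simp add: chart_inv_def inv_into_into)

lemma continuous_chart_inv:
  assumes "is_chart X \<kappa>"
  shows "continuous_map (top_of_set (snd \<kappa> ` fst \<kappa>)) X (chart_inv \<kappa>)"
proof -
  have ts: "topspace (subtopology X (fst \<kappa>)) = fst \<kappa>"
    using chart_subset[OF assms] by (auto simp: topspace_subtopology)
  obtain g where g: "homeomorphic_maps (subtopology X (fst \<kappa>)) (top_of_set (snd \<kappa> ` fst \<kappa>)) (snd \<kappa>) g"
    using chart_homeo[OF assms] homeomorphic_map_maps by blast
  hence c: "continuous_map (top_of_set (snd \<kappa> ` fst \<kappa>)) (subtopology X (fst \<kappa>)) g"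
    by (simp add: homeomorphic_maps_def)
  have "g y = chart_inv \<kappa> y" if "y \<in> snd \<kappa> ` fst \<kappa>" for y
  proof -
    have "g (snd \<kappa> p) = p" if "p \<in> fst \<kappa>" for p
      using g that ts by (simp add: homeomorphic_maps_def)
    thus ?thesis using that chart_inv_snd[OF assms] by auto
  qed
  hence "continuous_map (top_of_set (snd \<kappa> ` fst \<kappa>)) (subtopology X (fst \<kappa>)) (chart_inv \<kappa>)"
    using continuous_map_eq[OF c] by simp
  thus ?thesis using continuous_map_into_fulltopology by blast
qed

lemma open_chart_image:
  assumes "is_chart X \<kappa>" "openin X W"
  shows "open (snd \<kappa> ` (fst \<kappa> \<inter> W))"
proof -
  have "openin (top_of_set (snd \<kappa> ` fst \<kappa>)) {x \<in> snd \<kappa> ` fst \<kappa>. chart_inv \<kappa> x \<in> W}"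
    using openin_continuous_map_preimage[OF continuous_chart_inv[OF assms(1)] assms(2)] by simp
  hence "open {x \<in> snd \<kappa> ` fst \<kappa>. chart_inv \<kappa> x \<in> W}"
    using openin_open_trans chart_open[OF assms(1)] by blast
  moreover have "{x \<in> snd \<kappa> ` fst \<kappa>. chart_inv \<kappa> x \<in> W} = snd \<kappa> ` (fst \<kappa> \<inter> W)"
    using chart_inv_snd[OF assms(1)] by auto
  ultimately show ?thesis by simp
qed

lemma openin_chart_vimage:
  assumes "is_chart X \<kappa>" "open V"
  shows "openin X {p \<in> fst \<kappa>. snd \<kappa> p \<in> V}"
proof -
  have "continuous_map (subtopology X (fst \<kappa>)) euclidean (snd \<kappa>)"
    using homeomorphic_imp_continuous_map[OF chart_homeo[OF assms(1)]] continuous_map_into_fulltopology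
    by blast
  from openin_continuous_map_preimage[OF this] assms(2)
  have "openin (subtopology X (fst \<kappa>)) {p \<in> topspace (subtopology X (fst \<kappa>)). snd \<kappa> p \<in> V}" by simp
  moreover have "topspace (subtopology X (fst \<kappa>)) = fst \<kappa>"
    using chart_subset[OF assms(1)] by (auto simp: topspace_subtopology)
  ultimately show ?thesis
    using openin_trans_full chart_openin[OF assms(1)] by fastforce
qed

lemma manifold_chart: "smooth_manifold X A \<Longrightarrow> \<kappa> \<in> A \<Longrightarrow> is_chart X \<kappa>"
  by (simp add: smooth_manifold_def)

lemma
  assumes "smooth_manifold X A" "p \<in> topspace X"
  shows chart_at_in: "chart_at A p \<in> A" and chart_at_mem: "p \<in> fst (chart_at A p)"
proof -
  have "p \<in> \<Union>(fst ` A)" using assms unfolding smooth_manifold_def by metis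
  hence "\<exists>\<kappa>. \<kappa> \<in> A \<and> p \<in> fst \<kappa>" by blast
  from someI_ex[OF this] show "chart_at A p \<in> A" "p \<in> fst (chart_at A p)"
    unfolding chart_at_def by auto
qed

lemma smooth_transition:
  "smooth_manifold X A \<Longrightarrow> \<kappa> \<in> A \<Longrightarrow> \<kappa>' \<in> A \<Longrightarrow>
    smooth_on (snd \<kappa>' \<circ> chart_inv \<kappa>) (snd \<kappa> ` (fst \<kappa> \<inter> fst \<kappa>'))"
  by (simp add: smooth_manifold_def)

lemma open_rep_domain:
  assumes "is_chart X \<kappa>" "is_chart Y \<kappa>'" "continuous_map X Y f"
  shows "open (snd \<kappa> ` (fst \<kappa> \<inter> f -` fst \<kappa>'))"
proof -
  have "openin X {p \<in> topspace X. f p \<in> fst \<kappa>'}"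
    using openin_continuous_map_preimage[OF assms(3) chart_openin[OF assms(2)]] .
  from open_chart_image[OF assms(1) this]
  have "open (snd \<kappa> ` (fst \<kappa> \<inter> {p \<in> topspace X. f p \<in> fst \<kappa>'}))" .
  moreover have "fst \<kappa> \<inter> {p \<in> topspace X. f p \<in> fst \<kappa>'} = fst \<kappa> \<inter> f -` fst \<kappa>'"
    using chart_subset[OF assms(1)] by auto
  ultimately show ?thesis by simp
qed

lemma smooth_map_id: "smooth_manifold X A \<Longrightarrow> smooth_map X A X A id"
  by (simp add: smooth_map_def smooth_transition)

lemma rep_differentiable:
  assumes "smooth_map X A Y B f" "\<kappa> \<in> A" "\<kappa>' \<in> B" "p \<in> fst \<kappa>" "f p \<in> fst \<kappa>'"
  shows "(snd \<kappa>' \<circ> f \<circ> chart_inv \<kappa>) differentiable (at (snd \<kappa> p))"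
  using assms by (intro smooth_on_differentiable[of _ "snd \<kappa> ` (fst \<kappa> \<inter> f -` fst \<kappa>')"])
    (auto simp: smooth_map_def)

text \<open>The charts are arbitrary so that taking one of the two maps to be the identity gives the
  behaviour of derivatives under a change of coordinates.\<close>

lemma D_rep_compose:
  assumes "smooth_manifold X A" "smooth_manifold Y B"
    and f: "smooth_map X A Y B f"
    and charts: "\<kappa> \<in> A" "\<sigma> \<in> B" "p \<in> fst \<kappa>" "f p \<in> fst \<sigma>"
    and g: "(snd \<nu> \<circ> g \<circ> chart_inv \<sigma>) differentiable (at (snd \<sigma> (f p)))"
  shows "D (snd \<nu> \<circ> (g \<circ> f) \<circ> chart_inv \<kappa>) (snd \<kappa> p) v =
    D (snd \<nu> \<circ> g \<circ> chart_inv \<sigma>) (snd \<sigma> (f p)) (D (snd \<sigma> \<circ> f \<circ> chart_inv \<kappa>) (snd \<kappa> p) v)"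
proof -
  let ?r = "snd \<sigma> \<circ> f \<circ> chart_inv \<kappa>" and ?s = "snd \<nu> \<circ> g \<circ> chart_inv \<sigma>"
  let ?O = "snd \<kappa> ` (fst \<kappa> \<inter> f -` fst \<sigma>)"
  have k: "is_chart X \<kappa>" "is_chart Y \<sigma>" using manifold_chart assms(1,2) charts by blast+
  have "open ?O" using open_rep_domain[OF k] f by (simp add: smooth_map_def)
  moreover have "snd \<kappa> p \<in> ?O" using charts by auto
  moreover have "(snd \<nu> \<circ> (g \<circ> f) \<circ> chart_inv \<kappa>) x = ?s (?r x)" if "x \<in> ?O" for x
    using that chart_inv_snd[OF k(1)] chart_inv_snd[OF k(2)] by auto
  ultimately have "D (snd \<nu> \<circ> (g \<circ> f) \<circ> chart_inv \<kappa>) (snd \<kappa> p) = D (\<lambda>x. ?s (?r x)) (snd \<kappa> p)"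
    by (rule D_cong_open)
  moreover have p: "?r (snd \<kappa> p) = snd \<sigma> (f p)" using chart_inv_snd[OF k(1) charts(3)] by simp
  have "D (\<lambda>x. ?s (?r x)) (snd \<kappa> p) v = D ?s (snd \<sigma> (f p)) (D ?r (snd \<kappa> p) v)"
    using D_compose[of ?s ?r "snd \<kappa> p" v] g rep_differentiable[OF f charts] unfolding p by blast
  ultimately show ?thesis by simp
qed

lemma coord_change_eq: "coord_change \<kappa> \<kappa>' p = D (snd \<kappa>' \<circ> id \<circ> chart_inv \<kappa>) (snd \<kappa> p)"
  by (simp add: coord_change_def)

lemma coord_change_compose:
  assumes "smooth_manifold X A" "\<kappa> \<in> A" "\<kappa>' \<in> A" "\<kappa>'' \<in> A" "p \<in> fst \<kappa>" "p \<in> fst \<kappa>'" "p \<in> fst \<kappa>''"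
  shows "coord_change \<kappa>' \<kappa>'' p (coord_change \<kappa> \<kappa>' p v) = coord_change \<kappa> \<kappa>'' p v"
  using D_rep_compose[OF assms(1,1) smooth_map_id[OF assms(1)], of \<kappa> \<kappa>' p \<kappa>'' id v]
    rep_differentiable[OF smooth_map_id[OF assms(1)], of \<kappa>' \<kappa>'' p] assms
  by (simp add: coord_change_eq)

lemma coord_change_same:
  assumes "is_chart X \<kappa>" "p \<in> fst \<kappa>"
  shows "coord_change \<kappa> \<kappa> p v = v"
proof -
  have "D (snd \<kappa> \<circ> chart_inv \<kappa>) (snd \<kappa> p) = D (\<lambda>x. x) (snd \<kappa> p)"
  proof (rule D_cong_open[OF chart_open[OF assms(1)]])
    show "(snd \<kappa> \<circ> chart_inv \<kappa>) x = x" if "x \<in> snd \<kappa> ` fst \<kappa>" for x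
      using snd_chart_inv[OF that] by simp
  qed (use assms(2) in simp)
  thus ?thesis by (simp add: coord_change_def D_eq[OF has_derivative_ident])
qed

lemma coord_change_inverse:
  assumes "smooth_manifold X A" "\<kappa> \<in> A" "\<kappa>' \<in> A" "p \<in> fst \<kappa>" "p \<in> fst \<kappa>'"
  shows "coord_change \<kappa>' \<kappa> p (coord_change \<kappa> \<kappa>' p v) = v"
  using coord_change_compose[OF assms(1,2,3,2,4,5,4)]
    coord_change_same[OF manifold_chart[OF assms(1,2)] assms(4)] by simp

lemma linear_coord_change:
  assumes "smooth_manifold X A" "\<kappa> \<in> A" "\<kappa>' \<in> A" "p \<in> fst \<kappa>" "p \<in> fst \<kappa>'"
  shows "linear (coord_change \<kappa> \<kappa>' p)"
  unfolding coord_change_eq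
  using rep_differentiable[OF smooth_map_id[OF assms(1)], of \<kappa> \<kappa>' p] assms
  by (intro has_derivative_linear[OF has_D]) simp

lemma coord_change_eq_0_iff:
  assumes "smooth_manifold X A" "\<kappa> \<in> A" "\<kappa>' \<in> A" "p \<in> fst \<kappa>" "p \<in> fst \<kappa>'"
  shows "coord_change \<kappa> \<kappa>' p v = 0 \<longleftrightarrow> v = 0"
  using coord_change_inverse[OF assms, of v] linear_0[OF linear_coord_change[OF assms]]
    linear_0[OF linear_coord_change[OF assms(1,3,2,5,4)]] by metis

text \<open>Tangent maps refer to the preferred charts, which jump from point to point without any
  continuity. This lemma and \<open>coord_change_velocity\<close> below are the passage to a fixed chart.\<close>

lemma tangent_map_rep:
  assumes "smooth_manifold X A" "smooth_manifold Y B" "smooth_map X A Y B f"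
    and "\<kappa> \<in> A" "\<kappa>' \<in> B" "p \<in> fst \<kappa>" "f p \<in> fst \<kappa>'"
  shows "coord_change (chart_at B (f p)) \<kappa>' (f p) (tangent_map A B f p v) =
    D (snd \<kappa>' \<circ> f \<circ> chart_inv \<kappa>) (snd \<kappa> p) (coord_change (chart_at A p) \<kappa> p v)"
proof -
  have p: "p \<in> topspace X" using chart_subset[OF manifold_chart[OF assms(1,4)]] assms(6) by blast
  have fp: "f p \<in> topspace Y" using chart_subset[OF manifold_chart[OF assms(2,5)]] assms(7) by blast
  note c = chart_at_in[OF assms(1) p] chart_at_mem[OF assms(1) p]
    chart_at_in[OF assms(2) fp] chart_at_mem[OF assms(2) fp]
  have "D (snd \<kappa>' \<circ> (id \<circ> f) \<circ> chart_inv (chart_at A p)) (snd (chart_at A p) p) v =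
    coord_change (chart_at B (f p)) \<kappa>' (f p) (tangent_map A B f p v)"
    unfolding coord_change_eq tangent_map_def
    using rep_differentiable[OF smooth_map_id[OF assms(2)] c(3) assms(5) c(4)] assms(7)
    by (intro D_rep_compose[OF assms(1,2,3) c(1,3,2,4)]) simp
  moreover have "D (snd \<kappa>' \<circ> (f \<circ> id) \<circ> chart_inv (chart_at A p)) (snd (chart_at A p) p) v =
    D (snd \<kappa>' \<circ> f \<circ> chart_inv \<kappa>) (snd \<kappa> p) (coord_change (chart_at A p) \<kappa> p v)"
    unfolding coord_change_eq
    using rep_differentiable[OF assms(3-7)] assms(6)
      D_rep_compose[OF assms(1,1) smooth_map_id[OF assms(1)] c(1) assms(4) c(2), of \<kappa>' f v] by simp
  ultimately show ?thesis by simp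
qed

lemma chart_inv_prod:
  assumes "is_chart X \<kappa>" "is_chart Y \<kappa>'" "x \<in> snd \<kappa> ` fst \<kappa>" "y \<in> snd \<kappa>' ` fst \<kappa>'"
  shows "chart_inv (fst \<kappa> \<times> fst \<kappa>', map_prod (snd \<kappa>) (snd \<kappa>')) (x, y) = (chart_inv \<kappa> x, chart_inv \<kappa>' y)"
proof -
  have "inj_on (map_prod (snd \<kappa>) (snd \<kappa>')) (fst \<kappa> \<times> fst \<kappa>')"
    using chart_inj[OF assms(1)] chart_inj[OF assms(2)] by (rule map_prod_inj_on)
  from inv_into_f_f[OF this, of "(chart_inv \<kappa> x, chart_inv \<kappa>' y)"]
  show ?thesis
    using chart_inv_in[OF assms(3)] chart_inv_in[OF assms(4)]
      snd_chart_inv[OF assms(3)] snd_chart_inv[OF assms(4)]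
    by (simp add: chart_inv_def[of "(_, _)"])
qed

lemma smooth_map_prod_rep:
  assumes "smooth_manifold X A" "smooth_manifold Y B" "smooth_manifold Z C"
    and h: "smooth_map (prod_topology X Y) (prod_atlas A B) Z C h"
    and "\<kappa> \<in> A" "\<sigma> \<in> B" "\<nu> \<in> C"
  defines "Q \<equiv> {(x, y). x \<in> snd \<kappa> ` fst \<kappa> \<and> y \<in> snd \<sigma> ` fst \<sigma> \<and> h (chart_inv \<kappa> x, chart_inv \<sigma> y) \<in> fst \<nu>}"
  shows "open Q" and "smooth_on (\<lambda>(x, y). snd \<nu> (h (chart_inv \<kappa> x, chart_inv \<sigma> y))) Q"
proof -
  define \<pi> where "\<pi> = (fst \<kappa> \<times> fst \<sigma>, map_prod (snd \<kappa>) (snd \<sigma>))"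
  have k: "is_chart X \<kappa>" "is_chart Y \<sigma>" "is_chart Z \<nu>" using assms manifold_chart by blast+
  have pA: "\<pi> \<in> prod_atlas A B"
    unfolding prod_atlas_def \<pi>_def using assms(5,6) by blast
  have inv: "chart_inv \<pi> (x, y) = (chart_inv \<kappa> x, chart_inv \<sigma> y)"
    if "x \<in> snd \<kappa> ` fst \<kappa>" "y \<in> snd \<sigma> ` fst \<sigma>" for x y
    unfolding \<pi>_def using chart_inv_prod[OF k(1,2) that] .
  have Q: "snd \<pi> ` (fst \<pi> \<inter> h -` fst \<nu>) = Q"
  proof (intro equalityI subsetI)
    fix z assume "z \<in> snd \<pi> ` (fst \<pi> \<inter> h -` fst \<nu>)"
    thus "z \<in> Q" using chart_inv_snd[OF k(1)] chart_inv_snd[OF k(2)] by (auto simp: Q_def \<pi>_def)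
  next
    fix z assume "z \<in> Q"
    then obtain x y where z: "z = (x, y)" "x \<in> snd \<kappa> ` fst \<kappa>" "y \<in> snd \<sigma> ` fst \<sigma>"
      "h (chart_inv \<kappa> x, chart_inv \<sigma> y) \<in> fst \<nu>" by (auto simp: Q_def)
    thus "z \<in> snd \<pi> ` (fst \<pi> \<inter> h -` fst \<nu>)"
      using chart_inv_in[OF z(2)] chart_inv_in[OF z(3)] snd_chart_inv[OF z(2)] snd_chart_inv[OF z(3)]
      by (intro image_eqI[of _ _ "(chart_inv \<kappa> x, chart_inv \<sigma> y)"]) (simp_all add: \<pi>_def)
  qed
  have c: "continuous_map (top_of_set (snd \<kappa> ` fst \<kappa> \<times> snd \<sigma> ` fst \<sigma>)) Z
    (\<lambda>z. h (chart_inv \<kappa> (fst z), chart_inv \<sigma> (snd z)))"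
  proof -
    let ?T = "prod_topology (top_of_set (snd \<kappa> ` fst \<kappa>)) (top_of_set (snd \<sigma> ` fst \<sigma>))"
    have "continuous_map ?T (prod_topology X Y) (\<lambda>z. (chart_inv \<kappa> (fst z), chart_inv \<sigma> (snd z)))"
      using continuous_map_compose[OF continuous_map_fst continuous_chart_inv[OF k(1)]]
        continuous_map_compose[OF continuous_map_snd continuous_chart_inv[OF k(2)]]
      by (intro continuous_map_pairedI) (simp_all only: o_def)
    from continuous_map_compose[OF this] h
    have "continuous_map ?T Z (\<lambda>z. h (chart_inv \<kappa> (fst z), chart_inv \<sigma> (snd z)))"
      by (force simp: smooth_map_def o_def)
    moreover have "?T = top_of_set (snd \<kappa> ` fst \<kappa> \<times> snd \<sigma> ` fst \<sigma>)"
      by (simp add: subtopology_Times[symmetric] prod_topology_subtopology_eu)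
    ultimately show ?thesis by simp
  qed
  from openin_continuous_map_preimage[OF c chart_openin[OF k(3)]]
  have "openin (top_of_set (snd \<kappa> ` fst \<kappa> \<times> snd \<sigma> ` fst \<sigma>)) Q"
    by (simp add: Q_def split_beta' conj_assoc mem_Times_iff)
  thus o: "open Q" using open_Times[OF chart_open[OF k(1)] chart_open[OF k(2)]] openin_open_trans by blast
  have "smooth_on (snd \<nu> \<circ> h \<circ> chart_inv \<pi>) Q"
    using h pA assms(7) unfolding smooth_map_def Q[symmetric] by blast
  moreover have "(snd \<nu> \<circ> h \<circ> chart_inv \<pi>) z = (\<lambda>(x, y). snd \<nu> (h (chart_inv \<kappa> x, chart_inv \<sigma> y))) z"
    if "z \<in> Q" for z
    using that inv by (auto simp: Q_def)
  ultimately show "smooth_on (\<lambda>(x, y). snd \<nu> (h (chart_inv \<kappa> x, chart_inv \<sigma> y))) Q"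
    using smooth_on_cong[OF o, of "snd \<nu> \<circ> h \<circ> chart_inv \<pi>"] by blast
qed

lemma smooth_map_prod_left:
  assumes "smooth_manifold X A" "smooth_manifold Y B" "smooth_manifold Z C"
    and h: "smooth_map (prod_topology X Y) (prod_atlas A B) Z C h" and p: "p \<in> topspace X"
  shows "smooth_map Y B Z C (\<lambda>y. h (p, y))"
  unfolding smooth_map_def
proof (intro conjI ballI)
  have "continuous_map Y (prod_topology X Y) (\<lambda>y. (p, y))"
    using p by (intro continuous_map_pairedI) auto
  from continuous_map_compose[OF this] h
  show c: "continuous_map Y Z (\<lambda>y. h (p, y))" by (force simp: smooth_map_def o_def)
  fix \<sigma> \<nu> assume s: "\<sigma> \<in> B" "\<nu> \<in> C"
  define \<kappa> where "\<kappa> = chart_at A p"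
  have k: "\<kappa> \<in> A" "p \<in> fst \<kappa>" using chart_at_in[OF assms(1) p] chart_at_mem[OF assms(1) p] by (auto simp: \<kappa>_def)
  have ck: "is_chart X \<kappa>" "is_chart Y \<sigma>" "is_chart Z \<nu>" using assms k s manifold_chart by blast+
  note r = smooth_map_prod_rep[OF assms(1-4) k(1) s]
  have o: "open (snd \<sigma> ` (fst \<sigma> \<inter> (\<lambda>y. h (p, y)) -` fst \<nu>))" by (rule open_rep_domain[OF ck(2,3) c])
  have sm: "smooth_on (\<lambda>y. (snd \<kappa> p, y)) (snd \<sigma> ` (fst \<sigma> \<inter> (\<lambda>y. h (p, y)) -` fst \<nu>))"
    by (intro smooth_on_Pair o smooth_on_const smooth_on_id)
  have "smooth_on (\<lambda>y. (\<lambda>(x, y). snd \<nu> (h (chart_inv \<kappa> x, chart_inv \<sigma> y))) (snd \<kappa> p, y))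
      (snd \<sigma> ` (fst \<sigma> \<inter> (\<lambda>y. h (p, y)) -` fst \<nu>))"
  proof (rule smooth_on_compose[OF r(2) sm o])
    fix y assume "y \<in> snd \<sigma> ` (fst \<sigma> \<inter> (\<lambda>y. h (p, y)) -` fst \<nu>)"
    thus "(snd \<kappa> p, y) \<in> {(x, y). x \<in> snd \<kappa> ` fst \<kappa> \<and> y \<in> snd \<sigma> ` fst \<sigma> \<and>
        h (chart_inv \<kappa> x, chart_inv \<sigma> y) \<in> fst \<nu>}"
      using k chart_inv_snd[OF ck(1) k(2)] chart_inv_snd[OF ck(2)] by auto
  qed
  thus "smooth_on (snd \<nu> \<circ> (\<lambda>y. h (p, y)) \<circ> chart_inv \<sigma>)
      (snd \<sigma> ` (fst \<sigma> \<inter> (\<lambda>y. h (p, y)) -` fst \<nu>))"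
    using chart_inv_snd[OF ck(1) k(2)] by (simp add: o_def)
qed

lemma smooth_map_prod_right:
  assumes "smooth_manifold X A" "smooth_manifold Y B" "smooth_manifold Z C"
    and h: "smooth_map (prod_topology X Y) (prod_atlas A B) Z C h" and q: "q \<in> topspace Y"
  shows "smooth_map X A Z C (\<lambda>x. h (x, q))"
  unfolding smooth_map_def
proof (intro conjI ballI)
  have "continuous_map X (prod_topology X Y) (\<lambda>x. (x, q))"
    using q by (intro continuous_map_pairedI) auto
  from continuous_map_compose[OF this] h
  show c: "continuous_map X Z (\<lambda>x. h (x, q))" by (force simp: smooth_map_def o_def)
  fix \<kappa> \<nu> assume s: "\<kappa> \<in> A" "\<nu> \<in> C"
  define \<sigma> where "\<sigma> = chart_at B q"
  have k: "\<sigma> \<in> B" "q \<in> fst \<sigma>" using chart_at_in[OF assms(2) q] chart_at_mem[OF assms(2) q] by (auto simp: \<sigma>_def)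
  have ck: "is_chart X \<kappa>" "is_chart Y \<sigma>" "is_chart Z \<nu>" using assms k s manifold_chart by blast+
  note r = smooth_map_prod_rep[OF assms(1-4) s(1) k(1) s(2)]
  have o: "open (snd \<kappa> ` (fst \<kappa> \<inter> (\<lambda>x. h (x, q)) -` fst \<nu>))" by (rule open_rep_domain[OF ck(1,3) c])
  have sm: "smooth_on (\<lambda>x. (x, snd \<sigma> q)) (snd \<kappa> ` (fst \<kappa> \<inter> (\<lambda>x. h (x, q)) -` fst \<nu>))"
    by (intro smooth_on_Pair o smooth_on_const smooth_on_id)
  have "smooth_on (\<lambda>x. (\<lambda>(x, y). snd \<nu> (h (chart_inv \<kappa> x, chart_inv \<sigma> y))) (x, snd \<sigma> q))
      (snd \<kappa> ` (fst \<kappa> \<inter> (\<lambda>x. h (x, q)) -` fst \<nu>))"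
  proof (rule smooth_on_compose[OF r(2) sm o])
    fix x assume "x \<in> snd \<kappa> ` (fst \<kappa> \<inter> (\<lambda>x. h (x, q)) -` fst \<nu>)"
    thus "(x, snd \<sigma> q) \<in> {(x, y). x \<in> snd \<kappa> ` fst \<kappa> \<and> y \<in> snd \<sigma> ` fst \<sigma> \<and>
        h (chart_inv \<kappa> x, chart_inv \<sigma> y) \<in> fst \<nu>}"
      using k chart_inv_snd[OF ck(1)] chart_inv_snd[OF ck(2) k(2)] by auto
  qed
  thus "smooth_on (snd \<nu> \<circ> (\<lambda>x. h (x, q)) \<circ> chart_inv \<kappa>)
      (snd \<kappa> ` (fst \<kappa> \<inter> (\<lambda>x. h (x, q)) -` fst \<nu>))"
    using chart_inv_snd[OF ck(2) k(2)] by (simp add: o_def)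
qed

lemma
  fixes f :: "'a::real_normed_vector \<times> 'b::real_normed_vector \<Rightarrow> 'c::real_normed_vector"
  assumes "f differentiable (at (a, b))"
  shows has_partial_snd: "((\<lambda>y. f (a, y)) has_derivative (\<lambda>w. D f (a, b) (0, w))) (at b)"
    and has_partial_fst: "((\<lambda>x. f (x, b)) has_derivative (\<lambda>v. D f (a, b) (v, 0))) (at a)"
proof -
  have "((\<lambda>y. (a, y)) has_derivative (\<lambda>w. (0, w))) (at b)" by (auto intro!: derivative_eq_intros)
  from has_derivative_compose[OF this has_D[OF assms]]
  show "((\<lambda>y. f (a, y)) has_derivative (\<lambda>w. D f (a, b) (0, w))) (at b)" .
  have "((\<lambda>x. (x, b)) has_derivative (\<lambda>v. (v, 0))) (at a)" by (auto intro!: derivative_eq_intros)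
  from has_derivative_compose[OF this has_D[OF assms]]
  show "((\<lambda>x. f (x, b)) has_derivative (\<lambda>v. D f (a, b) (v, 0))) (at a)" .
qed

lemma open_curve_domain:
  assumes "continuous_map (top_of_set I) X c" "open I" "openin X W"
  shows "open {t \<in> I. c t \<in> W}"
  using openin_continuous_map_preimage[OF assms(1,3)] openin_open_trans[OF _ assms(2)] by simp

lemma smooth_curveI:
  assumes "smooth_manifold X A" "\<kappa> \<in> A" "open I" "smooth_on x I" "\<And>t. t \<in> I \<Longrightarrow> x t \<in> snd \<kappa> ` fst \<kappa>"
  shows "smooth_curve X A I (\<lambda>t. chart_inv \<kappa> (x t))"
proof -
  have k: "is_chart X \<kappa>" using manifold_chart[OF assms(1,2)] .
  have "continuous_map (top_of_set I) (top_of_set (snd \<kappa> ` fst \<kappa>)) x"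
    using smooth_on_continuous[OF assms(4)] assms(5) by (auto simp: continuous_map_in_subtopology)
  from continuous_map_compose[OF this continuous_chart_inv[OF k]]
  have c: "continuous_map (top_of_set I) X (\<lambda>t. chart_inv \<kappa> (x t))" by (simp add: o_def)
  moreover have "smooth_on (snd \<kappa>' \<circ> (\<lambda>t. chart_inv \<kappa> (x t))) {t \<in> I. chart_inv \<kappa> (x t) \<in> fst \<kappa>'}"
    if k': "\<kappa>' \<in> A" for \<kappa>'
  proof -
    let ?I = "{t \<in> I. chart_inv \<kappa> (x t) \<in> fst \<kappa>'}"
    have o: "open ?I" using open_curve_domain[OF c assms(3) chart_openin[OF manifold_chart[OF assms(1) k']]] .
    have m: "x t \<in> snd \<kappa> ` (fst \<kappa> \<inter> fst \<kappa>')" if "t \<in> ?I" for t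
      using that assms(5) chart_inv_in[of "x t" \<kappa>] snd_chart_inv[of "x t" \<kappa>] by (metis (no_types, lifting) IntI imageI mem_Collect_eq)
    have s: "smooth_on x ?I" by (rule smooth_on_subset[OF assms(4)]) auto
    show ?thesis
      using smooth_on_compose[OF smooth_transition[OF assms(1,2) k'] s o m] by (simp add: o_def)
  qed
  ultimately show ?thesis by (simp add: smooth_curve_def)
qed

lemma
  assumes "smooth_manifold X A" "smooth_curve X A I c" "open I" "t \<in> I" "\<kappa> \<in> A" "c t \<in> fst \<kappa>"
  shows curve_rep_has_derivative:
      "((snd \<kappa> \<circ> c) has_vector_derivative vector_derivative (snd \<kappa> \<circ> c) (at t)) (at t)"
    and coord_change_velocity:
      "coord_change (chart_at A (c t)) \<kappa> (c t) (velocity A c t) = vector_derivative (snd \<kappa> \<circ> c) (at t)"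
proof -
  have 1: "((snd \<kappa> \<circ> c) has_vector_derivative vector_derivative (snd \<kappa> \<circ> c) (at t)) (at t)"
    if "\<kappa> \<in> A" "c t \<in> fst \<kappa>" for \<kappa>
  proof -
    have "smooth_on (snd \<kappa> \<circ> c) {t \<in> I. c t \<in> fst \<kappa>}" using assms(2) that by (simp add: smooth_curve_def)
    hence "(snd \<kappa> \<circ> c) differentiable (at t)" by (rule smooth_on_differentiable) (use assms(4) that in simp)
    thus ?thesis by (simp add: vector_derivative_works)
  qed
  show "((snd \<kappa> \<circ> c) has_vector_derivative vector_derivative (snd \<kappa> \<circ> c) (at t)) (at t)"
    using 1 assms by blast
  define \<kappa>0 where "\<kappa>0 = chart_at A (c t)"
  have p: "c t \<in> topspace X" using chart_subset[OF manifold_chart[OF assms(1,5)]] assms(6) by blast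
  have c0: "\<kappa>0 \<in> A" "c t \<in> fst \<kappa>0"
    using chart_at_in[OF assms(1) p] chart_at_mem[OF assms(1) p] by (auto simp: \<kappa>0_def)
  have k: "is_chart X \<kappa>0" using manifold_chart[OF assms(1) c0(1)] .
  have "(snd \<kappa> \<circ> chart_inv \<kappa>0) differentiable (at (snd \<kappa>0 (c t)))"
    using rep_differentiable[OF smooth_map_id[OF assms(1)] c0(1) assms(5) c0(2)] assms(6) by simp
  from has_D[OF this] have "((snd \<kappa> \<circ> chart_inv \<kappa>0) has_derivative coord_change \<kappa>0 \<kappa> (c t)) (at ((snd \<kappa>0 \<circ> c) t))"
    by (simp add: coord_change_def)
  from vector_derivative_diff_chain_within[OF has_vector_derivative_at_within[OF 1[OF c0]]
      has_derivative_at_withinI[OF this], of UNIV]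
  have "(((snd \<kappa> \<circ> chart_inv \<kappa>0) \<circ> (snd \<kappa>0 \<circ> c)) has_vector_derivative
      coord_change \<kappa>0 \<kappa> (c t) (velocity A c t)) (at t)"
    by (simp only: velocity_def \<kappa>0_def[symmetric])
  moreover have "((snd \<kappa> \<circ> chart_inv \<kappa>0) \<circ> (snd \<kappa>0 \<circ> c)) s = (snd \<kappa> \<circ> c) s"
    if "s \<in> {t \<in> I. c t \<in> fst \<kappa>0}" for s
    using that chart_inv_snd[OF k] by simp
  moreover have "open {t \<in> I. c t \<in> fst \<kappa>0}"
    using open_curve_domain[OF _ assms(3) chart_openin[OF k]] assms(2) by (simp add: smooth_curve_def)
  ultimately have "((snd \<kappa> \<circ> c) has_vector_derivative coord_change \<kappa>0 \<kappa> (c t) (velocity A c t)) (at t)"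
    using has_vector_derivative_transform_within_open[of _ _ t "{t \<in> I. c t \<in> fst \<kappa>0}"] assms(4) c0(2)
    by blast
  thus "coord_change (chart_at A (c t)) \<kappa> (c t) (velocity A c t) = vector_derivative (snd \<kappa> \<circ> c) (at t)"
    by (simp add: vector_derivative_at \<kappa>0_def)
qed

section \<open>The transformation group in coordinates\<close>

locale homogeneous_finsler =
  fixes A :: "('m::topological_space, real^'n::finite) chart set"
    and F :: "'m \<Rightarrow> real^'n \<Rightarrow> real"
    and G :: "('m \<Rightarrow> 'm) set"
    and B :: "('m \<Rightarrow> 'm, 'b::euclidean_space) chart set"
    and x0 :: 'm
    and m :: "'b set"
  assumes manM: "smooth_manifold euclidean A"
    and finsler: "finsler_metric A F"
    and closed_group: "closed_isometry_subgroup A F G B"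
    and transitive: "\<forall>p q. \<exists>g\<in>G. g p = q"
    and reductive: "reductive_decomposition G B x0 m"
begin

lemma manG: "smooth_manifold (group_topology G) B"
  and smooth_mult: "smooth_map (prod_topology (group_topology G) (group_topology G)) (prod_atlas B B)
       (group_topology G) B (\<lambda>(g, h). g \<circ> h)"
  and smooth_inverse: "smooth_map (group_topology G) B (group_topology G) B inv"
  and smooth_action: "smooth_map (prod_topology (group_topology G) euclidean) (prod_atlas B A)
       euclidean A (\<lambda>(g, p). g p)"
  and G_bij: "g \<in> G \<Longrightarrow> bij g"
  and G_id: "id \<in> G"
  and G_inv: "g \<in> G \<Longrightarrow> inv g \<in> G"
  using closed_group by (auto simp: closed_isometry_subgroup_def lie_transformation_group_def)

lemma topspace_G: "topspace (group_topology G) = G"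
proof -
  have "(UNIV :: ('m \<Rightarrow> 'm) set) \<in> {{f. f ` K \<subseteq> V} | K V. compact K \<and> open V}"
  proof -
    have "UNIV = {f :: 'm \<Rightarrow> 'm. f ` {} \<subseteq> UNIV} \<and> compact ({} :: 'm set) \<and> open (UNIV :: 'm set)" by auto
    thus ?thesis by blast
  qed
  hence "\<Union>{{f :: 'm \<Rightarrow> 'm. f ` K \<subseteq> V} | K V. compact K \<and> open V} = UNIV" by blast
  thus ?thesis by (simp add: compact_open_topology_def topology_generated_by_topspace)
qed

lemma G_isometry:
  assumes "g \<in> G"
  shows "smooth_map euclidean A euclidean A g" "F (g p) (tangent_map A A g p v) = F p v"
proof -
  have "G \<subseteq> isometry_group A F"
    using closed_group closedin_subset unfolding closed_isometry_subgroup_def by fastforce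
  thus "smooth_map euclidean A euclidean A g" "F (g p) (tangent_map A A g p v) = F p v"
    using assms by (auto simp: isometry_group_def)
qed

lemma inv_comp [simp]: "g \<in> G \<Longrightarrow> inv g \<circ> g = id" "g \<in> G \<Longrightarrow> g \<circ> inv g = id"
  using inj_iff[of g] surj_iff[of g] bij_is_inj[OF G_bij] bij_is_surj[OF G_bij] by blast+

lemma chart_at_M: "chart_at A p \<in> A" "p \<in> fst (chart_at A p)"
  using chart_at_in[OF manM, of p] chart_at_mem[OF manM, of p] by auto

text \<open>The group near the identity in its preferred chart there. The sets \<open>\<Omega>\<close> and \<open>V1\<close> consist of
  the coordinates whose product and inverse stay in the domain of the chart.\<close>

definition "\<psi> = chart_at B id"
abbreviation "gr \<equiv> chart_inv \<psi>"
abbreviation "V \<equiv> snd \<psi> ` fst \<psi>"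
definition "e = snd \<psi> id"
definition "mul = (\<lambda>(a, b). snd \<psi> (gr a \<circ> gr b))"
definition "\<Omega> = {(a, b). a \<in> V \<and> b \<in> V \<and> gr a \<circ> gr b \<in> fst \<psi>}"
definition "ivt a = snd \<psi> (inv (gr a))"
definition "V1 = {a \<in> V. inv (gr a) \<in> fst \<psi>}"

lemma \<psi>: "\<psi> \<in> B" "id \<in> fst \<psi>" "is_chart (group_topology G) \<psi>"
proof -
  have "id \<in> topspace (group_topology G)" unfolding topspace_G by (rule G_id)
  from chart_at_in[OF manG this] chart_at_mem[OF manG this]
  show "\<psi> \<in> B" "id \<in> fst \<psi>" "is_chart (group_topology G) \<psi>"
    using manifold_chart[OF manG] unfolding \<psi>_def by blast+
qed

lemma fst_\<psi>: "fst \<psi> \<subseteq> G" using chart_subset[OF \<psi>(3)] unfolding topspace_G .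

lemma open_V: "open V" by (rule chart_open[OF \<psi>(3)])

lemma e_V: "e \<in> V" using \<psi>(2) by (auto simp: e_def)

lemma gr_e [simp]: "gr e = id" unfolding e_def by (rule chart_inv_snd[OF \<psi>(3,2)])

lemma gr_in: "a \<in> V \<Longrightarrow> gr a \<in> fst \<psi>" by (rule chart_inv_in)

lemma gr_G: "a \<in> V \<Longrightarrow> gr a \<in> G" using gr_in fst_\<psi> by blast

lemma \<psi>_gr: "a \<in> V \<Longrightarrow> snd \<psi> (gr a) = a" by (rule snd_chart_inv)

lemma gr_\<psi>: "g \<in> fst \<psi> \<Longrightarrow> gr (snd \<psi> g) = g" by (rule chart_inv_snd[OF \<psi>(3)])

lemma open_\<Omega>: "open \<Omega>" and smooth_mul: "smooth_on mul \<Omega>"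
proof -
  note r = smooth_map_prod_rep[OF manG manG manG smooth_mult \<psi>(1,1,1)]
  have "\<Omega> = {(x, y). x \<in> V \<and> y \<in> V \<and> (\<lambda>(g, h). g \<circ> h) (gr x, gr y) \<in> fst \<psi>}"
    by (simp add: \<Omega>_def)
  moreover have "mul = (\<lambda>(x, y). snd \<psi> ((\<lambda>(g, h). g \<circ> h) (gr x, gr y)))" by (simp add: mul_def)
  ultimately show "open \<Omega>" "smooth_on mul \<Omega>" using r by simp_all
qed

lemma V1_eq: "V1 = snd \<psi> ` (fst \<psi> \<inter> inv -` fst \<psi>)"
proof (intro equalityI subsetI)
  fix a assume "a \<in> V1"
  hence "gr a \<in> fst \<psi> \<inter> inv -` fst \<psi>" "a = snd \<psi> (gr a)" using gr_in \<psi>_gr by (auto simp: V1_def)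
  thus "a \<in> snd \<psi> ` (fst \<psi> \<inter> inv -` fst \<psi>)" by blast
qed (auto simp: V1_def gr_\<psi>)

lemma open_V1: "open V1" and smooth_ivt: "smooth_on ivt V1"
proof -
  have c: "continuous_map (group_topology G) (group_topology G) inv"
    using smooth_inverse by (simp add: smooth_map_def)
  show "open V1" unfolding V1_eq by (rule open_rep_domain[OF \<psi>(3,3) c])
  have "smooth_on (snd \<psi> \<circ> inv \<circ> chart_inv \<psi>) (snd \<psi> ` (fst \<psi> \<inter> inv -` fst \<psi>))"
    using smooth_inverse \<psi>(1) by (simp add: smooth_map_def)
  moreover have "snd \<psi> \<circ> inv \<circ> chart_inv \<psi> = ivt" by (auto simp: ivt_def)
  ultimately show "smooth_on ivt V1" by (simp add: V1_eq)
qed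

lemma V1_V: "V1 \<subseteq> V" by (auto simp: V1_def)

lemma e_V1: "e \<in> V1" using e_V \<psi>(2) by (simp add: V1_def)

lemma gr_ivt: "a \<in> V1 \<Longrightarrow> gr (ivt a) = inv (gr a)" by (simp add: V1_def ivt_def gr_\<psi>)

lemma ivt_V: "a \<in> V1 \<Longrightarrow> ivt a \<in> V" by (auto simp: V1_def ivt_def)

lemma gr_mul: "(a, b) \<in> \<Omega> \<Longrightarrow> gr (mul (a, b)) = gr a \<circ> gr b" by (simp add: \<Omega>_def mul_def gr_\<psi>)

lemma \<Omega>_e: "a \<in> V \<Longrightarrow> (a, e) \<in> \<Omega>" "a \<in> V \<Longrightarrow> (e, a) \<in> \<Omega>"
  using gr_in e_V by (auto simp: \<Omega>_def)

lemma mul_e: "a \<in> V \<Longrightarrow> mul (a, e) = a" "a \<in> V \<Longrightarrow> mul (e, a) = a"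
  by (auto simp: mul_def \<psi>_gr)

lemma \<Omega>_ivt: "a \<in> V1 \<Longrightarrow> (ivt a, a) \<in> \<Omega>"
  using gr_ivt ivt_V V1_V \<psi>(2) gr_G by (auto simp: \<Omega>_def)

lemma mul_ivt: "a \<in> V1 \<Longrightarrow> mul (ivt a, a) = e"
  using gr_ivt gr_G V1_V by (auto simp: mul_def e_def)

text \<open>\<open>\<theta> a\<close> is the differential at the identity of the left translation by \<open>gr a\<close> and \<open>\<Theta> a\<close> the
  differential at \<open>gr a\<close> of the left translation by its inverse.\<close>

definition "\<theta> a w = D mul (a, e) (0, w)"
definition "\<Theta> a w = D mul (ivt a, a) (0, w)"

lemma mul_differentiable: "z \<in> \<Omega> \<Longrightarrow> mul differentiable (at z)"
  by (rule smooth_on_differentiable[OF smooth_mul])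

lemma has_derivative_\<theta>: "a \<in> V \<Longrightarrow> ((\<lambda>b. mul (a, b)) has_derivative \<theta> a) (at e)"
  using has_partial_snd[OF mul_differentiable[OF \<Omega>_e(1)]] by (simp add: \<theta>_def[abs_def])

lemma has_derivative_\<Theta>: "a \<in> V1 \<Longrightarrow> ((\<lambda>b. mul (ivt a, b)) has_derivative \<Theta> a) (at a)"
  using has_partial_snd[OF mul_differentiable[OF \<Omega>_ivt]] by (simp add: \<Theta>_def[abs_def])

lemma linear_\<theta>: "a \<in> V \<Longrightarrow> linear (\<theta> a)" by (rule has_derivative_linear[OF has_derivative_\<theta>])

lemma open_slice: "open {b. (a, b) \<in> \<Omega>}"
  using open_vimage[OF open_\<Omega>, of "\<lambda>b. (a, b)"] by (simp add: vimage_def continuous_on_Pair)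

lemma \<Theta>_\<theta>:
  assumes a: "a \<in> V1"
  shows "\<Theta> a (\<theta> a w) = w"
proof -
  have aV: "a \<in> V" using a V1_V by blast
  have d: "((\<lambda>b. mul (ivt a, mul (a, b))) has_derivative (\<lambda>w. \<Theta> a (\<theta> a w))) (at e)"
    using has_derivative_compose[OF has_derivative_\<theta>[OF aV], of "\<lambda>b. mul (ivt a, b)" "\<Theta> a"]
      has_derivative_\<Theta>[OF a] by (simp add: mul_e aV)
  have eq: "mul (ivt a, mul (a, b)) = b" if b: "b \<in> {b. (a, b) \<in> \<Omega>}" for b
  proof -
    have "gr (ivt a) \<circ> gr (mul (a, b)) = gr b"
      using b by (simp only: mem_Collect_eq gr_ivt[OF a] gr_mul comp_assoc[symmetric]
          inv_comp[OF gr_G[OF aV]] id_comp)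
    moreover have "b \<in> V" using b by (simp add: \<Omega>_def)
    ultimately show ?thesis using \<psi>_gr[of b] by (simp add: mul_def[unfolded split_def])
  qed
  have "((\<lambda>b. b) has_derivative (\<lambda>w. \<Theta> a (\<theta> a w))) (at e)"
    by (rule has_derivative_transform_within_open[OF d open_slice _ eq]) (use \<Omega>_e(1)[OF aV] in simp_all)
  from has_derivative_unique[OF this has_derivative_ident] show ?thesis by metis
qed

lemma \<theta>_\<Theta>:
  assumes a: "a \<in> V1"
  shows "\<theta> a (\<Theta> a w) = w"
proof -
  have aV: "a \<in> V" using a V1_V by blast
  have d: "((\<lambda>b. mul (a, mul (ivt a, b))) has_derivative (\<lambda>w. \<theta> a (\<Theta> a w))) (at a)"
    using has_derivative_compose[OF has_derivative_\<Theta>[OF a], of "\<lambda>b. mul (a, b)" "\<theta> a"]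
      has_derivative_\<theta>[OF aV] by (simp add: mul_ivt a)
  have eq: "mul (a, mul (ivt a, b)) = b" if b: "b \<in> {b. (ivt a, b) \<in> \<Omega>}" for b
  proof -
    have "gr a \<circ> gr (mul (ivt a, b)) = gr b"
      using b by (simp only: mem_Collect_eq gr_ivt[OF a] gr_mul comp_assoc[symmetric]
          inv_comp[OF gr_G[OF aV]] id_comp)
    moreover have "b \<in> V" using b by (simp add: \<Omega>_def)
    ultimately show ?thesis using \<psi>_gr[of b] by (simp add: mul_def[unfolded split_def])
  qed
  have "((\<lambda>b. b) has_derivative (\<lambda>w. \<theta> a (\<Theta> a w))) (at a)"
    by (rule has_derivative_transform_within_open[OF d open_slice _ eq]) (use \<Omega>_ivt[OF a] in simp_all)
  from has_derivative_unique[OF this has_derivative_ident] show ?thesis by metis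
qed

lemma \<theta>_e [simp]: "\<theta> e w = w"
proof -
  have "((\<lambda>b. b) has_derivative \<theta> e) (at e)"
    by (rule has_derivative_transform_within_open[OF has_derivative_\<theta>[OF e_V] open_V e_V mul_e(2)])
  from has_derivative_unique[OF this has_derivative_ident] show ?thesis by metis
qed

lemma smooth_\<theta>:
  assumes "open S" "smooth_on a S" "smooth_on w S" "\<And>x. x \<in> S \<Longrightarrow> a x \<in> V"
  shows "smooth_on (\<lambda>x. \<theta> (a x) (w x)) S"
  unfolding \<theta>_def
  by (rule smooth_on_D_apply[OF smooth_mul assms(1) smooth_on_Pair[OF assms(1,2) smooth_on_const[OF assms(1)]]
        smooth_on_Pair[OF assms(1) smooth_on_const[OF assms(1)] assms(3)] \<Omega>_e(1)[OF assms(4)]])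

lemma smooth_\<Theta>:
  assumes "open S" "smooth_on a S" "smooth_on w S" "\<And>x. x \<in> S \<Longrightarrow> a x \<in> V1"
  shows "smooth_on (\<lambda>x. \<Theta> (a x) (w x)) S"
  unfolding \<Theta>_def
  by (rule smooth_on_D_apply[OF smooth_mul assms(1)
        smooth_on_Pair[OF assms(1) smooth_on_compose[OF smooth_ivt assms(2,1,4)] assms(2)]
        smooth_on_Pair[OF assms(1) smooth_on_const[OF assms(1)] assms(3)] \<Omega>_ivt[OF assms(4)]])

lemma smooth_left:
  assumes "g \<in> G"
  shows "smooth_map (group_topology G) B (group_topology G) B (\<lambda>h. g \<circ> h)"
proof -
  have "g \<in> topspace (group_topology G)" unfolding topspace_G by (rule assms)
  from smooth_map_prod_left[OF manG manG manG smooth_mult this] show ?thesis by simp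
qed

lemma smooth_orbit: "smooth_map (group_topology G) B euclidean A (\<lambda>g. g p)"
  using smooth_map_prod_right[OF manG manM manM smooth_action, of p] by simp

text \<open>The mixed second derivative of the product at the identity; its antisymmetric part is the Lie
  bracket.\<close>

definition "\<beta> u w = D (\<lambda>a. \<theta> a w) e u"

lemma left_field_rep:
  assumes "a \<in> V"
  shows "field_rep B \<psi> (\<lambda>g. tangent_map B B (\<lambda>h. g \<circ> h) id X) a = \<theta> a X"
proof -
  have g: "gr a \<in> G" "gr a \<in> fst \<psi>" using gr_G gr_in assms by auto
  have "field_rep B \<psi> (\<lambda>g. tangent_map B B (\<lambda>h. g \<circ> h) id X) a =
      D (snd \<psi> \<circ> (\<lambda>h. gr a \<circ> h) \<circ> gr) (snd \<psi> id) (coord_change \<psi> \<psi> id X)"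
    using tangent_map_rep[OF manG manG smooth_left[OF g(1)] \<psi>(1,1,2), of X] g(2)
    by (simp add: field_rep_def Let_def \<psi>_def[symmetric])
  also have "snd \<psi> \<circ> (\<lambda>h. gr a \<circ> h) \<circ> gr = (\<lambda>b. mul (a, b))" by (auto simp: mul_def)
  also have "D (\<lambda>b. mul (a, b)) (snd \<psi> id) (coord_change \<psi> \<psi> id X) = \<theta> a X"
    using D_eq[OF has_derivative_\<theta>[OF assms]] coord_change_same[OF \<psi>(3,2)] by (simp add: e_def)
  finally show ?thesis .
qed

lemma lie_bracket_eq: "lie_bracket B X Y = \<beta> X Y - \<beta> Y X"
proof -
  have "D (field_rep B \<psi> (\<lambda>g. tangent_map B B (\<lambda>h. g \<circ> h) id X)) e = D (\<lambda>a. \<theta> a X) e" for X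
    by (rule D_cong_open[OF open_V e_V left_field_rep])
  thus ?thesis
    using left_field_rep[OF e_V]
    by (simp add: lie_bracket_def field_bracket_def Let_def \<psi>_def[symmetric] e_def[symmetric] \<beta>_def)
qed

lemma smooth_\<theta>_left: "smooth_on (\<lambda>a. \<theta> a w) V"
  by (rule smooth_\<theta>[OF open_V smooth_on_id[OF open_V] smooth_on_const[OF open_V]])

lemma \<beta>_eq: "\<beta> u w = D (\<lambda>z. D mul z (0, w)) (e, e) (u, 0)"
proof -
  have "(\<lambda>z. D mul z (0, w)) differentiable (at (e, e))"
    using smooth_on_differentiable[OF smooth_on_D[OF smooth_mul]] \<Omega>_e(1)[OF e_V] by blast
  from D_eq[OF has_partial_fst[OF this]] show ?thesis by (simp add: \<beta>_def \<theta>_def)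
qed

lemma \<beta>_eq': "\<beta> u w = D (\<lambda>z. D mul z (u, 0)) (e, e) (0, w)"
  unfolding \<beta>_eq by (rule second_derivative_symmetric[OF smooth_mul open_\<Omega> \<Omega>_e(1)[OF e_V]])

lemma linear_\<beta>: "linear (\<lambda>u. \<beta> u w)" "linear (\<lambda>w. \<beta> u w)"
proof -
  show "linear (\<lambda>u. \<beta> u w)" unfolding \<beta>_def by (rule linear_D[OF smooth_\<theta>_left e_V])
  show "linear (\<lambda>w. \<beta> u w)" unfolding \<beta>_eq'
    by (rule linear_D_snd[OF smooth_on_D[OF smooth_mul] \<Omega>_e(1)[OF e_V]])
qed

lemma linear_lie_bracket: "linear (\<lambda>Y. lie_bracket B X Y)"
  unfolding lie_bracket_eq by (intro linear_compose_sub linear_\<beta>)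

lemma lie_bracket_minus: "lie_bracket B Y X = - lie_bracket B X Y"
  by (simp add: lie_bracket_eq)

text \<open>In coordinates, left velocities are obtained by a smooth function of position and velocity.\<close>

lemma left_velocity_eq:
  assumes "smooth_curve (group_topology G) B I c" "open I" "t \<in> I" "snd \<psi> (c t) \<in> V1" "c t \<in> fst \<psi>"
  shows "left_velocity B c t = \<Theta> (snd \<psi> (c t)) (vector_derivative (snd \<psi> \<circ> c) (at t))"
proof -
  let ?a = "snd \<psi> (c t)"
  have g: "c t \<in> G" "inv (c t) \<in> G" "inv (c t) = gr (ivt ?a)"
    using assms(4,5) fst_\<psi> G_inv gr_ivt gr_\<psi> by auto
  have *: "inv (c t) \<circ> c t = id" by (rule inv_comp(1)[OF g(1)])
  have "left_velocity B c t = coord_change \<psi> \<psi> id (left_velocity B c t)"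
    using coord_change_same[OF \<psi>(3,2)] by simp
  also have "\<dots> = D (snd \<psi> \<circ> (\<lambda>g. inv (c t) \<circ> g) \<circ> gr) ?a
      (coord_change (chart_at B (c t)) \<psi> (c t) (velocity B c t))"
    using tangent_map_rep[OF manG manG smooth_left[OF g(2)] \<psi>(1,1) assms(5), of "velocity B c t"] \<psi>(2)
    unfolding left_velocity_def * \<psi>_def[symmetric] by blast
  also have "snd \<psi> \<circ> (\<lambda>g. inv (c t) \<circ> g) \<circ> gr = (\<lambda>b. mul (ivt ?a, b))"
    using g(3) by (auto simp: mul_def)
  also have "D (\<lambda>b. mul (ivt ?a, b)) ?a = \<Theta> ?a" by (rule D_eq[OF has_derivative_\<Theta>[OF assms(4)]])
  also have "coord_change (chart_at B (c t)) \<psi> (c t) (velocity B c t) = vector_derivative (snd \<psi> \<circ> c) (at t)"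
    by (rule coord_change_velocity[OF manG assms(1-3) \<psi>(1) assms(5)])
  finally show ?thesis .
qed

lemma velocity_at_id:
  assumes "c t = id"
  shows "velocity B c t = vector_derivative (snd \<psi> \<circ> c) (at t)"
  using assms by (simp add: velocity_def \<psi>_def)

end

lemma has_vector_derivative_compose:
  fixes f :: "'c::real_normed_vector \<Rightarrow> 'd::real_normed_vector"
  assumes "(c has_vector_derivative c') (at t)" "(f has_derivative f') (at (c t))"
  shows "((\<lambda>t. f (c t)) has_vector_derivative f' c') (at t)"
proof -
  have "((\<lambda>t. f (c t)) has_derivative (\<lambda>h. f' (h *\<^sub>R c'))) (at t)"
    using has_derivative_compose[OF assms(1)[unfolded has_vector_derivative_def] assms(2)] .
  thus ?thesis using linear_cmul[OF has_derivative_linear[OF assms(2)]]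
    by (simp add: has_vector_derivative_def)
qed

context homogeneous_finsler
begin

section \<open>The action in coordinates and the isotropy algebra\<close>

definition "act \<kappa> = (\<lambda>(a, x). snd \<kappa> (gr a (chart_inv \<kappa> x)))"
definition "\<Omega>act \<kappa> = {(a, x). a \<in> V \<and> x \<in> snd \<kappa> ` fst \<kappa> \<and> gr a (chart_inv \<kappa> x) \<in> fst \<kappa>}"
definition "orb \<kappa> a = snd \<kappa> (gr a x0)"
definition "Vorb \<kappa> = {a \<in> V. gr a x0 \<in> fst \<kappa>}"

definition "\<delta> = orbit_differential A B x0"
definition "\<hh> = lie_subalgebra G B (isotropy G x0)"

lemma
  assumes "\<kappa> \<in> A"
  shows open_\<Omega>act: "open (\<Omega>act \<kappa>)" and smooth_act: "smooth_on (act \<kappa>) (\<Omega>act \<kappa>)"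
  using smooth_map_prod_rep[OF manG manM manM smooth_action \<psi>(1) assms assms]
  by (simp_all add: \<Omega>act_def act_def)

lemma
  assumes "\<kappa> \<in> A"
  shows open_Vorb: "open (Vorb \<kappa>)" and smooth_orb: "smooth_on (orb \<kappa>) (Vorb \<kappa>)"
proof -
  let ?f = "\<lambda>g :: 'm \<Rightarrow> 'm. g x0"
  have eq: "Vorb \<kappa> = snd \<psi> ` (fst \<psi> \<inter> ?f -` fst \<kappa>)"
  proof (intro equalityI subsetI)
    fix a assume "a \<in> Vorb \<kappa>"
    hence "gr a \<in> fst \<psi> \<inter> ?f -` fst \<kappa>" "a = snd \<psi> (gr a)" using gr_in \<psi>_gr by (auto simp: Vorb_def)
    thus "a \<in> snd \<psi> ` (fst \<psi> \<inter> ?f -` fst \<kappa>)" by blast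
  qed (auto simp: Vorb_def gr_\<psi>)
  have c: "continuous_map (group_topology G) euclidean ?f"
    using smooth_orbit[of x0] by (simp add: smooth_map_def)
  show "open (Vorb \<kappa>)" unfolding eq by (rule open_rep_domain[OF \<psi>(3) manifold_chart[OF manM assms] c])
  have "smooth_on (snd \<kappa> \<circ> ?f \<circ> gr) (snd \<psi> ` (fst \<psi> \<inter> ?f -` fst \<kappa>))"
    using smooth_orbit[of x0] \<psi>(1) assms unfolding smooth_map_def by blast
  moreover have "snd \<kappa> \<circ> ?f \<circ> gr = orb \<kappa>" by (auto simp: orb_def)
  ultimately show "smooth_on (orb \<kappa>) (Vorb \<kappa>)" by (simp add: eq)
qed

lemma Vorb_V: "Vorb \<kappa> \<subseteq> V" by (auto simp: Vorb_def)

lemma e_Vorb: "x0 \<in> fst \<kappa> \<Longrightarrow> e \<in> Vorb \<kappa>" using e_V by (simp add: Vorb_def)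

lemma orb_e: "orb \<kappa> e = snd \<kappa> x0" by (simp add: orb_def)

lemma chart_inv_orb: "\<kappa> \<in> A \<Longrightarrow> a \<in> Vorb \<kappa> \<Longrightarrow> chart_inv \<kappa> (orb \<kappa> a) = gr a x0"
  using chart_inv_snd[OF manifold_chart[OF manM]] by (simp add: Vorb_def orb_def)

lemma \<Omega>act_x0: "\<kappa> \<in> A \<Longrightarrow> x0 \<in> fst \<kappa> \<Longrightarrow> a \<in> Vorb \<kappa> \<Longrightarrow> (a, snd \<kappa> x0) \<in> \<Omega>act \<kappa>"
  using chart_inv_snd[OF manifold_chart[OF manM]] by (auto simp: Vorb_def \<Omega>act_def)

lemma act_x0: "\<kappa> \<in> A \<Longrightarrow> x0 \<in> fst \<kappa> \<Longrightarrow> act \<kappa> (a, snd \<kappa> x0) = orb \<kappa> a"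
  using chart_inv_snd[OF manifold_chart[OF manM]] by (simp add: act_def orb_def)

lemma orb_mul:
  assumes "\<kappa> \<in> A" "(a, b) \<in> \<Omega>" "b \<in> Vorb \<kappa>"
  shows "orb \<kappa> (mul (a, b)) = act \<kappa> (a, orb \<kappa> b)"
  using assms by (simp add: act_def chart_inv_orb orb_def[of _ "mul _"] gr_mul)

lemma orb_has_D: "\<kappa> \<in> A \<Longrightarrow> a \<in> Vorb \<kappa> \<Longrightarrow> (orb \<kappa> has_derivative D (orb \<kappa>) a) (at a)"
  by (rule smooth_on_has_D[OF smooth_orb])

lemma act_differentiable: "\<kappa> \<in> A \<Longrightarrow> z \<in> \<Omega>act \<kappa> \<Longrightarrow> act \<kappa> differentiable (at z)"
  by (rule smooth_on_differentiable[OF smooth_act])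

text \<open>The orbit map intertwines the left translations of the group with the action.\<close>

lemma D_orb_\<theta>:
  assumes \<kappa>: "\<kappa> \<in> A" "x0 \<in> fst \<kappa>" and a: "a \<in> Vorb \<kappa>"
  shows "D (orb \<kappa>) a (\<theta> a w) = D (act \<kappa>) (a, snd \<kappa> x0) (0, D (orb \<kappa>) e w)"
proof -
  have aV: "a \<in> V" using a Vorb_V by blast
  have d1: "((\<lambda>b. orb \<kappa> (mul (a, b))) has_derivative (\<lambda>w. D (orb \<kappa>) a (\<theta> a w))) (at e)"
    using has_derivative_compose[OF has_derivative_\<theta>[OF aV], of "orb \<kappa>"] orb_has_D[OF \<kappa>(1) a]
    by (simp add: mul_e aV)
  have "((\<lambda>x. act \<kappa> (a, x)) has_derivative (\<lambda>w. D (act \<kappa>) (a, snd \<kappa> x0) (0, w))) (at (orb \<kappa> e))"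
    unfolding orb_e by (rule has_partial_snd[OF act_differentiable[OF \<kappa>(1) \<Omega>act_x0[OF \<kappa> a]]])
  from has_derivative_compose[OF orb_has_D[OF \<kappa>(1) e_Vorb[OF \<kappa>(2)]] this]
  have d2: "((\<lambda>b. act \<kappa> (a, orb \<kappa> b)) has_derivative
      (\<lambda>w. D (act \<kappa>) (a, snd \<kappa> x0) (0, D (orb \<kappa>) e w))) (at e)" .
  have o: "open ({b. (a, b) \<in> \<Omega>} \<inter> Vorb \<kappa>)" by (intro open_Int open_slice open_Vorb \<kappa>)
  have m: "e \<in> {b. (a, b) \<in> \<Omega>} \<inter> Vorb \<kappa>" using \<Omega>_e(1)[OF aV] e_Vorb[OF \<kappa>(2)] by simp
  have "act \<kappa> (a, orb \<kappa> b) = orb \<kappa> (mul (a, b))" if "b \<in> {b. (a, b) \<in> \<Omega>} \<inter> Vorb \<kappa>" for b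
    using orb_mul[OF \<kappa>(1)] that by simp
  from has_derivative_transform_within_open[OF d2 o m this]
  show ?thesis using has_derivative_unique[OF d1] by metis
qed

lemma coord_change_\<delta>:
  assumes "\<kappa> \<in> A" "x0 \<in> fst \<kappa>"
  shows "coord_change (chart_at A x0) \<kappa> x0 (\<delta> v) = D (orb \<kappa>) e v"
proof -
  have "coord_change (chart_at A x0) \<kappa> x0 (\<delta> v) =
      D (snd \<kappa> \<circ> (\<lambda>g. g x0) \<circ> gr) (snd \<psi> id) (coord_change \<psi> \<psi> id v)"
    using tangent_map_rep[where f="\<lambda>g. g x0" and p=id and v=v,
        OF manG manM smooth_orbit \<psi>(1) assms(1) \<psi>(2)] assms(2)
    by (simp add: \<delta>_def orbit_differential_def \<psi>_def)
  also have "snd \<kappa> \<circ> (\<lambda>g. g x0) \<circ> gr = orb \<kappa>" by (auto simp: orb_def)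
  also have "coord_change \<psi> \<psi> id v = v" by (rule coord_change_same[OF \<psi>(3,2)])
  finally show ?thesis unfolding e_def .
qed

definition "\<kappa>0 = chart_at A x0"

lemma \<kappa>0: "\<kappa>0 \<in> A" "x0 \<in> fst \<kappa>0"
  using chart_at_M[of x0] by (auto simp: \<kappa>0_def)

lemma \<delta>_eq: "\<delta> v = D (orb \<kappa>0) e v"
  using coord_change_\<delta>[OF \<kappa>0, of v] coord_change_same[OF manifold_chart[OF manM \<kappa>0(1)] \<kappa>0(2), of "\<delta> v"]
  by (simp add: \<kappa>0_def[symmetric])

lemma linear_\<delta>: "linear \<delta>"
  using linear_D[OF smooth_orb[OF \<kappa>0(1)] e_Vorb[OF \<kappa>0(2)]] unfolding \<delta>_eq[abs_def, symmetric] .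

lemma D_orb_eq_0: "\<kappa> \<in> A \<Longrightarrow> x0 \<in> fst \<kappa> \<Longrightarrow> D (orb \<kappa>) e v = 0 \<longleftrightarrow> \<delta> v = 0"
  using coord_change_\<delta>[of \<kappa> v] coord_change_eq_0_iff[OF manM \<kappa>0(1) _ \<kappa>0(2), of \<kappa> "\<delta> v"]
  by (simp add: \<kappa>0_def[symmetric])

text \<open>The kernel of \<open>\<delta>\<close> is the isotropy algebra: the integral curve of the left-invariant field
  generated by a vector in the kernel fixes the point \<open>x0\<close>, because by equivariance its image under
  the orbit map has zero velocity.\<close>

lemma \<hh>_eq: "\<hh> = {v. \<delta> v = 0}"
proof (intro equalityI subsetI)
  fix v assume "v \<in> \<hh>"
  then obtain c \<epsilon> where c: "v = velocity B c 0" "0 < \<epsilon>" "smooth_curve (group_topology G) B {-\<epsilon><..<\<epsilon>} c"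
    "c 0 = id" "\<And>t. t \<in> {-\<epsilon><..<\<epsilon>} \<Longrightarrow> c t \<in> isotropy G x0"
    unfolding \<hh>_def lie_subalgebra_def by blast
  let ?I = "{-\<epsilon><..<\<epsilon>}"
  have z: "0 \<in> ?I" using c(2) by simp
  have c0: "c 0 \<in> fst \<psi>" using c(4) \<psi>(2) by simp
  have "((snd \<psi> \<circ> c) has_vector_derivative v) (at 0)"
    using curve_rep_has_derivative[OF manG c(3) _ z \<psi>(1) c0] velocity_at_id[of c 0] c(1,4) by simp
  moreover have "(orb \<kappa>0 has_derivative D (orb \<kappa>0) e) (at ((snd \<psi> \<circ> c) 0))"
    using orb_has_D[OF \<kappa>0(1) e_Vorb[OF \<kappa>0(2)]] c(4) by (simp add: e_def)
  ultimately have d: "((\<lambda>t. orb \<kappa>0 ((snd \<psi> \<circ> c) t)) has_vector_derivative D (orb \<kappa>0) e v) (at 0)"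
    by (rule has_vector_derivative_compose)
  have o: "open {t \<in> ?I. c t \<in> fst \<psi>}"
    using c(3) unfolding smooth_curve_def
    by (intro open_curve_domain[OF _ open_greaterThanLessThan chart_openin[OF \<psi>(3)]]) (rule conjunct1)
  have eq: "orb \<kappa>0 ((snd \<psi> \<circ> c) t) = snd \<kappa>0 x0" if "t \<in> {t \<in> ?I. c t \<in> fst \<psi>}" for t
    using that c(5)[of t] by (simp add: orb_def gr_\<psi> isotropy_def)
  have "((\<lambda>t. snd \<kappa>0 x0) has_vector_derivative D (orb \<kappa>0) e v) (at 0)"
    by (rule has_vector_derivative_transform_within_open[OF d o _ eq]) (use z c0 in auto)
  hence "D (orb \<kappa>0) e v = 0"
    using vector_derivative_at[OF has_vector_derivative_const] vector_derivative_at by metis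
  thus "v \<in> {v. \<delta> v = 0}" by (simp add: \<delta>_eq)
next
  fix X assume "X \<in> {v. \<delta> v = 0}"
  hence X: "D (orb \<kappa>0) e X = 0" by (simp add: \<delta>_eq)
  have s: "smooth_on (\<lambda>a. \<theta> a X) (Vorb \<kappa>0)"
    by (rule smooth_on_subset[OF smooth_\<theta>_left Vorb_V])
  obtain \<epsilon> a where a: "0 < \<epsilon>" "a 0 = e" "smooth_on a {-\<epsilon><..<\<epsilon>}"
    "\<And>t. t \<in> {-\<epsilon><..<\<epsilon>} \<Longrightarrow> a t \<in> Vorb \<kappa>0"
    "\<And>t. t \<in> {-\<epsilon><..<\<epsilon>} \<Longrightarrow> (a has_vector_derivative \<theta> (a t) X) (at t)"
    using ode_solution[OF s open_Vorb[OF \<kappa>0(1)] e_Vorb[OF \<kappa>0(2)]] by metis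
  let ?I = "{-\<epsilon><..<\<epsilon>}"
  have z: "0 \<in> ?I" using a(1) by simp
  have aV: "a t \<in> V" if "t \<in> ?I" for t using a(4)[OF that] Vorb_V by blast
  have d: "((\<lambda>t. orb \<kappa>0 (a t)) has_vector_derivative 0) (at t)" if t: "t \<in> ?I" for t
  proof -
    have "D (orb \<kappa>0) (a t) (\<theta> (a t) X) = 0"
      unfolding D_orb_\<theta>[OF \<kappa>0 a(4)[OF t]] X
      using linear_0[OF linear_D[OF smooth_act[OF \<kappa>0(1)] \<Omega>act_x0[OF \<kappa>0 a(4)[OF t]]]]
      by (simp add: zero_prod_def)
    thus ?thesis using has_vector_derivative_compose[OF a(5)[OF t] orb_has_D[OF \<kappa>0(1) a(4)[OF t]]] by simp
  qed
  have orb_const: "orb \<kappa>0 (a t) = snd \<kappa>0 x0" if "t \<in> ?I" for t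
    by (rule equal_derivatives_imp_equal[OF d has_vector_derivative_const z _ that]) (simp_all add: a(2) orb_e)
  have fix_x0: "gr (a t) x0 = x0" if "t \<in> ?I" for t
    using chart_inv_orb[OF \<kappa>0(1) a(4)[OF that]] orb_const[OF that]
      chart_inv_snd[OF manifold_chart[OF manM \<kappa>0(1)] \<kappa>0(2)] by simp
  have sc: "smooth_curve (group_topology G) B ?I (\<lambda>t. gr (a t))"
    by (rule smooth_curveI[OF manG \<psi>(1) _ a(3) aV]) simp_all
  have "(a has_vector_derivative X) (at 0)" using a(5)[OF z] by (simp add: a(2))
  hence "((snd \<psi> \<circ> (\<lambda>t. gr (a t))) has_vector_derivative X) (at 0)"
    by (rule has_vector_derivative_transform_within_open[of _ _ _ ?I]) (use z aV \<psi>_gr in auto)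
  hence "velocity B (\<lambda>t. gr (a t)) 0 = X"
    using velocity_at_id[of "\<lambda>t. gr (a t)" 0] by (simp add: a(2) vector_derivative_at)
  moreover have "gr (a t) \<in> isotropy G x0" if "t \<in> ?I" for t
    using fix_x0[OF that] gr_G[OF aV[OF that]] by (simp add: isotropy_def)
  moreover have "gr (a 0) = id" by (simp add: a(2))
  ultimately show "X \<in> \<hh>" unfolding \<hh>_def lie_subalgebra_def using a(1) sc
    by (intro CollectI exI[of _ "\<lambda>t. gr (a t)"] conjI exI[of _ \<epsilon>]) simp_all
qed

lemma reductive_facts: "subspace m" "\<hh> \<inter> m = {0}" "\<exists>Y\<in>\<hh>. \<exists>Z\<in>m. X = Y + Z"
  using reductive by (auto simp: reductive_decomposition_def Let_def \<hh>_def)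

lemma \<delta>_inj: "inj_on \<delta> m"
proof (rule inj_onI)
  fix y z assume yz: "y \<in> m" "z \<in> m" "\<delta> y = \<delta> z"
  hence "y - z \<in> \<hh> \<inter> m" using subspace_diff[OF reductive_facts(1)] by (simp add: \<hh>_eq linear_diff[OF linear_\<delta>])
  thus "y = z" using reductive_facts(2) by simp
qed

lemma \<delta>_eq_0: "y \<in> m \<Longrightarrow> \<delta> y = 0 \<longleftrightarrow> y = 0"
  using reductive_facts(2) linear_0[OF linear_\<delta>] unfolding \<hh>_eq by blast

definition "prm = proj_m G B x0 m"

text \<open>The projection to \<open>m\<close> replaces a vector by the element of \<open>m\<close> with the same image under \<open>\<delta>\<close>;
  quantities that factor through \<open>\<delta>\<close> do not see it.\<close>

lemma prm: "prm X \<in> m" "\<delta> (prm X) = \<delta> X"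
proof -
  obtain Y Z where YZ: "Y \<in> \<hh>" "Z \<in> m" "X = Y + Z" using reductive_facts(3) by blast
  have "prm X = Z" unfolding prm_def proj_m_def \<hh>_def[symmetric]
  proof (rule the_equality)
    show "Z \<in> m \<and> X - Z \<in> \<hh>" using YZ by simp
    fix Z' assume Z': "Z' \<in> m \<and> X - Z' \<in> \<hh>"
    hence "\<delta> Z' = \<delta> Z" using YZ by (simp add: \<hh>_eq linear_diff[OF linear_\<delta>] linear_add[OF linear_\<delta>])
    thus "Z' = Z" using \<delta>_inj Z' YZ(2) by (simp add: inj_on_def)
  qed
  thus "prm X \<in> m" "\<delta> (prm X) = \<delta> X" using YZ by (auto simp: \<hh>_eq linear_add[OF linear_\<delta>])
qed

lemma prm_unique: "Z \<in> m \<Longrightarrow> \<delta> Z = \<delta> X \<Longrightarrow> prm X = Z"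
  using \<delta>_inj prm by (metis inj_onD)

lemma linear_prm: "linear prm"
proof (rule linearI)
  show "prm (X + Y) = prm X + prm Y" for X Y
    using prm subspace_add[OF reductive_facts(1)] by (intro prm_unique) (simp_all add: linear_add[OF linear_\<delta>])
  show "prm (c *\<^sub>R X) = c *\<^sub>R prm X" for c X
    using prm subspace_scale[OF reductive_facts(1)] by (intro prm_unique) (simp_all add: linear_cmul[OF linear_\<delta>])
qed

section \<open>The orbit map is a submersion\<close>

lemma D_mul_e: "D mul (e, e) (u, w) = u + w"
proof -
  have d: "mul differentiable (at (e, e))" by (rule mul_differentiable[OF \<Omega>_e(1)[OF e_V]])
  have "((\<lambda>a. a) has_derivative (\<lambda>v. D mul (e, e) (v, 0))) (at e)"
    by (rule has_derivative_transform_within_open[OF has_partial_fst[OF d] open_V e_V mul_e(1)])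
  from has_derivative_unique[OF this has_derivative_ident] have "D mul (e, e) (u, 0) = u" by metis
  moreover have "D mul (e, e) (0, w) = w" using \<theta>_e[of w] by (simp add: \<theta>_def)
  moreover have "D mul (e, e) ((u, 0) + (0, w)) = D mul (e, e) (u, 0) + D mul (e, e) (0, w)"
    by (rule linear_add[OF linear_D[OF smooth_mul \<Omega>_e(1)[OF e_V]]])
  ultimately show ?thesis by simp
qed

text \<open>A product of one curve in the isotropy group for each vector of an orthonormal basis yields a
  map into the isotropy group with a prescribed differential at the origin.\<close>

lemma isotropy_parametrization:
  assumes "finite I" "\<And>i. i \<in> I \<Longrightarrow> P i \<in> \<hh>"
  shows "\<exists>K S. open S \<and> 0 \<in> S \<and> (\<forall>v\<in>S. K v \<in> fst \<psi> \<and> K v x0 = x0) \<and> K 0 = id \<and>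
    continuous_on S (\<lambda>v. snd \<psi> (K v)) \<and>
    ((\<lambda>v. snd \<psi> (K v)) has_derivative (\<lambda>v. \<Sum>i\<in>I. (v \<bullet> i) *\<^sub>R P i)) (at (0 :: 'b))"
  using assms
proof (induction I rule: finite_induct)
  case empty
  show ?case using \<psi>(2) by (intro exI[of _ "\<lambda>_. id"] exI[of _ UNIV]) (auto simp: id_def)
next
  case (insert i I)
  obtain K S where K: "open S" "0 \<in> S" "\<And>v. v \<in> S \<Longrightarrow> K v \<in> fst \<psi>" "\<And>v. v \<in> S \<Longrightarrow> K v x0 = x0" "K 0 = id"
    "continuous_on S (\<lambda>v. snd \<psi> (K v))"
    "((\<lambda>v. snd \<psi> (K v)) has_derivative (\<lambda>v. \<Sum>i\<in>I. (v \<bullet> i) *\<^sub>R P i)) (at 0)"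
    using insert.IH[OF insert.prems[OF insertI2]] by blast
  obtain c \<epsilon> where c: "P i = velocity B c 0" "0 < \<epsilon>" "smooth_curve (group_topology G) B {-\<epsilon><..<\<epsilon>} c"
    "c 0 = id" "\<And>t. t \<in> {-\<epsilon><..<\<epsilon>} \<Longrightarrow> c t \<in> isotropy G x0"
    using insert.prems[of i] unfolding \<hh>_def lie_subalgebra_def by blast
  define J where "J = {t \<in> {-\<epsilon><..<\<epsilon>}. c t \<in> fst \<psi>}"
  have J: "open J" unfolding J_def using c(3) unfolding smooth_curve_def
    by (intro open_curve_domain[OF _ open_greaterThanLessThan chart_openin[OF \<psi>(3)]]) (rule conjunct1)
  have J0: "0 \<in> J" using c(2,4) \<psi>(2) by (simp add: J_def)
  have "smooth_on (snd \<psi> \<circ> c) J" using c(3) \<psi>(1) unfolding smooth_curve_def J_def by blast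
  hence cJ: "continuous_on J (snd \<psi> \<circ> c)" by (rule smooth_on_continuous)
  have c0: "c 0 \<in> fst \<psi>" using c(4) \<psi>(2) by simp
  have c': "((snd \<psi> \<circ> c) has_vector_derivative P i) (at 0)"
    using curve_rep_has_derivative[OF manG c(3) _ _ \<psi>(1) c0] velocity_at_id[of c 0] c(1,2,4) by simp
  define f where "f v = (snd \<psi> (K v), (snd \<psi> \<circ> c) (v \<bullet> i))" for v
  define S1 where "S1 = S \<inter> (\<lambda>v. v \<bullet> i) -` J"
  have S1: "open S1" unfolding S1_def
    by (intro open_Int K(1) open_vimage[OF J]) (intro continuous_intros)
  have cf: "continuous_on S1 f" unfolding f_def
  proof (rule continuous_on_Pair)
    show "continuous_on S1 (\<lambda>v. snd \<psi> (K v))"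
      by (rule continuous_on_subset[OF K(6)]) (simp add: S1_def)
    have "continuous_on S1 (\<lambda>v. v \<bullet> i)" by (intro continuous_intros)
    thus "continuous_on S1 (\<lambda>v. (snd \<psi> \<circ> c) (v \<bullet> i))"
      by (rule continuous_on_compose2[OF cJ]) (auto simp: S1_def)
  qed
  define S2 where "S2 = S1 \<inter> f -` \<Omega>"
  have S2: "open S2" unfolding S2_def by (rule continuous_open_preimage[OF cf S1 open_\<Omega>])
  have f0: "f 0 = (e, e)" by (simp add: f_def K(5) c(4) e_def)
  have m: "0 \<in> S2" using f0 K(2) J0 \<Omega>_e(1)[OF e_V] by (simp add: S2_def S1_def)
  define K' where "K' v = K v \<circ> c (v \<bullet> i)" for v
  have mulf: "mul (f v) = snd \<psi> (K' v)" "K' v \<in> fst \<psi>" "K' v x0 = x0" if "v \<in> S2" for v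
  proof -
    have v: "v \<in> S" "v \<bullet> i \<in> J" "f v \<in> \<Omega>" using that by (auto simp: S2_def S1_def)
    have g: "gr (snd \<psi> (K v)) = K v" "gr ((snd \<psi> \<circ> c) (v \<bullet> i)) = c (v \<bullet> i)"
      using gr_\<psi> K(3) v by (auto simp: J_def)
    show "mul (f v) = snd \<psi> (K' v)" unfolding f_def mul_def K'_def using g by simp
    show "K' v \<in> fst \<psi>" using v(3) g unfolding f_def \<Omega>_def K'_def by auto
    show "K' v x0 = x0" using K(4)[OF v(1)] c(5)[of "v \<bullet> i"] v(2) by (simp add: K'_def J_def isotropy_def)
  qed
  have "continuous_on S2 (\<lambda>v. mul (f v))"
  proof (rule continuous_on_compose2[OF smooth_on_continuous[OF smooth_mul]])
    show "continuous_on S2 f" by (rule continuous_on_subset[OF cf]) (simp add: S2_def)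
  qed (auto simp: S2_def)
  hence cont: "continuous_on S2 (\<lambda>v. snd \<psi> (K' v))" using mulf(1) by (simp cong: continuous_on_cong)
  have "((\<lambda>v. (snd \<psi> \<circ> c) (v \<bullet> i)) has_derivative (\<lambda>v. (v \<bullet> i) *\<^sub>R P i)) (at 0)"
  proof -
    have 1: "((\<lambda>v. v \<bullet> i) has_derivative (\<lambda>v. v \<bullet> i)) (at 0)"
      by (rule bounded_linear_imp_has_derivative[OF bounded_linear_inner_left])
    have "((snd \<psi> \<circ> c) has_derivative (\<lambda>h. h *\<^sub>R P i)) (at (0 \<bullet> i))"
      using c' by (simp add: has_vector_derivative_def)
    from has_derivative_compose[OF 1 this] show ?thesis .
  qed
  from has_derivative_Pair[OF K(7) this]
  have df: "(f has_derivative (\<lambda>v. (\<Sum>i\<in>I. (v \<bullet> i) *\<^sub>R P i, (v \<bullet> i) *\<^sub>R P i))) (at 0)"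
    unfolding f_def[abs_def] .
  have "(mul has_derivative D mul (e, e)) (at (f 0))"
    unfolding f0 by (rule has_D[OF mul_differentiable[OF \<Omega>_e(1)[OF e_V]]])
  from has_derivative_compose[OF df this]
  have "((\<lambda>v. mul (f v)) has_derivative (\<lambda>v. (\<Sum>i\<in>I. (v \<bullet> i) *\<^sub>R P i) + (v \<bullet> i) *\<^sub>R P i)) (at 0)"
    by (simp add: D_mul_e)
  from has_derivative_transform_within_open[OF this S2 m mulf(1)]
  have "((\<lambda>v. snd \<psi> (K' v)) has_derivative (\<lambda>v. \<Sum>i\<in>insert i I. (v \<bullet> i) *\<^sub>R P i)) (at 0)"
    using insert.hyps by (simp add: add.commute)
  moreover have "K' 0 = id" using K(5) c(4) by (simp add: K'_def)
  ultimately show ?case using S2 m mulf(2,3) cont by blast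
qed

text \<open>By the open mapping property, a neighbourhood of the identity lies in the product of the slice
  \<open>e + m\<close> and the isotropy group, so a neighbourhood of the identity has the same orbit as a
  piece of the slice.\<close>

lemma slice_neighbourhood:
  obtains O' where "openin (group_topology G) O'" "id \<in> O'"
    "\<And>g. g \<in> O' \<Longrightarrow> \<exists>y\<in>m. e + y \<in> Vorb \<kappa>0 \<and> g x0 = gr (e + y) x0"
proof -
  define P where "P v = v - prm v" for v
  have Ph: "P v \<in> \<hh>" for v by (simp add: P_def \<hh>_eq linear_diff[OF linear_\<delta>] prm)
  have linP: "linear P" unfolding P_def[abs_def]
    by (rule linearI) (simp_all add: linear_add[OF linear_prm] linear_cmul[OF linear_prm] algebra_simps)
  have "\<exists>K S. open S \<and> 0 \<in> S \<and> (\<forall>v\<in>S. K v \<in> fst \<psi> \<and> K v x0 = x0) \<and> K 0 = id \<and>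
    continuous_on S (\<lambda>v. snd \<psi> (K v)) \<and>
    ((\<lambda>v. snd \<psi> (K v)) has_derivative (\<lambda>v. \<Sum>i\<in>Basis. (v \<bullet> i) *\<^sub>R P i)) (at 0)"
    by (rule isotropy_parametrization[OF finite_Basis Ph])
  then obtain K S where K: "open S" "0 \<in> S" "\<forall>v\<in>S. K v \<in> fst \<psi> \<and> K v x0 = x0" "K 0 = id"
    "continuous_on S (\<lambda>v. snd \<psi> (K v))"
    "((\<lambda>v. snd \<psi> (K v)) has_derivative (\<lambda>v. \<Sum>i\<in>Basis. (v \<bullet> i) *\<^sub>R P i)) (at 0)"
    by (elim exE conjE)
  have "(\<Sum>i\<in>Basis. (v \<bullet> i) *\<^sub>R P i) = P v" for v
    using linear_sum[OF linP, of "\<lambda>i. (v \<bullet> i) *\<^sub>R i" Basis]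
    by (simp add: euclidean_representation linear_cmul[OF linP])
  hence K': "((\<lambda>v. snd \<psi> (K v)) has_derivative P) (at 0)" using K(6) by simp
  have bl: "bounded_linear prm" using linear_prm by (simp add: linear_conv_bounded_linear)
  define f where "f v = (e + prm v, snd \<psi> (K v))" for v
  have cf: "continuous_on S f" unfolding f_def
    by (rule continuous_on_Pair[OF continuous_on_add[OF continuous_on_const linear_continuous_on[OF bl]] K(5)])
  define W where "W = \<Omega> \<inter> (Vorb \<kappa>0 \<times> UNIV)"
  have W: "open W" unfolding W_def by (intro open_Int open_\<Omega> open_Times open_Vorb \<kappa>0 open_UNIV)
  define S2 where "S2 = S \<inter> f -` W"
  have S2: "open S2" unfolding S2_def by (rule continuous_open_preimage[OF cf K(1) W])
  have f0: "f 0 = (e, e)" by (simp add: f_def linear_0[OF linear_prm] K(4) e_def)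
  have m: "0 \<in> S2" using f0 K(2) \<Omega>_e(1)[OF e_V] e_Vorb[OF \<kappa>0(2)] by (simp add: S2_def W_def)
  have cont: "continuous_on S2 (\<lambda>v. mul (f v))"
  proof (rule continuous_on_compose2[OF smooth_on_continuous[OF smooth_mul]])
    show "continuous_on S2 f" by (rule continuous_on_subset[OF cf]) (simp add: S2_def)
  qed (auto simp: S2_def W_def)
  have "((\<lambda>v. e + prm v) has_derivative prm) (at 0)"
    using has_derivative_add[OF has_derivative_const[of e] bounded_linear_imp_has_derivative[OF bl]] by simp
  from has_derivative_Pair[OF this K']
  have df: "(f has_derivative (\<lambda>v. (prm v, P v))) (at 0)" unfolding f_def[abs_def] .
  have "(mul has_derivative D mul (e, e)) (at (f 0))"
    unfolding f0 by (rule has_D[OF mul_differentiable[OF \<Omega>_e(1)[OF e_V]]])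
  from has_derivative_compose[OF df this]
  have d: "((\<lambda>v. mul (f v)) has_derivative (\<lambda>v. v)) (at 0)" by (simp add: D_mul_e P_def)
  have int: "mul (f 0) \<in> interior ((\<lambda>v. mul (f v)) ` S2)"
    using S2 m
    by (intro sussmann_open_mapping[OF S2 cont m d bounded_linear_ident _ order_refl])
      (auto simp: interior_open)
  define O' where "O' = {g \<in> fst \<psi>. snd \<psi> g \<in> interior ((\<lambda>v. mul (f v)) ` S2)}"
  show thesis
  proof (rule that[of O'])
    show "openin (group_topology G) O'" unfolding O'_def
      by (rule openin_chart_vimage[OF \<psi>(3) open_interior])
    have "mul (e, e) = e" by (rule mul_e(1)[OF e_V])
    thus "id \<in> O'" using int \<psi>(2) by (simp add: O'_def f0 e_def[symmetric])
    fix g assume g: "g \<in> O'"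
    then obtain v where v: "v \<in> S2" "snd \<psi> g = mul (f v)"
      using interior_subset unfolding O'_def by blast
    have \<Omega>: "(e + prm v, snd \<psi> (K v)) \<in> \<Omega>" and vo: "e + prm v \<in> Vorb \<kappa>0" and vS: "v \<in> S"
      using v(1) by (auto simp: S2_def W_def f_def)
    have "g = gr (snd \<psi> g)" using g gr_\<psi> by (simp add: O'_def)
    also have "\<dots> = gr (e + prm v) \<circ> gr (snd \<psi> (K v))" unfolding v(2) f_def by (rule gr_mul[OF \<Omega>])
    also have "\<dots> = gr (e + prm v) \<circ> K v" using gr_\<psi> K(3) vS by simp
    finally have "g x0 = gr (e + prm v) x0" using K(3) vS by simp
    thus "\<exists>y\<in>m. e + y \<in> Vorb \<kappa>0 \<and> g x0 = gr (e + y) x0" using vo prm(1) by blast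
  qed
qed

text \<open>If \<open>\<delta>\<close> is not onto, \<open>m\<close> is the image of a proper subspace of \<open>\<real>\<^sup>n\<close> under a linear map, and
  a differentiable map takes this null set to a null set.\<close>

lemma negligible_slice_image:
  assumes "\<delta> ` m \<noteq> UNIV"
  shows "negligible (orb \<kappa>0 ` {e + y | y. y \<in> m \<and> e + y \<in> Vorb \<kappa>0})"
proof -
  have sub: "subspace (\<delta> ` m)" by (rule linear_subspace_image[OF linear_\<delta> reductive_facts(1)])
  have "dim (\<delta> ` m) < DIM(real^'n)"
    using dim_eq_full[of "\<delta> ` m"] span_eq_iff[of "\<delta> ` m"] sub assms dim_subset_UNIV[of "\<delta> ` m"]
    by (metis order_le_imp_less_or_eq)
  hence neg: "negligible (\<delta> ` m)" by (rule negligible_lowdim)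
  obtain J where J: "linear J" "\<And>v. v \<in> m \<Longrightarrow> J (\<delta> v) = v"
    using linear_exists_left_inverse_on[OF linear_\<delta> reductive_facts(1) \<delta>_inj] by blast
  define Q where "Q = {z \<in> \<delta> ` m. e + J z \<in> Vorb \<kappa>0}"
  have "(\<lambda>z. orb \<kappa>0 (e + J z)) differentiable_on Q" unfolding differentiable_on_def
  proof
    fix z assume z: "z \<in> Q"
    have "(\<lambda>z. e + J z) differentiable (at z)"
      using linear_imp_differentiable[OF J(1)] by (intro differentiable_add) auto
    moreover have "orb \<kappa>0 differentiable (at (e + J z))"
      using smooth_on_differentiable[OF smooth_orb[OF \<kappa>0(1)]] z by (simp add: Q_def)
    ultimately have "(orb \<kappa>0 \<circ> (\<lambda>z. e + J z)) differentiable (at z)"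
      by (rule differentiable_chain_at)
    thus "(\<lambda>z. orb \<kappa>0 (e + J z)) differentiable (at z within Q)"
      by (simp add: o_def differentiable_at_withinI)
  qed
  moreover have "negligible Q" by (rule negligible_subset[OF neg]) (auto simp: Q_def)
  ultimately have "negligible ((\<lambda>z. orb \<kappa>0 (e + J z)) ` Q)"
    using negligible_differentiable_image_negligible[of Q "\<lambda>z. orb \<kappa>0 (e + J z)"] by simp
  moreover have "(\<lambda>z. orb \<kappa>0 (e + J z)) ` Q = orb \<kappa>0 ` {e + y | y. y \<in> m \<and> e + y \<in> Vorb \<kappa>0}"
    using J(2) by (force simp: Q_def image_iff)
  ultimately show ?thesis by simp
qed

text \<open>If \<open>\<delta>\<close> were not onto, the orbit of a neighbourhood of the identity would be a null set
  in the chart, and \<open>M\<close>, being covered by countably many translates of it, would be a null set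
  as well.\<close>

lemma \<delta>_surj: "\<delta> ` m = UNIV"
proof (rule ccontr)
  assume "\<delta> ` m \<noteq> UNIV"
  define Z where "Z = orb \<kappa>0 ` {e + y | y. y \<in> m \<and> e + y \<in> Vorb \<kappa>0}"
  have negZ: "negligible Z" unfolding Z_def by (rule negligible_slice_image) fact
  obtain O' where O': "openin (group_topology G) O'" "id \<in> O'"
    "\<And>g. g \<in> O' \<Longrightarrow> \<exists>y\<in>m. e + y \<in> Vorb \<kappa>0 \<and> g x0 = gr (e + y) x0"
    by (rule slice_neighbourhood) blast
  have O'Z: "k x0 \<in> fst \<kappa>0" "snd \<kappa>0 (k x0) \<in> Z" if "k \<in> O'" for k
  proof -
    obtain y where y: "y \<in> m" "e + y \<in> Vorb \<kappa>0" "k x0 = gr (e + y) x0" using O'(3)[OF \<open>k \<in> O'\<close>] by blast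
    have "snd \<kappa>0 (k x0) = orb \<kappa>0 (e + y)" by (simp add: orb_def y(3))
    thus "k x0 \<in> fst \<kappa>0" "snd \<kappa>0 (k x0) \<in> Z" using y by (auto simp only: Z_def Vorb_def)
  qed
  have translate: "openin (group_topology G) {h \<in> G. inv g \<circ> h \<in> O'}" if "g \<in> G" for g
  proof -
    have "continuous_map (group_topology G) (group_topology G) (\<lambda>h. inv g \<circ> h)"
      using smooth_left[OF G_inv[OF that]] by (simp add: smooth_map_def)
    from openin_continuous_map_preimage[OF this O'(1)] show ?thesis unfolding topspace_G .
  qed
  obtain \<B> where \<B>: "countable \<B>" "openin (group_topology G) = arbitrary union_of (\<lambda>U. U \<in> \<B>)"
    using manG unfolding smooth_manifold_def by blast
  \<comment> \<open>second countability: basic open sets that fit into a translate of \<open>O'\<close> already cover \<open>G\<close>\<close>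
  define \<C> where "\<C> = {U \<in> \<B>. \<exists>g\<in>G. U \<subseteq> {h \<in> G. inv g \<circ> h \<in> O'}}"
  have "\<forall>U\<in>\<C>. \<exists>g. g \<in> G \<and> U \<subseteq> {h \<in> G. inv g \<circ> h \<in> O'}" unfolding \<C>_def by blast
  from bchoice[OF this] obtain s where "\<forall>U\<in>\<C>. s U \<in> G \<and> U \<subseteq> {h \<in> G. inv (s U) \<circ> h \<in> O'}" ..
  hence s: "\<And>U. U \<in> \<C> \<Longrightarrow> s U \<in> G" "\<And>U. U \<in> \<C> \<Longrightarrow> U \<subseteq> {h \<in> G. inv (s U) \<circ> h \<in> O'}"
    by simp_all
  have cover: "\<exists>U\<in>\<C>. g \<in> U" if "g \<in> G" for g
  proof -
    have "(arbitrary union_of (\<lambda>U. U \<in> \<B>)) {h \<in> G. inv g \<circ> h \<in> O'}"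
      using translate[OF that] unfolding \<B>(2) .
    then obtain \<U> where \<U>: "\<U> \<subseteq> \<B>" "\<Union>\<U> = {h \<in> G. inv g \<circ> h \<in> O'}" by (auto simp: union_of_def)
    have "g \<in> \<Union>\<U>" unfolding \<U>(2) using that O'(2) by simp
    thus ?thesis using \<U> that unfolding \<C>_def by blast
  qed
  define T where "T U = (snd \<kappa>0 \<circ> s U \<circ> chart_inv \<kappa>0) ` (Z \<inter> snd \<kappa>0 ` (fst \<kappa>0 \<inter> s U -` fst \<kappa>0))" for U
  have "negligible (T U)" if U: "U \<in> \<C>" for U
  proof -
    have sm: "smooth_on (snd \<kappa>0 \<circ> s U \<circ> chart_inv \<kappa>0) (snd \<kappa>0 ` (fst \<kappa>0 \<inter> s U -` fst \<kappa>0))"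
      using G_isometry(1)[OF s(1)[OF U]] \<kappa>0(1) by (simp add: smooth_map_def)
    have "(snd \<kappa>0 \<circ> s U \<circ> chart_inv \<kappa>0) differentiable_on (Z \<inter> snd \<kappa>0 ` (fst \<kappa>0 \<inter> s U -` fst \<kappa>0))"
      unfolding differentiable_on_def
      using smooth_on_differentiable[OF sm] differentiable_at_withinI by blast
    moreover have "negligible (Z \<inter> snd \<kappa>0 ` (fst \<kappa>0 \<inter> s U -` fst \<kappa>0))"
      by (rule negligible_subset[OF negZ]) simp
    ultimately show ?thesis unfolding T_def
      by (intro negligible_differentiable_image_negligible) simp_all
  qed
  moreover have "countable (T ` \<C>)" using \<B>(1) by (intro countable_image) (simp add: \<C>_def)
  ultimately have "negligible (\<Union>(T ` \<C>))" by (intro negligible_countable_Union) auto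
  moreover have "snd \<kappa>0 ` fst \<kappa>0 \<subseteq> \<Union>(T ` \<C>)"
  proof
    fix z assume "z \<in> snd \<kappa>0 ` fst \<kappa>0"
    then obtain p where p: "p \<in> fst \<kappa>0" "z = snd \<kappa>0 p" by blast
    obtain g where g: "g \<in> G" "g x0 = p" using transitive by blast
    obtain U where U: "U \<in> \<C>" "g \<in> U" using cover[OF g(1)] by blast
    define k where "k = inv (s U) \<circ> g"
    have k: "k \<in> O'" using s(2)[OF U(1)] U(2) by (auto simp: k_def)
    have "s U \<circ> k = g" unfolding k_def comp_assoc[symmetric] inv_comp(2)[OF s(1)[OF U(1)]] by simp
    hence sk: "s U (k x0) = p" using g(2) by (metis comp_apply)
    have "chart_inv \<kappa>0 (snd \<kappa>0 (k x0)) = k x0"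
      by (rule chart_inv_snd[OF manifold_chart[OF manM \<kappa>0(1)] O'Z(1)[OF k]])
    hence "z = (snd \<kappa>0 \<circ> s U \<circ> chart_inv \<kappa>0) (snd \<kappa>0 (k x0))" using sk p(2) by simp
    moreover have "snd \<kappa>0 (k x0) \<in> Z \<inter> snd \<kappa>0 ` (fst \<kappa>0 \<inter> s U -` fst \<kappa>0)"
      using O'Z[OF k] sk p(1) by auto
    ultimately have "z \<in> T U" unfolding T_def by blast
    thus "z \<in> \<Union>(T ` \<C>)" using U(1) by blast
  qed
  ultimately have "negligible (snd \<kappa>0 ` fst \<kappa>0)" by (rule negligible_subset)
  thus False using open_not_negligible[OF chart_open[OF manifold_chart[OF manM \<kappa>0(1)]]] \<kappa>0(2) by blast
qed

end

section \<open>The Euler--Lagrange equation and the existence of geodesics\<close>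

lemma deriv_line:
  fixes f :: "'a::real_normed_vector \<Rightarrow> real"
  assumes "f differentiable (at z)"
  shows "deriv (\<lambda>t. f (z + t *\<^sub>R v)) 0 = D f z v"
proof -
  have "((\<lambda>t. z + t *\<^sub>R v) has_derivative (\<lambda>h. h *\<^sub>R v)) (at 0)" by (auto intro!: derivative_eq_intros)
  moreover have "(f has_derivative D f z) (at (z + 0 *\<^sub>R v))" using has_D[OF assms] by simp
  ultimately have "((\<lambda>t. f (z + t *\<^sub>R v)) has_derivative (\<lambda>h. D f z (h *\<^sub>R v))) (at 0)"
    by (rule has_derivative_compose)
  hence "((\<lambda>t. f (z + t *\<^sub>R v)) has_real_derivative D f z v) (at 0)"
    using linear_cmul[OF has_derivative_linear[OF has_D[OF assms]]]
    by (simp add: has_field_derivative_def mult.commute[of _ "D f z v"])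
  thus ?thesis by (rule DERIV_imp_deriv)
qed

lemma deriv_line_cong:
  fixes f g :: "'a::real_normed_vector \<Rightarrow> real"
  assumes "open S" "z \<in> S" "\<And>y. y \<in> S \<Longrightarrow> f y = g y" "g differentiable (at z)"
  shows "deriv (\<lambda>t. f (z + t *\<^sub>R v)) 0 = D g z v"
proof -
  have "f differentiable (at z)"
    using assms unfolding differentiable_def by (metis has_derivative_transform_within_open)
  from deriv_line[OF this, of v] show ?thesis by (simp only: D_cong_open[OF assms(1-3)])
qed

lemma linear_axis_expansion:
  fixes L :: "real^'n \<Rightarrow> real"
  assumes "linear L"
  shows "L v = (\<Sum>j\<in>UNIV. v $ j * L (axis j 1))"
proof -
  have "L v = L (\<Sum>j\<in>UNIV. v $ j *\<^sub>R axis j 1)"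
    using basis_expansion[of v] by (simp add: scalar_mult_eq_scaleR)
  thus ?thesis by (simp add: linear_sum[OF assms] linear_cmul[OF assms])
qed

lemma fundamental_tensor_eq:
  fixes q :: "'a::real_normed_vector \<Rightarrow> real"
  assumes "open S" "smooth_on q S" "y \<in> S" "\<And>z. z \<in> S \<Longrightarrow> (f z)\<^sup>2 = q z"
  shows "fundamental_tensor f y u v = 1/2 * D (\<lambda>z. D q z v) y u"
proof -
  have "deriv (\<lambda>t. (f (z + t *\<^sub>R v))\<^sup>2) 0 = D q z v" if "z \<in> S" for z
    by (rule deriv_line_cong[where f="\<lambda>z. (f z)\<^sup>2", OF assms(1) that assms(4) smooth_on_differentiable[OF assms(2) that]])
  from deriv_line_cong[where f="\<lambda>z. deriv (\<lambda>t. (f (z + t *\<^sub>R v))\<^sup>2) 0",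
      OF assms(1,3) this smooth_on_differentiable[OF smooth_on_D[OF assms(2)] assms(3)]]
  show ?thesis by (simp add: fundamental_tensor_def)
qed

lemma cartan_tensor_eq:
  fixes q :: "'a::real_normed_vector \<Rightarrow> real"
  assumes "open S" "smooth_on q S" "y \<in> S" "\<And>z. z \<in> S \<Longrightarrow> (f z)\<^sup>2 = q z"
  shows "cartan_tensor f y u v w = 1/4 * D (\<lambda>z. D (\<lambda>z. D q z w) z v) y u"
proof -
  have 1: "deriv (\<lambda>t. (f (z + t *\<^sub>R w))\<^sup>2) 0 = D q z w" if "z \<in> S" for z
    by (rule deriv_line_cong[where f="\<lambda>z. (f z)\<^sup>2", OF assms(1) that assms(4) smooth_on_differentiable[OF assms(2) that]])
  have "deriv (\<lambda>s. deriv (\<lambda>t. (f (z + s *\<^sub>R v + t *\<^sub>R w))\<^sup>2) 0) 0 = D (\<lambda>z. D q z w) z v" if "z \<in> S" for z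
    by (rule deriv_line_cong[where f="\<lambda>z. deriv (\<lambda>t. (f (z + t *\<^sub>R w))\<^sup>2) 0",
        OF assms(1) that 1 smooth_on_differentiable[OF smooth_on_D[OF assms(2)] that]])
  from deriv_line_cong[where f="\<lambda>z. deriv (\<lambda>s. deriv (\<lambda>t. (f (z + s *\<^sub>R v + t *\<^sub>R w))\<^sup>2) 0) 0",
      OF assms(1,3) this smooth_on_differentiable[OF smooth_on_D[OF smooth_on_D[OF assms(2)]] assms(3)]]
  show ?thesis by (simp add: cartan_tensor_def)
qed

context homogeneous_finsler
begin

text \<open>Twice the kinetic energy in the coordinates of the tangent bundle induced by a chart.\<close>

definition "E \<kappa> z = (local_F A F \<kappa> z)\<^sup>2"
definition "slit \<kappa> = snd \<kappa> ` fst \<kappa> \<times> (UNIV - {0 :: real^'n})"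

lemma open_slit: "\<kappa> \<in> A \<Longrightarrow> open (slit \<kappa>)"
  unfolding slit_def by (intro open_Times chart_open[OF manifold_chart[OF manM]]) (auto simp: open_delete)

lemma smooth_E: "\<kappa> \<in> A \<Longrightarrow> smooth_on (E \<kappa>) (slit \<kappa>)"
proof -
  assume "\<kappa> \<in> A"
  hence "smooth_on (local_F A F \<kappa>) (slit \<kappa>)" using finsler by (simp add: finsler_metric_def slit_def)
  from smooth_on_mult[OF open_slit[OF \<open>\<kappa> \<in> A\<close>] this this]
  show ?thesis by (simp add: E_def[abs_def] power2_eq_square)
qed

lemma E_eq:
  assumes "\<kappa> \<in> A" "p \<in> fst \<kappa>"
  shows "E \<kappa> (snd \<kappa> p, y) = (F p (coord_change \<kappa> (chart_at A p) p y))\<^sup>2"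
  using chart_inv_snd[OF manifold_chart[OF manM assms(1)] assms(2)]
  by (simp add: E_def local_F_def)

lemma smooth_F: "smooth_on (\<lambda>v. (F p v)\<^sup>2) (UNIV - {0})"
proof -
  define \<kappa> where "\<kappa> = chart_at A p"
  have \<kappa>: "\<kappa> \<in> A" "p \<in> fst \<kappa>"
    using chart_at_M[of p] by (auto simp: \<kappa>_def)
  have o: "open (UNIV - {0 :: real^'n})" by (auto simp: open_delete)
  have "smooth_on (\<lambda>v. E \<kappa> (snd \<kappa> p, v)) (UNIV - {0})"
    by (rule smooth_on_compose[OF smooth_E[OF \<kappa>(1)] smooth_on_Pair[OF o smooth_on_const[OF o] smooth_on_id[OF o]] o])
      (use \<kappa>(2) in \<open>auto simp: slit_def\<close>)
  moreover have "E \<kappa> (snd \<kappa> p, v) = (F p v)\<^sup>2" for v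
    using E_eq[OF \<kappa>] coord_change_same[OF manifold_chart[OF manM \<kappa>(1)] \<kappa>(2)] by (simp add: \<kappa>_def)
  ultimately show ?thesis by simp
qed

lemma F_positive: "y \<noteq> 0 \<Longrightarrow> v \<noteq> 0 \<Longrightarrow> 0 < D (\<lambda>z. D (\<lambda>v. (F p v)\<^sup>2) z v) y v"
proof -
  assume yv: "y \<noteq> 0" "v \<noteq> 0"
  have o: "open (UNIV - {0 :: real^'n})" by (auto simp: open_delete)
  have "0 < fundamental_tensor (F p) y v v" using finsler yv by (simp add: finsler_metric_def)
  thus ?thesis using fundamental_tensor_eq[OF o smooth_F, of y "F p" p v v] yv by simp
qed

lemma F_homogeneous: "0 \<le> l \<Longrightarrow> F p (l *\<^sub>R v) = l * F p v"
  using finsler by (simp add: finsler_metric_def)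

text \<open>On a fibre the energy in a chart and the squared norm differ by the linear change of
  coordinates only. This transfers positive definiteness of the fundamental tensor to the chart.\<close>

lemma D_E_fibre:
  assumes "\<kappa> \<in> A" "p \<in> fst \<kappa>" "y \<noteq> 0"
  defines "C \<equiv> coord_change \<kappa> (chart_at A p) p"
  shows "D (E \<kappa>) (snd \<kappa> p, y) (0, w) = D (\<lambda>v. (F p v)\<^sup>2) (C y) (C w)"
    and "C y \<noteq> 0"
proof -
  note c = chart_at_M[of p]
  have linC: "linear C" unfolding C_def by (rule linear_coord_change[OF manM assms(1) c(1) assms(2) c(2)])
  show Cy: "C y \<noteq> 0" using coord_change_eq_0_iff[OF manM assms(1) c(1) assms(2) c(2)] assms(3) by (simp add: C_def)
  have s: "(snd \<kappa> p, y) \<in> slit \<kappa>" using assms by (auto simp: slit_def)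
  have 1: "((\<lambda>y. E \<kappa> (snd \<kappa> p, y)) has_derivative (\<lambda>w. D (E \<kappa>) (snd \<kappa> p, y) (0, w))) (at y)"
    by (rule has_partial_snd[OF smooth_on_differentiable[OF smooth_E[OF assms(1)] s]])
  have "(C has_derivative C) (at y)"
    by (rule linear_has_derivative[OF linC])
  moreover have "((\<lambda>v. (F p v)\<^sup>2) has_derivative D (\<lambda>v. (F p v)\<^sup>2) (C y)) (at (C y))"
    using Cy by (intro smooth_on_has_D[OF smooth_F]) simp
  ultimately have "((\<lambda>y. (F p (C y))\<^sup>2) has_derivative (\<lambda>w. D (\<lambda>v. (F p v)\<^sup>2) (C y) (C w))) (at y)"
    by (rule has_derivative_compose)
  hence "((\<lambda>y. E \<kappa> (snd \<kappa> p, y)) has_derivative (\<lambda>w. D (\<lambda>v. (F p v)\<^sup>2) (C y) (C w))) (at y)"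
    using E_eq[OF assms(1,2)] by (simp add: C_def)
  from has_derivative_unique[OF 1 this] show "D (E \<kappa>) (snd \<kappa> p, y) (0, w) = D (\<lambda>v. (F p v)\<^sup>2) (C y) (C w)"
    by metis
qed

lemma E_positive:
  assumes "\<kappa> \<in> A" "z \<in> slit \<kappa>" "v \<noteq> 0"
  shows "0 < D (\<lambda>z. D (E \<kappa>) z (0, v)) z (0, v)"
proof -
  obtain p y where z: "z = (snd \<kappa> p, y)" "p \<in> fst \<kappa>" "y \<noteq> 0" using assms(2) by (auto simp: slit_def)
  define C where "C = coord_change \<kappa> (chart_at A p) p"
  let ?q = "\<lambda>v. (F p v)\<^sup>2"
  note c = chart_at_M[of p]
  have linC: "linear C" unfolding C_def by (rule linear_coord_change[OF manM assms(1) c(1) z(2) c(2)])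
  have C0: "C y \<noteq> 0" "C v \<noteq> 0"
    using coord_change_eq_0_iff[OF manM assms(1) c(1) z(2) c(2)] z(3) assms(3) by (auto simp: C_def)
  have o: "open (UNIV - {0 :: real^'n})" by (auto simp: open_delete)
  have "((\<lambda>y. D (E \<kappa>) (snd \<kappa> p, y) (0, v)) has_derivative
      (\<lambda>w. D (\<lambda>z. D (E \<kappa>) z (0, v)) (snd \<kappa> p, y) (0, w))) (at y)"
    using assms(2) unfolding z(1)
    by (rule has_partial_snd[OF smooth_on_differentiable[OF smooth_on_D[OF smooth_E[OF assms(1)]]]])
  moreover have "((\<lambda>y. D (E \<kappa>) (snd \<kappa> p, y) (0, v)) has_derivative
      (\<lambda>w. D (\<lambda>y. D ?q y (C v)) (C y) (C w))) (at y)"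
  proof -
    have "(C has_derivative C) (at y)"
      by (rule linear_has_derivative[OF linC])
    moreover have "((\<lambda>y. D ?q y (C v)) has_derivative D (\<lambda>y. D ?q y (C v)) (C y)) (at (C y))"
      using C0 by (intro smooth_on_has_D[OF smooth_on_D[OF smooth_F]]) simp
    ultimately have d: "((\<lambda>y. D ?q (C y) (C v)) has_derivative (\<lambda>w. D (\<lambda>y. D ?q y (C v)) (C y) (C w))) (at y)"
      by (rule has_derivative_compose)
    have "D ?q (C y') (C v) = D (E \<kappa>) (snd \<kappa> p, y') (0, v)" if "y' \<in> UNIV - {0}" for y'
      using D_E_fibre(1)[OF assms(1) z(2), of y' v] that by (simp add: C_def)
    from has_derivative_transform_within_open[OF d o _ this] z(3) show ?thesis by simp
  qed
  ultimately have "D (\<lambda>z. D (E \<kappa>) z (0, v)) (snd \<kappa> p, y) (0, v) = D (\<lambda>y. D ?q y (C v)) (C y) (C v)"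
    using has_derivative_unique by metis
  thus ?thesis using F_positive[OF C0] by (simp add: z(1))
qed

text \<open>The spray coefficients solve a linear system: its matrix is the fundamental tensor in the chart, and its
  right-hand side a quarter of \<open>rhs\<close>.\<close>

definition "hess \<kappa> z = (\<chi> i j. 1/2 * D (\<lambda>z. D (E \<kappa>) z (0, axis i 1)) z (0, axis j 1))"
definition "rhs \<kappa> z = (\<chi> l. D (\<lambda>z. D (E \<kappa>) z (0, axis l 1)) z (snd z, 0) - D (E \<kappa>) z (axis l 1, 0))"

lemma
  assumes \<kappa>: "\<kappa> \<in> A" and z: "z \<in> slit \<kappa>"
  shows hess_mult: "(hess \<kappa> z *v v) $ i = 1/2 * D (\<lambda>z. D (E \<kappa>) z (0, axis i 1)) z (0, v)"
    and hess_inner: "v \<bullet> (hess \<kappa> z *v v) = 1/2 * D (\<lambda>z. D (E \<kappa>) z (0, v)) z (0, v)"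
proof -
  have lin: "linear (\<lambda>v. D (\<lambda>z. D (E \<kappa>) z w) z (0, v))" for w
    by (rule linear_D_snd[OF smooth_on_D[OF smooth_E[OF \<kappa>]] z])
  show h: "(hess \<kappa> z *v v) $ i = 1/2 * D (\<lambda>z. D (E \<kappa>) z (0, axis i 1)) z (0, v)" for i
    using linear_axis_expansion[OF lin, of "(0, axis i 1)" v]
    by (simp add: hess_def matrix_vector_mult_def sum_distrib_left mult_ac)
  have sym: "D (\<lambda>z. D (E \<kappa>) z w) z w' = D (\<lambda>z. D (E \<kappa>) z w') z w" for w w'
    by (rule second_derivative_symmetric[OF smooth_E[OF \<kappa>] open_slit[OF \<kappa>] z])
  have "v \<bullet> (hess \<kappa> z *v v) = (\<Sum>i\<in>UNIV. v $ i * (1/2 * D (\<lambda>z. D (E \<kappa>) z (0, v)) z (0, axis i 1)))"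
    by (simp only: inner_vec_def inner_real_def h sym[of "(0, v)"])
  also have "\<dots> = 1/2 * D (\<lambda>z. D (E \<kappa>) z (0, v)) z (0, v)"
    unfolding linear_axis_expansion[OF lin, of "(0, v)" v] by (simp add: sum_distrib_left mult_ac)
  finally show "v \<bullet> (hess \<kappa> z *v v) = 1/2 * D (\<lambda>z. D (E \<kappa>) z (0, v)) z (0, v)" .
qed

lemma hess_regular:
  assumes "\<kappa> \<in> A" "z \<in> slit \<kappa>"
  shows "invertible (hess \<kappa> z)" "det (hess \<kappa> z) \<noteq> 0"
proof -
  have "v = 0" if "hess \<kappa> z *v v = 0" for v
    using hess_inner[OF assms, of v] E_positive[OF assms, of v] that by force
  hence "\<exists>B. B ** hess \<kappa> z = mat 1" using matrix_left_invertible_ker by blast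
  thus "invertible (hess \<kappa> z)" using invertible_left_inverse by blast
  thus "det (hess \<kappa> z) \<noteq> 0" by (simp add: invertible_det_nz)
qed

lemma partial_x_eq:
  assumes "open S" "z \<in> S" "\<And>y. y \<in> S \<Longrightarrow> f y = h y" "h differentiable (at z)"
  shows "partial_x i f z = D h z (axis i 1, 0)"
  using deriv_line_cong[OF assms, of "(axis i 1, 0)"] by (cases z) (simp add: partial_x_def)

lemma partial_y_eq:
  assumes "open S" "z \<in> S" "\<And>y. y \<in> S \<Longrightarrow> f y = h y" "h differentiable (at z)"
  shows "partial_y i f z = D h z (0, axis i 1)"
  using deriv_line_cong[OF assms, of "(0, axis i 1)"] by (cases z) (simp add: partial_y_def)

lemma spray_coeff_eq:
  assumes \<kappa>: "\<kappa> \<in> A" and z: "z \<in> slit \<kappa>"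
  shows "spray_coeff A F \<kappa> z = matrix_inv (hess \<kappa> z) *v ((1/4) *\<^sub>R rhs \<kappa> z)"
proof -
  note o = open_slit[OF \<kappa>] and s = smooth_E[OF \<kappa>]
  have ds: "(\<lambda>z. 1/2 * E \<kappa> z) differentiable (at z)" "D (\<lambda>z. 1/2 * E \<kappa> z) z w = 1/2 * D (E \<kappa>) z w"
    if "z \<in> slit \<kappa>" for z w
  proof -
    have "((\<lambda>z. 1/2 * E \<kappa> z) has_derivative (\<lambda>w. 1/2 * D (E \<kappa>) z w)) (at z)"
      using smooth_on_has_D[OF s that] by (rule has_derivative_mult_right)
    thus "(\<lambda>z. 1/2 * E \<kappa> z) differentiable (at z)" "D (\<lambda>z. 1/2 * E \<kappa> z) z w = 1/2 * D (E \<kappa>) z w"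
      by (auto simp: differentiable_def D_eq)
  qed
  have y1: "partial_y i (\<lambda>z. 1/2 * E \<kappa> z) z = 1/2 * D (E \<kappa>) z (0, axis i 1)" if "z \<in> slit \<kappa>" for z i
    using partial_y_eq[OF o that _ ds(1)[OF that]] ds(2)[OF that] by simp
  have g: "partial_y j (partial_y i (\<lambda>z. 1/2 * E \<kappa> z)) z = hess \<kappa> z $ i $ j" for i j
  proof -
    have d: "((\<lambda>z. 1/2 * D (E \<kappa>) z (0, axis i 1)) has_derivative
        (\<lambda>w. 1/2 * D (\<lambda>z. D (E \<kappa>) z (0, axis i 1)) z w)) (at z)"
      using smooth_on_has_D[OF smooth_on_D[OF s] z] by (rule has_derivative_mult_right)
    hence "(\<lambda>z. 1/2 * D (E \<kappa>) z (0, axis i 1)) differentiable (at z)" by (auto simp: differentiable_def)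
    from partial_y_eq[OF o z y1 this] show ?thesis by (simp only: hess_def D_eq[OF d] vec_lambda_beta)
  qed
  have x1: "partial_x k (E \<kappa>) z = D (E \<kappa>) z (axis k 1, 0)" if "z \<in> slit \<kappa>" for z k
    using partial_x_eq[OF o that _ smooth_on_differentiable[OF s that]] by simp
  have yx: "partial_y l (partial_x k (E \<kappa>)) z = D (\<lambda>z. D (E \<kappa>) z (0, axis l 1)) z (axis k 1, 0)" for l k
  proof -
    have "partial_y l (partial_x k (E \<kappa>)) z = D (\<lambda>z. D (E \<kappa>) z (axis k 1, 0)) z (0, axis l 1)"
      by (rule partial_y_eq[OF o z x1 smooth_on_differentiable[OF smooth_on_D[OF s] z]])
    thus ?thesis using second_derivative_symmetric[OF s o z] by simp
  qed
  have r: "(\<Sum>k\<in>UNIV. partial_y l (partial_x k (E \<kappa>)) z * snd z $ k) - partial_x l (E \<kappa>) z = rhs \<kappa> z $ l" for l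
  proof -
    have lin: "linear (\<lambda>v. D (\<lambda>z. D (E \<kappa>) z (0, axis l 1)) z (v, 0))"
      by (rule linear_D_fst[OF smooth_on_D[OF s] z])
    have "snd z = (\<Sum>k\<in>UNIV. snd z $ k *\<^sub>R axis k 1)"
      using basis_expansion[of "snd z"] by (simp add: scalar_mult_eq_scaleR)
    hence "D (\<lambda>z. D (E \<kappa>) z (0, axis l 1)) z (snd z, 0) =
        D (\<lambda>z. D (E \<kappa>) z (0, axis l 1)) z ((\<Sum>k\<in>UNIV. snd z $ k *\<^sub>R axis k 1), 0)" by simp
    also have "\<dots> = (\<Sum>k\<in>UNIV. snd z $ k * D (\<lambda>z. D (E \<kappa>) z (0, axis l 1)) z (axis k 1, 0))"
      using linear_sum[OF lin, of "\<lambda>k. snd z $ k *\<^sub>R axis k 1" UNIV] linear_cmul[OF lin] by simp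
    finally show ?thesis by (simp add: rhs_def yx x1[OF z] mult.commute)
  qed
  obtain x y where xy: "z = (x, y)" by (cases z)
  have E: "(\<lambda>z. (local_F A F \<kappa> z)\<^sup>2) = E \<kappa>" by (auto simp: E_def)
  have "spray_coeff A F \<kappa> z = (\<chi> i. 1/4 * (\<Sum>l\<in>UNIV. matrix_inv (\<chi> i j. partial_y j (partial_y i (\<lambda>z. 1/2 * E \<kappa> z)) z) $ i $ l *
      ((\<Sum>k\<in>UNIV. partial_y l (partial_x k (E \<kappa>)) z * snd z $ k) - partial_x l (E \<kappa>) z)))"
    unfolding spray_coeff_def Let_def E[symmetric] by (simp add: xy)
  also have "\<dots> = (\<chi> i. 1/4 * (\<Sum>l\<in>UNIV. matrix_inv (hess \<kappa> z) $ i $ l * rhs \<kappa> z $ l))"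
    unfolding g r by (simp add: vec_nth_inverse)
  also have "\<dots> = matrix_inv (hess \<kappa> z) *v ((1/4) *\<^sub>R rhs \<kappa> z)"
    by (simp add: vec_eq_iff matrix_vector_mult_def sum_distrib_left mult_ac)
  finally show ?thesis .
qed

lemma hess_spray_coeff:
  assumes "\<kappa> \<in> A" "z \<in> slit \<kappa>"
  shows "hess \<kappa> z *v spray_coeff A F \<kappa> z = (1/4) *\<^sub>R rhs \<kappa> z"
proof -
  have "hess \<kappa> z ** matrix_inv (hess \<kappa> z) = mat 1"
    using someI_ex[OF hess_regular(1)[OF assms, unfolded invertible_def]]
    by (simp add: matrix_inv_def)
  thus ?thesis unfolding spray_coeff_eq[OF assms] matrix_vector_mul_assoc by simp
qed

text \<open>Multiplying the spray coefficients by the Hessian removes its inverse. What remains says that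
  along an integral curve the fibre derivative of the energy changes at the rate of its base
  derivative.\<close>

lemma euler_lagrange:
  assumes \<kappa>: "\<kappa> \<in> A" and z: "z \<in> slit \<kappa>"
  shows "D (\<lambda>z. D (E \<kappa>) z (0, w)) z (geodesic_spray A F \<kappa> z) = D (E \<kappa>) z (w, 0)"
proof -
  note o = open_slit[OF \<kappa>] and s = smooth_E[OF \<kappa>]
  let ?\<zeta> = "geodesic_spray A F \<kappa> z"
  have \<zeta>: "?\<zeta> = (snd z, 0) + (-2) *\<^sub>R (0, spray_coeff A F \<kappa> z)"
    by (cases z) (simp add: geodesic_spray_def)
  have lin: "linear (D (\<lambda>z. D (E \<kappa>) z w) z)" for w by (rule linear_D[OF smooth_on_D[OF s] z])
  have ax: "D (\<lambda>z. D (E \<kappa>) z (0, axis l 1)) z ?\<zeta> = D (E \<kappa>) z (axis l 1, 0)" for l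
  proof -
    have "(hess \<kappa> z *v spray_coeff A F \<kappa> z) $ l = 1/4 * rhs \<kappa> z $ l"
      unfolding hess_spray_coeff[OF assms] by simp
    hence "1/2 * D (\<lambda>z. D (E \<kappa>) z (0, axis l 1)) z (0, spray_coeff A F \<kappa> z) = 1/4 * rhs \<kappa> z $ l"
      unfolding hess_mult[OF assms] .
    moreover have "D (\<lambda>z. D (E \<kappa>) z (0, axis l 1)) z ?\<zeta> =
        D (\<lambda>z. D (E \<kappa>) z (0, axis l 1)) z (snd z, 0)
        + (-2) *\<^sub>R D (\<lambda>z. D (E \<kappa>) z (0, axis l 1)) z (0, spray_coeff A F \<kappa> z)"
      unfolding \<zeta> linear_add[OF lin] linear_cmul[OF lin] ..
    ultimately show ?thesis by (simp add: rhs_def)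
  qed
  have sym: "D (\<lambda>z. D (E \<kappa>) z w) z ?\<zeta> = D (\<lambda>z. D (E \<kappa>) z ?\<zeta>) z w" for w
    by (rule second_derivative_symmetric[OF s o z])
  have l1: "linear (\<lambda>w. D (\<lambda>z. D (E \<kappa>) z ?\<zeta>) z (0, w))"
    by (rule linear_D_snd[OF smooth_on_D[OF s] z])
  have l2: "linear (\<lambda>w. D (E \<kappa>) z (w, 0))" by (rule linear_D_fst[OF s z])
  have w: "w = (\<Sum>l\<in>UNIV. w $ l *\<^sub>R axis l 1)"
    using basis_expansion[of w] by (simp add: scalar_mult_eq_scaleR)
  have "D (\<lambda>z. D (E \<kappa>) z ?\<zeta>) z (0, \<Sum>l\<in>UNIV. w $ l *\<^sub>R axis l 1) = D (E \<kappa>) z (\<Sum>l\<in>UNIV. w $ l *\<^sub>R axis l 1, 0)"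
    unfolding linear_sum[OF l1] linear_sum[OF l2] linear_cmul[OF l1] linear_cmul[OF l2]
    using ax unfolding sym by simp
  thus ?thesis unfolding sym w[symmetric] .
qed

lemma smooth_geodesic_spray:
  assumes \<kappa>: "\<kappa> \<in> A"
  shows "smooth_on (geodesic_spray A F \<kappa>) (slit \<kappa>)"
proof -
  note o = open_slit[OF \<kappa>] and s = smooth_E[OF \<kappa>]
  have h: "smooth_on (\<lambda>z. hess \<kappa> z $ i $ j) (slit \<kappa>)" for i j
    using smooth_on_mult[OF o smooth_on_const[OF o, of "1/2"] smooth_on_D[OF smooth_on_D[OF s]]]
    by (simp add: hess_def)
  have "smooth_on (\<lambda>z. rhs \<kappa> z $ l) (slit \<kappa>)" for l
  proof -
    have "smooth_on (\<lambda>z :: (real^'n) \<times> (real^'n). (snd z, 0 :: real^'n)) (slit \<kappa>)"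
      by (rule smooth_on_Pair[OF o smooth_on_snd[OF o smooth_on_id[OF o]] smooth_on_const[OF o]])
    from smooth_on_D_apply[OF smooth_on_D[OF s] o smooth_on_id[OF o] this]
    show ?thesis unfolding rhs_def vec_lambda_beta by (rule smooth_on_diff[OF o _ smooth_on_D[OF s]])
  qed
  hence "smooth_on (\<lambda>z. (1/4) *\<^sub>R rhs \<kappa> z) (slit \<kappa>)"
    by (intro smooth_on_linear_compose[OF bounded_linear_scaleR_right o] smooth_on_vec[OF o])
  from smooth_on_linear_system[OF o h this hess_regular(2)[OF \<kappa>] hess_spray_coeff[OF \<kappa>]]
  have "smooth_on (spray_coeff A F \<kappa>) (slit \<kappa>)" .
  from smooth_on_Pair[OF o smooth_on_snd[OF o smooth_on_id[OF o]]
      smooth_on_linear_compose[OF bounded_linear_scaleR_right[of "-2"] o this]]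
  show ?thesis by (simp add: geodesic_spray_def[abs_def] split_beta')
qed

lemma geodesic_exists:
  assumes "v \<noteq> 0"
  shows "\<exists>c. \<exists>\<epsilon>>0. geodesic_on A F {-\<epsilon><..<\<epsilon>} c \<and> c 0 = x0 \<and> velocity A c 0 = v"
proof -
  have z0: "(snd \<kappa>0 x0, v) \<in> slit \<kappa>0" using \<kappa>0(2) assms by (auto simp: slit_def)
  obtain \<epsilon> z where z: "0 < \<epsilon>" "z 0 = (snd \<kappa>0 x0, v)" "smooth_on z {-\<epsilon><..<\<epsilon>}"
    "\<And>t. t \<in> {-\<epsilon><..<\<epsilon>} \<Longrightarrow> z t \<in> slit \<kappa>0"
    "\<And>t. t \<in> {-\<epsilon><..<\<epsilon>} \<Longrightarrow> (z has_vector_derivative geodesic_spray A F \<kappa>0 (z t)) (at t)"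
    using ode_solution[OF smooth_geodesic_spray[OF \<kappa>0(1)] open_slit[OF \<kappa>0(1)] z0] by metis
  let ?I = "{-\<epsilon><..<\<epsilon>}"
  define x where "x t = fst (z t)" for t
  define c where "c t = chart_inv \<kappa>0 (x t)" for t
  have x: "x t \<in> snd \<kappa>0 ` fst \<kappa>0" "snd (z t) \<noteq> 0" if "t \<in> ?I" for t
    using z(4)[OF that] by (auto simp: slit_def x_def)
  have k0: "is_chart euclidean \<kappa>0" by (rule manifold_chart[OF manM \<kappa>0(1)])
  have \<kappa>c: "snd \<kappa>0 (c t) = x t" "c t \<in> fst \<kappa>0" if "t \<in> ?I" for t
    using snd_chart_inv[OF x(1)[OF that]] chart_inv_in[OF x(1)[OF that]] by (auto simp: c_def)
  have x': "(x has_vector_derivative snd (z t)) (at t)" if "t \<in> ?I" for t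
  proof -
    have "(x has_vector_derivative fst (geodesic_spray A F \<kappa>0 (z t))) (at t)"
      unfolding x_def
      using bounded_linear.has_vector_derivative[OF bounded_linear_fst z(5)[OF that]] .
    thus ?thesis by (simp add: geodesic_spray_def split_beta')
  qed
  have xc': "((snd \<kappa>0 \<circ> c) has_vector_derivative snd (z t)) (at t)" if "t \<in> ?I" for t
    by (rule has_vector_derivative_transform_within_open[OF x'[OF that] open_greaterThanLessThan that])
      (simp add: \<kappa>c)
  hence vd: "vector_derivative (snd \<kappa>0 \<circ> c) (at t) = snd (z t)" if "t \<in> ?I" for t
    using that vector_derivative_at by blast
  have sx: "smooth_on x ?I" unfolding x_def by (rule smooth_on_fst[OF _ z(3)]) simp
  have sc: "smooth_curve euclidean A ?I c"
    unfolding c_def by (rule smooth_curveI[OF manM \<kappa>0(1) _ sx x(1)]) simp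
  have "geodesic_on A F ?I c" unfolding geodesic_on_def
  proof (intro conjI ballI)
    show "smooth_curve euclidean A ?I c" by (rule sc)
  next
    fix t assume t: "t \<in> ?I"
    note ct = chart_at_M[of "c t"]
    have "coord_change (chart_at A (c t)) \<kappa>0 (c t) (velocity A c t) = snd (z t)"
      using coord_change_velocity[OF manM sc open_greaterThanLessThan t \<kappa>0(1) \<kappa>c(2)[OF t]]
      unfolding vd[OF t] .
    thus "velocity A c t \<noteq> 0"
      using x(2)[OF t] coord_change_eq_0_iff[OF manM ct(1) \<kappa>0(1) ct(2) \<kappa>c(2)[OF t]] by metis
  next
    fix t assume t: "t \<in> ?I"
    have eq: "z s = (snd \<kappa>0 (c s), vector_derivative (snd \<kappa>0 \<circ> c) (at s))" if "s \<in> ?I" for s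
      using \<kappa>c[OF that] vd[OF that] by (simp add: x_def)
    have "((\<lambda>s. (snd \<kappa>0 (c s), vector_derivative (snd \<kappa>0 \<circ> c) (at s))) has_vector_derivative
        geodesic_spray A F \<kappa>0 (z t)) (at t)"
      by (rule has_vector_derivative_transform_within_open[OF z(5)[OF t] open_greaterThanLessThan t eq])
    hence "((\<lambda>s. (snd \<kappa>0 (c s), vector_derivative (snd \<kappa>0 \<circ> c) (at s))) has_vector_derivative
        geodesic_spray A F \<kappa>0 (snd \<kappa>0 (c t), vector_derivative (snd \<kappa>0 \<circ> c) (at t))) (at t)"
      unfolding eq[OF t] .
    thus "\<exists>\<kappa>\<in>A. c t \<in> fst \<kappa> \<and> (let z = \<lambda>s. (snd \<kappa> (c s), vector_derivative (snd \<kappa> \<circ> c) (at s))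
        in (z has_vector_derivative geodesic_spray A F \<kappa> (z t)) (at t))"
      unfolding Let_def using \<kappa>0(1) \<kappa>c(2)[OF t] by blast
  qed
  moreover have I0: "0 \<in> ?I" using z(1) by simp
  have c0: "c 0 = x0"
    using chart_inv_snd[OF k0 \<kappa>0(2)] z(2) by (simp add: c_def x_def)
  moreover have "velocity A c 0 = v"
    using vd[OF I0] z(2) by (simp add: velocity_def c0 \<kappa>0_def)
  ultimately show ?thesis using z(1) by blast
qed

lemma geodesic:
  assumes "v \<noteq> 0"
  obtains \<epsilon> where "0 < \<epsilon>" "geodesic_on A F {-\<epsilon><..<\<epsilon>} (geodesic A F x0 v)"
    "geodesic A F x0 v 0 = x0" "velocity A (geodesic A F x0 v) 0 = v"
  using someI_ex[OF geodesic_exists[OF assms]] unfolding geodesic_def by blast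

end

section \<open>Invariance of the metric\<close>

lemma has_vector_derivative_D_apply:
  fixes f :: "'a::euclidean_space \<Rightarrow> 'b::euclidean_space"
  assumes "smooth_on f S" "open S" "z t \<in> S"
    and z: "(z has_vector_derivative z') (at t)" and w: "(w has_vector_derivative w') (at t)"
  shows "((\<lambda>t. D f (z t) (w t)) has_vector_derivative
    D (\<lambda>y. D f y (w t)) (z t) z' + D f (z t) w') (at t)"
proof -
  define \<Phi> where "\<Phi> = (\<lambda>p. D f (fst p) (snd p))"
  have o: "open (S \<times> (UNIV :: 'a set))" by (intro open_Times assms(2) open_UNIV)
  have s: "smooth_on \<Phi> (S \<times> UNIV)" unfolding \<Phi>_def
  proof (rule smooth_on_D_apply[OF assms(1) o smooth_on_fst[OF o smooth_on_id[OF o]] smooth_on_snd[OF o smooth_on_id[OF o]]])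
    show "fst p \<in> S" if "p \<in> S \<times> UNIV" for p :: "'a \<times> 'a" using that by auto
  qed
  have m: "(z t, w t) \<in> S \<times> UNIV" using assms(3) by simp
  have d: "\<Phi> differentiable (at (z t, w t))" by (rule smooth_on_differentiable[OF s m])
  have lin: "linear (D \<Phi> (z t, w t))" by (rule linear_D[OF s m])
  have 1: "D \<Phi> (z t, w t) (z', 0) = D (\<lambda>y. D f y (w t)) (z t) z'"
    using D_eq[OF has_partial_fst[OF d]] by (simp add: \<Phi>_def)
  have "(D f (z t) has_derivative D f (z t)) (at (w t))"
    by (rule linear_has_derivative[OF linear_D[OF assms(1,3)]])
  hence "((\<lambda>w. \<Phi> (z t, w)) has_derivative D f (z t)) (at (w t))" by (simp add: \<Phi>_def)
  from fun_cong[OF has_derivative_unique[OF has_partial_snd[OF d] this], of w']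
  have 2: "D \<Phi> (z t, w t) (0, w') = D f (z t) w'" .
  have "((\<lambda>t. (z t, w t)) has_vector_derivative (z', w')) (at t)"
    by (rule has_vector_derivative_Pair[OF z w])
  from has_vector_derivative_compose[OF this has_D[OF d]]
  have "((\<lambda>t. D f (z t) (w t)) has_vector_derivative D \<Phi> (z t, w t) (z', w')) (at t)"
    by (simp add: \<Phi>_def)
  moreover have "D \<Phi> (z t, w t) (z', w') = D \<Phi> (z t, w t) (z', 0) + D \<Phi> (z t, w t) (0, w')"
    using linear_add[OF lin, of "(z', 0)" "(0, w')"] by simp
  ultimately show ?thesis by (simp add: 1 2)
qed

context homogeneous_finsler
begin

text \<open>The elements of \<open>G\<close> are isometries; the coordinate changes at both end points cancel.\<close>

lemma E_invariant:
  assumes \<kappa>: "\<kappa> \<in> A" and b: "(b, x) \<in> \<Omega>act \<kappa>"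
  shows "E \<kappa> (act \<kappa> (b, x), D (act \<kappa>) (b, x) (0, v)) = E \<kappa> (x, v)"
proof -
  define p where "p = chart_inv \<kappa> x"
  have x: "x \<in> snd \<kappa> ` fst \<kappa>" "gr b p \<in> fst \<kappa>" "b \<in> V" using b by (auto simp: \<Omega>act_def p_def)
  have p: "p \<in> fst \<kappa>" "snd \<kappa> p = x" using chart_inv_in[OF x(1)] snd_chart_inv[OF x(1)] by (auto simp: p_def)
  have g: "gr b \<in> G" by (rule gr_G[OF x(3)])
  have c: "chart_at A p \<in> A" "p \<in> fst (chart_at A p)"
    "chart_at A (gr b p) \<in> A" "gr b p \<in> fst (chart_at A (gr b p))"
    using chart_at_in[OF manM, of p] chart_at_mem[OF manM, of p]
      chart_at_in[OF manM, of "gr b p"] chart_at_mem[OF manM, of "gr b p"] by auto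
  define w where "w = coord_change \<kappa> (chart_at A p) p v"
  have "D (act \<kappa>) (b, x) (0, v) = D (snd \<kappa> \<circ> gr b \<circ> chart_inv \<kappa>) (snd \<kappa> p) v"
    using D_eq[OF has_partial_snd[OF act_differentiable[OF \<kappa> b]]]
    by (simp add: act_def o_def p(2))
  also have "\<dots> = coord_change (chart_at A (gr b p)) \<kappa> (gr b p) (tangent_map A A (gr b) p w)"
  proof -
    have "coord_change (chart_at A p) \<kappa> p w = v"
      unfolding w_def by (rule coord_change_inverse[OF manM \<kappa> c(1) p(1) c(2)])
    thus ?thesis
      using tangent_map_rep[OF manM manM G_isometry(1)[OF g] \<kappa> \<kappa> p(1) x(2), of w] by simp
  qed
  finally have Dv: "D (act \<kappa>) (b, x) (0, v) =
      coord_change (chart_at A (gr b p)) \<kappa> (gr b p) (tangent_map A A (gr b) p w)" .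
  have "act \<kappa> (b, x) = snd \<kappa> (gr b p)" by (simp add: act_def p_def)
  hence "E \<kappa> (act \<kappa> (b, x), D (act \<kappa>) (b, x) (0, v)) =
      E \<kappa> (snd \<kappa> (gr b p), coord_change (chart_at A (gr b p)) \<kappa> (gr b p) (tangent_map A A (gr b) p w))"
    by (simp only: Dv)
  also have "\<dots> = (F (gr b p) (tangent_map A A (gr b) p w))\<^sup>2"
    unfolding E_eq[OF \<kappa> x(2)] coord_change_inverse[OF manM c(3) \<kappa> c(4) x(2)] ..
  also have "\<dots> = E \<kappa> (x, v)"
    using E_eq[OF \<kappa> p(1), of v] by (simp add: G_isometry(2)[OF g] w_def p(2))
  finally show ?thesis .
qed

text \<open>The fundamental vector field of the action generated by \<open>u\<close>, in a chart.\<close>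

definition "killing \<kappa> u x = D (act \<kappa>) (e, x) (u, 0)"

lemma \<Omega>act_e: "\<kappa> \<in> A \<Longrightarrow> x \<in> snd \<kappa> ` fst \<kappa> \<Longrightarrow> (e, x) \<in> \<Omega>act \<kappa>"
  using e_V chart_inv_in[of x \<kappa>] by (simp add: \<Omega>act_def)

lemma act_e: "\<kappa> \<in> A \<Longrightarrow> x \<in> snd \<kappa> ` fst \<kappa> \<Longrightarrow> act \<kappa> (e, x) = x"
  using snd_chart_inv by (simp add: act_def)

lemma open_\<kappa>: "\<kappa> \<in> A \<Longrightarrow> open (snd \<kappa> ` fst \<kappa>)"
  by (rule chart_open[OF manifold_chart[OF manM]])

lemma D_act_e:
  assumes \<kappa>: "\<kappa> \<in> A" and x: "x \<in> snd \<kappa> ` fst \<kappa>"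
  shows "D (act \<kappa>) (e, x) (0, v) = v"
proof -
  have "((\<lambda>x. x) has_derivative (\<lambda>v. D (act \<kappa>) (e, x) (0, v))) (at x)"
    by (rule has_derivative_transform_within_open[OF has_partial_snd[OF act_differentiable[OF \<kappa> \<Omega>act_e[OF \<kappa> x]]]
          open_\<kappa>[OF \<kappa>] x act_e[OF \<kappa>]])
  from has_derivative_unique[OF this has_derivative_ident] show ?thesis by metis
qed

lemma D_killing:
  assumes \<kappa>: "\<kappa> \<in> A" and x: "x \<in> snd \<kappa> ` fst \<kappa>"
  shows "(killing \<kappa> u has_derivative (\<lambda>v. D (\<lambda>\<zeta>. D (act \<kappa>) \<zeta> (0, v)) (e, x) (u, 0))) (at x)"
proof -
  have "(\<lambda>\<zeta>. D (act \<kappa>) \<zeta> (u, 0)) differentiable (at (e, x))"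
    by (rule smooth_on_differentiable[OF smooth_on_D[OF smooth_act[OF \<kappa>]] \<Omega>act_e[OF \<kappa> x]])
  from has_partial_snd[OF this]
  have "(killing \<kappa> u has_derivative (\<lambda>v. D (\<lambda>\<zeta>. D (act \<kappa>) \<zeta> (u, 0)) (e, x) (0, v))) (at x)"
    unfolding killing_def[abs_def] .
  moreover have "D (\<lambda>\<zeta>. D (act \<kappa>) \<zeta> (u, 0)) (e, x) (0, v) = D (\<lambda>\<zeta>. D (act \<kappa>) \<zeta> (0, v)) (e, x) (u, 0)" for v
    by (rule second_derivative_symmetric[OF smooth_act[OF \<kappa>] open_\<Omega>act[OF \<kappa>] \<Omega>act_e[OF \<kappa> x]])
  ultimately show ?thesis by simp
qed

text \<open>Differentiating the invariance of the energy along a one-parameter family of isometries through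
  the identity gives the Killing equation.\<close>

lemma killing_equation:
  assumes \<kappa>: "\<kappa> \<in> A" and z: "(x, v) \<in> slit \<kappa>"
  shows "D (E \<kappa>) (x, v) (killing \<kappa> u x, 0) + D (E \<kappa>) (x, v) (0, D (killing \<kappa> u) x v) = 0"
proof -
  have x: "x \<in> snd \<kappa> ` fst \<kappa>" using z by (simp add: slit_def)
  note ex = \<Omega>act_e[OF \<kappa> x]
  define f where "f b = (act \<kappa> (b, x), D (act \<kappa>) (b, x) (0, v))" for b
  have fe: "f e = (x, v)" by (simp add: f_def act_e[OF \<kappa> x] D_act_e[OF \<kappa> x])
  have d1: "((\<lambda>b. act \<kappa> (b, x)) has_derivative (\<lambda>u. D (act \<kappa>) (e, x) (u, 0))) (at e)"
    by (rule has_partial_fst[OF act_differentiable[OF \<kappa> ex]])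
  have d2: "((\<lambda>b. D (act \<kappa>) (b, x) (0, v)) has_derivative (\<lambda>u. D (\<lambda>\<zeta>. D (act \<kappa>) \<zeta> (0, v)) (e, x) (u, 0))) (at e)"
    by (rule has_partial_fst[OF smooth_on_differentiable[OF smooth_on_D[OF smooth_act[OF \<kappa>]] ex]])
  have "(E \<kappa> has_derivative D (E \<kappa>) (x, v)) (at (f e))"
    unfolding fe by (rule smooth_on_has_D[OF smooth_E[OF \<kappa>] z])
  from has_derivative_compose[OF has_derivative_Pair[OF d1 d2, folded f_def[abs_def]] this]
  have d: "((\<lambda>b. E \<kappa> (f b)) has_derivative (\<lambda>u. D (E \<kappa>) (x, v)
      (D (act \<kappa>) (e, x) (u, 0), D (\<lambda>\<zeta>. D (act \<kappa>) \<zeta> (0, v)) (e, x) (u, 0)))) (at e)" .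
  have o: "open {b. (b, x) \<in> \<Omega>act \<kappa>}"
    using open_vimage[OF open_\<Omega>act[OF \<kappa>], of "\<lambda>b. (b, x)"] by (simp add: vimage_def continuous_on_Pair)
  have "E \<kappa> (f b) = E \<kappa> (x, v)" if "b \<in> {b. (b, x) \<in> \<Omega>act \<kappa>}" for b
    using E_invariant[OF \<kappa>, of b x v] that by (simp add: f_def)
  from has_derivative_transform_within_open[OF d o _ this] ex
  have "((\<lambda>b. E \<kappa> (x, v)) has_derivative (\<lambda>u. D (E \<kappa>) (x, v)
      (D (act \<kappa>) (e, x) (u, 0), D (\<lambda>\<zeta>. D (act \<kappa>) \<zeta> (0, v)) (e, x) (u, 0)))) (at e)" by simp
  from has_derivative_unique[OF this has_derivative_const]
  have "D (E \<kappa>) (x, v) (D (act \<kappa>) (e, x) (u, 0), D (\<lambda>\<zeta>. D (act \<kappa>) \<zeta> (0, v)) (e, x) (u, 0)) = 0" by metis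
  hence "D (E \<kappa>) (x, v) (killing \<kappa> u x, D (killing \<kappa> u) x v) = 0"
    by (simp add: killing_def D_eq[OF D_killing[OF \<kappa> x]])
  moreover have "D (E \<kappa>) (x, v) ((killing \<kappa> u x, 0) + (0, D (killing \<kappa> u) x v)) =
      D (E \<kappa>) (x, v) (killing \<kappa> u x, 0) + D (E \<kappa>) (x, v) (0, D (killing \<kappa> u) x v)"
    by (rule linear_add[OF linear_D[OF smooth_E[OF \<kappa>] z]])
  ultimately show ?thesis by simp
qed

text \<open>The orbit map takes the right-invariant field of \<open>u\<close> to its fundamental vector field, since
  it intertwines left multiplication with the action.\<close>

lemma D_orb_right:
  assumes \<kappa>: "\<kappa> \<in> A" "x0 \<in> fst \<kappa>" and a: "a \<in> Vorb \<kappa>"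
  shows "D (orb \<kappa>) a (D mul (e, a) (u, 0)) = killing \<kappa> u (orb \<kappa> a)"
proof -
  have aV: "a \<in> V" using a Vorb_V by blast
  have x: "orb \<kappa> a \<in> snd \<kappa> ` fst \<kappa>" using a by (auto simp: orb_def Vorb_def)
  have "((\<lambda>b. mul (b, a)) has_derivative (\<lambda>u. D mul (e, a) (u, 0))) (at e)"
    by (rule has_partial_fst[OF mul_differentiable[OF \<Omega>_e(2)[OF aV]]])
  moreover have "(orb \<kappa> has_derivative D (orb \<kappa>) a) (at (mul (e, a)))"
    unfolding mul_e(2)[OF aV] by (rule orb_has_D[OF \<kappa>(1) a])
  ultimately have d1: "((\<lambda>b. orb \<kappa> (mul (b, a))) has_derivative (\<lambda>u. D (orb \<kappa>) a (D mul (e, a) (u, 0)))) (at e)"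
    by (rule has_derivative_compose)
  have d2: "((\<lambda>b. act \<kappa> (b, orb \<kappa> a)) has_derivative (\<lambda>u. D (act \<kappa>) (e, orb \<kappa> a) (u, 0))) (at e)"
    by (rule has_partial_fst[OF act_differentiable[OF \<kappa>(1) \<Omega>act_e[OF \<kappa>(1) x]]])
  have o: "open {b. (b, a) \<in> \<Omega>}"
    using open_vimage[OF open_\<Omega>, of "\<lambda>b. (b, a)"] by (simp add: vimage_def continuous_on_Pair)
  have "orb \<kappa> (mul (b, a)) = act \<kappa> (b, orb \<kappa> a)" if "b \<in> {b. (b, a) \<in> \<Omega>}" for b
    using orb_mul[OF \<kappa>(1) _ a] that by simp
  from has_derivative_transform_within_open[OF d1 o _ this] \<Omega>_e(2)[OF aV]
  have "((\<lambda>b. act \<kappa> (b, orb \<kappa> a)) has_derivative (\<lambda>u. D (orb \<kappa>) a (D mul (e, a) (u, 0)))) (at e)" by simp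
  from has_derivative_unique[OF this d2] show ?thesis unfolding killing_def by metis
qed

text \<open>The squared Minkowski norm is taken on the whole Lie algebra, where \<open>Vq\<close> is open and
  directional derivatives make sense, although it is degenerate along the isotropy algebra.\<close>

definition "q Y = (norm_m A F B x0 Y)\<^sup>2"
definition "Vq = {Y. \<delta> Y \<noteq> 0}"

lemma q_eq: "q Y = (F x0 (\<delta> Y))\<^sup>2" by (simp add: q_def norm_m_def \<delta>_def)

lemma open_Vq: "open Vq"
proof -
  have "continuous_on UNIV \<delta>" using linear_\<delta> by (simp add: linear_conv_bounded_linear linear_continuous_on)
  moreover have "Vq = \<delta> -` (UNIV - {0})" by (auto simp: Vq_def)
  ultimately show ?thesis using open_vimage[of "UNIV - {0}" \<delta>] by (auto simp: open_delete)
qed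

lemma smooth_q: "smooth_on q Vq"
  unfolding q_eq[abs_def]
  by (rule smooth_on_compose[OF smooth_F smooth_on_linear[OF linear_\<delta> open_Vq] open_Vq])
    (simp add: Vq_def)

lemma m_Vq: "y \<in> m \<Longrightarrow> y \<noteq> 0 \<Longrightarrow> y \<in> Vq" by (simp add: Vq_def \<delta>_eq_0)

lemma D_q: "Y \<in> Vq \<Longrightarrow> D q Y W = D (\<lambda>v. (F x0 v)\<^sup>2) (\<delta> Y) (\<delta> W)"
proof -
  assume Y: "Y \<in> Vq"
  have "(\<delta> has_derivative \<delta>) (at Y)"
    by (rule linear_has_derivative[OF linear_\<delta>])
  moreover have "((\<lambda>v. (F x0 v)\<^sup>2) has_derivative D (\<lambda>v. (F x0 v)\<^sup>2) (\<delta> Y)) (at (\<delta> Y))"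
    using Y by (intro smooth_on_has_D[OF smooth_F]) (simp add: Vq_def)
  ultimately have "(q has_derivative (\<lambda>W. D (\<lambda>v. (F x0 v)\<^sup>2) (\<delta> Y) (\<delta> W))) (at Y)"
    unfolding q_eq[abs_def] by (rule has_derivative_compose)
  thus ?thesis using D_eq by metis
qed

lemma D_q_cong: "Y \<in> Vq \<Longrightarrow> \<delta> W = \<delta> W' \<Longrightarrow> D q Y W = D q Y W'"
  by (simp add: D_q)

lemma D2_q_cong:
  assumes "Y \<in> Vq" "\<delta> W = \<delta> W'"
  shows "D (\<lambda>z. D q z W) Y Z = D (\<lambda>z. D q z W') Y Z"
  by (rule fun_cong[OF D_cong_open[OF open_Vq assms(1) D_q_cong[OF _ assms(2)]]])

lemma D2_q_symmetric: "Y \<in> Vq \<Longrightarrow> D (\<lambda>z. D q z W) Y Z = D (\<lambda>z. D q z Z) Y W"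
  by (rule second_derivative_symmetric[OF smooth_q open_Vq])

lemma D2_q_positive:
  assumes "Y \<in> Vq" "\<delta> W \<noteq> 0"
  shows "0 < D (\<lambda>z. D q z W) Y W"
proof -
  let ?f = "\<lambda>v. (F x0 v)\<^sup>2"
  have Y: "\<delta> Y \<noteq> 0" using assms(1) by (simp add: Vq_def)
  have "(\<delta> has_derivative \<delta>) (at Y)"
    by (rule linear_has_derivative[OF linear_\<delta>])
  moreover have "((\<lambda>v. D ?f v (\<delta> W)) has_derivative D (\<lambda>v. D ?f v (\<delta> W)) (\<delta> Y)) (at (\<delta> Y))"
    using Y by (intro smooth_on_has_D[OF smooth_on_D[OF smooth_F]]) simp
  ultimately have "((\<lambda>z. D ?f (\<delta> z) (\<delta> W)) has_derivative (\<lambda>Z. D (\<lambda>v. D ?f v (\<delta> W)) (\<delta> Y) (\<delta> Z))) (at Y)"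
    by (rule has_derivative_compose)
  from has_derivative_transform_within_open[OF this open_Vq assms(1) D_q[symmetric]]
  have "((\<lambda>z. D q z W) has_derivative (\<lambda>Z. D (\<lambda>v. D ?f v (\<delta> W)) (\<delta> Y) (\<delta> Z))) (at Y)" .
  from fun_cong[OF D_eq[OF this], of W]
  have "D (\<lambda>z. D q z W) Y W = D (\<lambda>v. D ?f v (\<delta> W)) (\<delta> Y) (\<delta> W)" .
  thus ?thesis using F_positive[OF Y assms(2)] by simp
qed

text \<open>Euler's theorem for the homogeneous function \<open>D q\<close> of degree one.\<close>

lemma D2_q_euler:
  assumes Y: "Y \<in> Vq"
  shows "D (\<lambda>z. D q z W) Y Y = D q Y W"
proof -
  have scale: "D q (l *\<^sub>R Y) W = l * D q Y W" if l: "l > 0" for l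
  proof -
    have lY: "l *\<^sub>R Y \<in> Vq" using Y l by (simp add: Vq_def linear_cmul[OF linear_\<delta>])
    have qs: "q (l *\<^sub>R Z) = l\<^sup>2 * q Z" for Z
      using l by (simp add: q_eq linear_cmul[OF linear_\<delta>] F_homogeneous power_mult_distrib)
    have "((\<lambda>Z. l *\<^sub>R Z) has_derivative (\<lambda>W. l *\<^sub>R W)) (at Y)" by (auto intro!: derivative_eq_intros)
    from has_derivative_compose[OF this smooth_on_has_D[OF smooth_q lY]]
    have 1: "((\<lambda>Z. l\<^sup>2 * q Z) has_derivative (\<lambda>W. D q (l *\<^sub>R Y) (l *\<^sub>R W))) (at Y)" by (simp add: qs)
    have 2: "((\<lambda>Z. l\<^sup>2 * q Z) has_derivative (\<lambda>W. l\<^sup>2 * D q Y W)) (at Y)"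
      by (rule has_derivative_mult_right[OF smooth_on_has_D[OF smooth_q Y]])
    have "D q (l *\<^sub>R Y) (l *\<^sub>R W) = l\<^sup>2 * D q Y W" using has_derivative_unique[OF 1 2] by metis
    hence "l * D q (l *\<^sub>R Y) W = l * (l * D q Y W)"
      using linear_cmul[OF linear_D[OF smooth_q lY]] by (simp add: power2_eq_square)
    thus ?thesis using l by simp
  qed
  have "((\<lambda>l. l *\<^sub>R Y) has_vector_derivative Y) (at 1)"
    unfolding has_vector_derivative_def by (auto intro!: derivative_eq_intros)
  moreover have "((\<lambda>z. D q z W) has_derivative D (\<lambda>z. D q z W) Y) (at (1 *\<^sub>R Y))"
    using smooth_on_has_D[OF smooth_on_D[OF smooth_q] Y] by simp
  ultimately have "((\<lambda>l. D q (l *\<^sub>R Y) W) has_vector_derivative D (\<lambda>z. D q z W) Y Y) (at 1)"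
    by (rule has_vector_derivative_compose)
  from has_vector_derivative_transform_within_open[OF this open_greaterThan, of 0 "\<lambda>l. l * D q Y W"]
  have 1: "((\<lambda>l. l * D q Y W) has_vector_derivative D (\<lambda>z. D q z W) Y Y) (at 1)"
    using scale by simp
  have "((\<lambda>l. l * D q Y W) has_vector_derivative D q Y W) (at 1)"
    unfolding has_vector_derivative_def by (auto intro!: derivative_eq_intros)
  from vector_derivative_unique_at[OF 1 this] show ?thesis .
qed

text \<open>Left invariance of the energy pulled back to the group: its fibre derivative at \<open>gr a\<close> is the
  one at the identity.\<close>

lemma D_E_orb:
  assumes \<kappa>: "\<kappa> \<in> A" "x0 \<in> fst \<kappa>" and a: "a \<in> Vorb \<kappa>" and Y: "Y \<in> Vq"
    and s: "(orb \<kappa> a, D (orb \<kappa>) a (\<theta> a Y)) \<in> slit \<kappa>"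
  shows "D (E \<kappa>) (orb \<kappa> a, D (orb \<kappa>) a (\<theta> a Y)) (0, D (orb \<kappa>) a (\<theta> a W)) = D q Y W"
proof -
  have aV: "a \<in> V" using a Vorb_V by blast
  have c: "chart_at A x0 \<in> A" "x0 \<in> fst (chart_at A x0)" using \<kappa>0 by (auto simp: \<kappa>0_def)
  have eq: "E \<kappa> (orb \<kappa> a, D (orb \<kappa>) a (\<theta> a Z)) = q Z" for Z
  proof -
    have "E \<kappa> (orb \<kappa> a, D (orb \<kappa>) a (\<theta> a Z)) = E \<kappa> (snd \<kappa> x0, D (orb \<kappa>) e Z)"
      using E_invariant[OF \<kappa>(1) \<Omega>act_x0[OF \<kappa> a]] by (simp add: D_orb_\<theta>[OF \<kappa> a] act_x0[OF \<kappa>])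
    also have "\<dots> = (F x0 (\<delta> Z))\<^sup>2"
      unfolding E_eq[OF \<kappa>] coord_change_\<delta>[OF \<kappa>, symmetric] coord_change_inverse[OF manM c(1) \<kappa>(1) c(2) \<kappa>(2)] ..
    finally show ?thesis by (simp add: q_eq)
  qed
  have lin: "linear (\<lambda>Z. D (orb \<kappa>) a (\<theta> a Z))"
    using linear_compose[OF linear_\<theta>[OF aV] linear_D[OF smooth_orb[OF \<kappa>(1)] a]] by (simp add: o_def)
  have d: "((\<lambda>Z. D (orb \<kappa>) a (\<theta> a Z)) has_derivative (\<lambda>Z. D (orb \<kappa>) a (\<theta> a Z))) (at Y)"
    by (rule linear_has_derivative[OF lin])
  have "((\<lambda>v. E \<kappa> (orb \<kappa> a, v)) has_derivative
      (\<lambda>w. D (E \<kappa>) (orb \<kappa> a, D (orb \<kappa>) a (\<theta> a Y)) (0, w))) (at (D (orb \<kappa>) a (\<theta> a Y)))"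
    by (rule has_partial_snd[OF smooth_on_differentiable[OF smooth_E[OF \<kappa>(1)] s]])
  from has_derivative_compose[OF d this]
  have "(q has_derivative (\<lambda>W. D (E \<kappa>) (orb \<kappa> a, D (orb \<kappa>) a (\<theta> a Y)) (0, D (orb \<kappa>) a (\<theta> a W)))) (at Y)"
    by (simp add: eq)
  from fun_cong[OF D_eq[OF this], of W] show ?thesis by (rule sym)
qed

end

lemma smooth_on_has_vector_derivative:
  fixes x :: "real \<Rightarrow> 'a::real_normed_vector"
  assumes "smooth_on x I" "t \<in> I"
  shows "(x has_vector_derivative D x t 1) (at t)"
proof -
  have "D x t h = h *\<^sub>R D x t 1" for h
    using linear_cmul[OF linear_D[OF assms], of h 1] by simp
  hence "D x t = (\<lambda>h. h *\<^sub>R D x t 1)" by (rule ext)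
  thus ?thesis using smooth_on_has_D[OF assms] by (simp only: has_vector_derivative_def)
qed

context homogeneous_finsler
begin

section \<open>Horizontal lifts\<close>

text \<open>The inverse of the identification of \<open>m\<close> with the tangent space at \<open>x0\<close>.\<close>

definition "J = (SOME J. linear J \<and> range J \<subseteq> m \<and> (\<forall>v\<in>m. J (\<delta> v) = v))"

lemma linear_J: "linear J" and J_m: "J x \<in> m" and J_\<delta>: "v \<in> m \<Longrightarrow> J (\<delta> v) = v"
proof -
  have "\<exists>J. linear J \<and> range J \<subseteq> m \<and> (\<forall>v\<in>m. J (\<delta> v) = v)"
    using linear_exists_left_inverse_on[OF linear_\<delta> reductive_facts(1) \<delta>_inj] by blast
  from someI_ex[OF this] show "linear J" "J x \<in> m" "v \<in> m \<Longrightarrow> J (\<delta> v) = v"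
    unfolding J_def by blast+
qed

lemma \<delta>_J: "\<delta> (J x) = x"
proof -
  obtain v where "v \<in> m" "x = \<delta> v" using \<delta>_surj by blast
  thus ?thesis by (simp add: J_\<delta>)
qed

text \<open>The matrix of the differential of the orbit map on the left-invariant fields generated
  by \<open>m\<close>.\<close>

definition "hor a = matrix (\<lambda>x. D (orb \<kappa>0) a (\<theta> a (J x)))"

lemma hor_mult: "a \<in> Vorb \<kappa>0 \<Longrightarrow> hor a *v x = D (orb \<kappa>0) a (\<theta> a (J x))"
proof -
  assume a: "a \<in> Vorb \<kappa>0"
  hence aV: "a \<in> V" using Vorb_V by blast
  have "linear (\<lambda>x. D (orb \<kappa>0) a (\<theta> a (J x)))"
    using linear_compose[OF linear_compose[OF linear_J linear_\<theta>[OF aV]] linear_D[OF smooth_orb[OF \<kappa>0(1)] a]]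
    by (simp add: o_def)
  thus ?thesis unfolding hor_def using matrix_works linear_matrix_vector_mul_eq by metis
qed

lemma smooth_hor:
  assumes "open S" "smooth_on a S" "\<And>x. x \<in> S \<Longrightarrow> a x \<in> Vorb \<kappa>0"
  shows "smooth_on (\<lambda>x. hor (a x) $ i $ j) S"
proof -
  have aV: "a x \<in> V" if "x \<in> S" for x using assms(3)[OF that] Vorb_V by blast
  have "smooth_on (\<lambda>x. D (orb \<kappa>0) (a x) (\<theta> (a x) (J (axis j 1)))) S"
    by (rule smooth_on_D_apply[OF smooth_orb[OF \<kappa>0(1)] assms(1,2)
          smooth_\<theta>[OF assms(1,2) smooth_on_const[OF assms(1)] aV] assms(3)])
  from smooth_on_nth[OF assms(1) this, of i] show ?thesis by (simp add: hor_def matrix_def)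
qed

lemma hor_e: "hor e = mat 1"
proof -
  have "hor e *v x = x" for x
    unfolding hor_mult[OF e_Vorb[OF \<kappa>0(2)]] by (simp add: \<delta>_eq[symmetric] \<delta>_J)
  thus ?thesis by (metis matrix_eq matrix_vector_mul_lid)
qed

definition "horsol a w = matrix_inv (hor a) *v w"

lemma hor_horsol:
  assumes "det (hor a) \<noteq> 0"
  shows "hor a *v horsol a w = w"
proof -
  have "invertible (hor a)" using assms by (simp add: invertible_det_nz)
  hence "hor a ** matrix_inv (hor a) = mat 1"
    using someI_ex[of "\<lambda>A'. hor a ** A' = mat 1 \<and> A' ** hor a = mat 1"]
    by (simp add: matrix_inv_def invertible_def)
  thus ?thesis by (simp add: horsol_def matrix_vector_mul_assoc)
qed

text \<open>The lift solves \<open>a' = \<theta> a (J s)\<close>, where the coordinates \<open>s\<close> of the left velocity are chosen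
  such that the orbit map takes \<open>a'\<close> to the velocity of the given curve. Hence the projection of
  the solution and the given curve have the same derivative and agree.\<close>

lemma lift_exists:
  assumes c: "smooth_curve euclidean A {-\<epsilon><..<\<epsilon>} c" "0 < \<epsilon>" "c 0 = x0"
    and vel: "\<And>t. t \<in> {-\<epsilon><..<\<epsilon>} \<Longrightarrow> velocity A c t \<noteq> 0"
  shows "\<exists>cb. \<exists>\<epsilon>>0. smooth_curve (group_topology G) B {-\<epsilon><..<\<epsilon>} cb \<and> cb 0 = id \<and>
        (\<forall>t\<in>{-\<epsilon><..<\<epsilon>}. c t = cb t x0 \<and> left_velocity B cb t \<in> m - {0})"
proof -
  have k0: "is_chart euclidean \<kappa>0" by (rule manifold_chart[OF manM \<kappa>0(1)])
  define I where "I = {t \<in> {-\<epsilon><..<\<epsilon>}. c t \<in> fst \<kappa>0}"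
  have I: "open I" unfolding I_def using c(1) unfolding smooth_curve_def
    by (intro open_curve_domain[OF _ open_greaterThanLessThan chart_openin[OF k0]]) (rule conjunct1)
  have I0: "0 \<in> I" using c \<kappa>0(2) by (simp add: I_def)
  define \<gamma> where "\<gamma> = snd \<kappa>0 \<circ> c"
  have s\<gamma>: "smooth_on \<gamma> I" using c(1) \<kappa>0(1) unfolding smooth_curve_def I_def \<gamma>_def by blast
  define \<gamma>' where "\<gamma>' t = D \<gamma> t 1" for t
  have s\<gamma>': "smooth_on \<gamma>' I" unfolding \<gamma>'_def by (rule smooth_on_D[OF s\<gamma>])
  have d\<gamma>: "(\<gamma> has_vector_derivative \<gamma>' t) (at t)" if "t \<in> I" for t
    unfolding \<gamma>'_def by (rule smooth_on_has_vector_derivative[OF s\<gamma> that])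
  have \<gamma>'_nz: "\<gamma>' t \<noteq> 0" if t: "t \<in> I" for t
  proof -
    have t': "t \<in> {-\<epsilon><..<\<epsilon>}" "c t \<in> fst \<kappa>0" using t by (auto simp: I_def)
    note ct = chart_at_M[of "c t"]
    have "\<gamma>' t = coord_change (chart_at A (c t)) \<kappa>0 (c t) (velocity A c t)"
      using coord_change_velocity[OF manM c(1) open_greaterThanLessThan t'(1) \<kappa>0(1) t'(2)]
        vector_derivative_at[OF d\<gamma>[OF t]] by (simp add: \<gamma>_def)
    thus ?thesis using coord_change_eq_0_iff[OF manM ct(1) \<kappa>0(1) ct(2) t'(2)] vel[OF t'(1)] by metis
  qed
  define W where "W = Vorb \<kappa>0 \<inter> V1"
  have W: "open W" "e \<in> W" unfolding W_def
    using open_Vorb[OF \<kappa>0(1)] open_V1 e_Vorb[OF \<kappa>0(2)] e_V1 by auto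
  have WV: "a \<in> Vorb \<kappa>0" "a \<in> V1" "a \<in> V" if "a \<in> W" for a using that V1_V by (auto simp: W_def)
  have sdet: "smooth_on (\<lambda>a. det (hor a)) W"
    by (rule smooth_on_det[OF W(1) smooth_hor[OF W(1) smooth_on_id[OF W(1)] WV(1)]])
  define W' where "W' = W \<inter> (\<lambda>a. det (hor a)) -` (- {0})"
  have W': "open W'" unfolding W'_def
    by (rule continuous_open_preimage[OF smooth_on_continuous[OF sdet] W(1)]) auto
  have W'e: "e \<in> W'" using W(2) by (simp add: W'_def hor_e)
  define S where "S = I \<times> W'"
  have S: "open S" unfolding S_def by (rule open_Times[OF I W'])
  have Sd: "fst p \<in> I" "snd p \<in> Vorb \<kappa>0" "snd p \<in> V1" "snd p \<in> V" "det (hor (snd p)) \<noteq> 0" if "p \<in> S" for p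
    using that WV[of "snd p"] by (auto simp: S_def W'_def)
  define s where "s p = horsol (snd p) (\<gamma>' (fst p))" for p
  have hs: "hor (snd p) *v s p = \<gamma>' (fst p)" if "p \<in> S" for p
    unfolding s_def by (rule hor_horsol[OF Sd(5)[OF that]])
  have ss: "smooth_on s S"
    by (rule smooth_on_linear_system[OF S smooth_hor[OF S smooth_on_snd[OF S smooth_on_id[OF S]] Sd(2)]
          smooth_on_compose[OF s\<gamma>' smooth_on_fst[OF S smooth_on_id[OF S]] S Sd(1)] Sd(5) hs])
  have blJ: "bounded_linear J" using linear_J by (simp add: linear_conv_bounded_linear)
  define X where "X p = (1 :: real, \<theta> (snd p) (J (s p)))" for p
  have sX: "smooth_on X S" unfolding X_def
    by (rule smooth_on_Pair[OF S smooth_on_const[OF S]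
          smooth_\<theta>[OF S smooth_on_snd[OF S smooth_on_id[OF S]] smooth_on_linear_compose[OF blJ S ss] Sd(4)]])
  have m: "(0, e) \<in> S" using I0 W'e by (simp add: S_def)
  obtain \<epsilon>' z where z: "0 < \<epsilon>'" "z 0 = (0, e)" "smooth_on z {-\<epsilon>'<..<\<epsilon>'}"
    "\<And>t. t \<in> {-\<epsilon>'<..<\<epsilon>'} \<Longrightarrow> z t \<in> S"
    "\<And>t. t \<in> {-\<epsilon>'<..<\<epsilon>'} \<Longrightarrow> (z has_vector_derivative X (z t)) (at t)"
    using ode_solution[OF sX S m] by metis
  let ?I = "{-\<epsilon>'<..<\<epsilon>'}"
  have z0: "0 \<in> ?I" using z(1) by simp
  have fz': "((\<lambda>t. fst (z t)) has_vector_derivative 1) (at t)" if "t \<in> ?I" for t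
    using bounded_linear.has_vector_derivative[OF bounded_linear_fst z(5)[OF that]] by (simp add: X_def)
  have idt: "((\<lambda>t :: real. t) has_vector_derivative 1) (at t)" for t
    unfolding has_vector_derivative_def by (auto intro!: derivative_eq_intros)
  have fz: "fst (z t) = t" if "t \<in> ?I" for t
    by (rule equal_derivatives_imp_equal[OF fz' idt z0 _ that]) (simp_all add: z(2))
  define a where "a t = snd (z t)" for t
  have zt: "z t = (t, a t)" if "t \<in> ?I" for t using fz[OF that] by (simp add: a_def prod_eq_iff)
  have a0: "a 0 = e" by (simp add: a_def z(2))
  have at: "t \<in> I" "a t \<in> Vorb \<kappa>0" "a t \<in> V1" "a t \<in> V" "(t, a t) \<in> S" if "t \<in> ?I" for t
    using Sd[OF z(4)[OF that]] z(4)[OF that] unfolding zt[OF that] by simp_all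
  have da: "(a has_vector_derivative \<theta> (a t) (J (s (t, a t)))) (at t)" if "t \<in> ?I" for t
    using bounded_linear.has_vector_derivative[OF bounded_linear_snd z(5)[OF that]]
    unfolding zt[OF that] by (simp add: X_def a_def[abs_def])
  have "((\<lambda>t. orb \<kappa>0 (a t)) has_vector_derivative \<gamma>' t) (at t)" if "t \<in> ?I" for t
    using has_vector_derivative_compose[OF da[OF that] orb_has_D[OF \<kappa>0(1) at(2)[OF that]]]
      hs[OF at(5)[OF that]] by (simp add: hor_mult[OF at(2)[OF that]])
  from equal_derivatives_imp_equal[OF this d\<gamma>[OF at(1)] z0]
  have orb_a: "orb \<kappa>0 (a t) = \<gamma> t" if "t \<in> ?I" for t
    using that by (simp add: a0 orb_e \<gamma>_def c(3))
  define cb where "cb t = gr (a t)" for t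
  have sa: "smooth_on a ?I" unfolding a_def by (rule smooth_on_snd[OF _ z(3)]) simp
  have scb: "smooth_curve (group_topology G) B ?I cb" unfolding cb_def
    by (rule smooth_curveI[OF manG \<psi>(1) open_greaterThanLessThan sa at(4)])
  have cbt: "snd \<psi> (cb t) = a t" "cb t \<in> fst \<psi>" if "t \<in> ?I" for t
    using \<psi>_gr[OF at(4)[OF that]] gr_in[OF at(4)[OF that]] by (auto simp: cb_def)
  have cx: "c t = cb t x0" if "t \<in> ?I" for t
    using chart_inv_orb[OF \<kappa>0(1) at(2)[OF that]] orb_a[OF that] chart_inv_snd[OF k0, of "c t"] at(1)[OF that]
    by (simp add: cb_def \<gamma>_def I_def)
  have lv: "left_velocity B cb t = J (s (t, a t))" if t: "t \<in> ?I" for t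
  proof -
    have "((snd \<psi> \<circ> cb) has_vector_derivative \<theta> (a t) (J (s (t, a t)))) (at t)"
      by (rule has_vector_derivative_transform_within_open[OF da[OF t] open_greaterThanLessThan t])
        (simp add: cbt)
    hence "vector_derivative (snd \<psi> \<circ> cb) (at t) = \<theta> (a t) (J (s (t, a t)))" by (rule vector_derivative_at)
    moreover have "snd \<psi> (cb t) \<in> V1" using cbt(1)[OF t] at(3)[OF t] by simp
    ultimately show ?thesis
      using left_velocity_eq[OF scb open_greaterThanLessThan t _ cbt(2)[OF t]] \<Theta>_\<theta>[OF at(3)[OF t]]
      by (simp add: cbt(1)[OF t])
  qed
  have "J (s (t, a t)) \<noteq> 0" if t: "t \<in> ?I" for t
  proof
    assume "J (s (t, a t)) = 0"
    hence "s (t, a t) = 0" using \<delta>_J[of "s (t, a t)"] linear_0[OF linear_\<delta>] by simp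
    hence "\<gamma>' t = 0" using hs[OF at(5)[OF t]] by simp
    thus False using \<gamma>'_nz[OF at(1)[OF t]] by simp
  qed
  hence "left_velocity B cb t \<in> m - {0}" if "t \<in> ?I" for t using lv[OF that] J_m that by simp
  moreover have "cb 0 = id" by (simp add: cb_def a0)
  ultimately show ?thesis using z(1) scb cx by blast
qed

lemma curve_lift:
  assumes c: "smooth_curve euclidean A {-\<epsilon><..<\<epsilon>} c" "0 < \<epsilon>" "c 0 = x0"
    and vel: "\<And>t. t \<in> {-\<epsilon><..<\<epsilon>} \<Longrightarrow> velocity A c t \<noteq> 0"
  obtains \<epsilon>' where "0 < \<epsilon>'" "smooth_curve (group_topology G) B {-\<epsilon>'<..<\<epsilon>'} (curve_lift G B x0 m c)"
    "curve_lift G B x0 m c 0 = id"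
    "\<And>t. t \<in> {-\<epsilon>'<..<\<epsilon>'} \<Longrightarrow> c t = curve_lift G B x0 m c t x0"
    "\<And>t. t \<in> {-\<epsilon>'<..<\<epsilon>'} \<Longrightarrow> left_velocity B (curve_lift G B x0 m c) t \<in> m - {0}"
  using someI_ex[OF lift_exists[OF assms]] unfolding curve_lift_def by blast

section \<open>The spray vector field\<close>

lemma has_vector_derivative_in_m:
  assumes "open I" "t \<in> I" "\<And>s. s \<in> I \<Longrightarrow> Y s \<in> m" "(Y has_vector_derivative Y') (at t)"
  shows "Y' \<in> m"
proof -
  have blJ: "bounded_linear (\<lambda>v. J (\<delta> v))"
    using linear_compose[OF linear_\<delta> linear_J] by (simp add: linear_conv_bounded_linear o_def)
  have "((\<lambda>s. J (\<delta> (Y s))) has_vector_derivative J (\<delta> Y')) (at t)"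
    by (rule bounded_linear.has_vector_derivative[OF blJ assms(4)])
  from has_vector_derivative_transform_within_open[OF this assms(1,2) J_\<delta>[OF assms(3)]]
  have "(Y has_vector_derivative J (\<delta> Y')) (at t)" .
  hence "Y' = J (\<delta> Y')" using vector_derivative_unique_at assms(4) by blast
  thus ?thesis using J_m by metis
qed

text \<open>An isometry annihilates no tangent vector because it preserves \<open>F\<close>.\<close>

lemma D_act_eq_0:
  assumes \<kappa>: "\<kappa> \<in> A" and b: "(b, x) \<in> \<Omega>act \<kappa>" and v: "D (act \<kappa>) (b, x) (0, v) = 0"
  shows "v = 0"
proof (rule ccontr)
  assume "v \<noteq> 0"
  have x: "x \<in> snd \<kappa> ` fst \<kappa>" and y: "act \<kappa> (b, x) \<in> snd \<kappa> ` fst \<kappa>"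
    using b by (auto simp: \<Omega>act_def act_def)
  have E0: "E \<kappa> (w, v) = 0 \<longleftrightarrow> v = 0" if "w \<in> snd \<kappa> ` fst \<kappa>" for w v
  proof -
    obtain p where p: "p \<in> fst \<kappa>" "w = snd \<kappa> p" using \<open>w \<in> snd \<kappa> ` fst \<kappa>\<close> by blast
    note c = chart_at_M[of p]
    have pos: "w \<noteq> 0 \<Longrightarrow> 0 < F p w" for w using finsler by (simp add: finsler_metric_def)
    have "F p 0 = 0" using F_homogeneous[of 0 p 0] by simp
    hence "F p w = 0 \<longleftrightarrow> w = 0" for w using pos[of w] by (cases "w = 0") auto
    thus ?thesis unfolding p(2) E_eq[OF \<kappa> p(1)]
      using coord_change_eq_0_iff[OF manM \<kappa> c(1) p(1) c(2), of v] by simp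
  qed
  have "E \<kappa> (x, v) = 0" using E_invariant[OF \<kappa> b, of v] E0[OF y, of 0] v by simp
  thus False using E0[OF x] \<open>v \<noteq> 0\<close> by simp
qed

abbreviation "\<eta> \<equiv> spray_vector_field A F G B x0 m"

text \<open>For a geodesic \<open>c\<close> with lift \<open>gr a\<close> and left velocity \<open>Y\<close>, the momentum \<open>P\<close> paired with the
  fundamental vector field of \<open>u\<close> is conserved by the Euler--Lagrange and the Killing equation.
  By left invariance \<open>P = D q Y W\<close> with \<open>W\<close> the translate of the right-invariant field of \<open>u\<close>
  to the identity, whose derivative at time \<open>0\<close> is a bracket.\<close>

lemma spray_equation:
  assumes y: "y \<in> m" "y \<noteq> 0"
  shows "\<eta> y \<in> m" "D (\<lambda>z. D q z u) y (\<eta> y) = D q y (lie_bracket B u y)"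
proof -
  have \<delta>y: "\<delta> y \<noteq> 0" using \<delta>_eq_0 y by simp
  define c where "c = geodesic A F x0 (\<delta> y)"
  obtain \<epsilon>0 where geo: "0 < \<epsilon>0" "geodesic_on A F {-\<epsilon>0<..<\<epsilon>0} c" "c 0 = x0" "velocity A c 0 = \<delta> y"
    using geodesic[OF \<delta>y] unfolding c_def by blast
  have sc: "smooth_curve euclidean A {-\<epsilon>0<..<\<epsilon>0} c"
    and vel: "\<And>t. t \<in> {-\<epsilon>0<..<\<epsilon>0} \<Longrightarrow> velocity A c t \<noteq> 0"
    and eqn: "\<And>t. t \<in> {-\<epsilon>0<..<\<epsilon>0} \<Longrightarrow> \<exists>\<kappa>\<in>A. c t \<in> fst \<kappa> \<and>
        (let z = (\<lambda>s. (snd \<kappa> (c s), vector_derivative (snd \<kappa> \<circ> c) (at s)))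
         in (z has_vector_derivative geodesic_spray A F \<kappa> (z t)) (at t))"
    using geo(2) unfolding geodesic_on_def by blast+
  have z0: "0 \<in> {-\<epsilon>0<..<\<epsilon>0}" using geo(1) by simp
  define cb where "cb = curve_lift G B x0 m c"
  obtain \<epsilon>1 where lift: "0 < \<epsilon>1" "smooth_curve (group_topology G) B {-\<epsilon>1<..<\<epsilon>1} cb" "cb 0 = id"
    "\<And>t. t \<in> {-\<epsilon>1<..<\<epsilon>1} \<Longrightarrow> c t = cb t x0"
    "\<And>t. t \<in> {-\<epsilon>1<..<\<epsilon>1} \<Longrightarrow> left_velocity B cb t \<in> m - {0}"
    using curve_lift[OF sc geo(1,3) vel] unfolding cb_def by blast
  obtain \<kappa> where \<kappa>: "\<kappa> \<in> A" "x0 \<in> fst \<kappa>" and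
    ez: "((\<lambda>s. (snd \<kappa> (c s), vector_derivative (snd \<kappa> \<circ> c) (at s))) has_vector_derivative
      geodesic_spray A F \<kappa> (snd \<kappa> (c 0), vector_derivative (snd \<kappa> \<circ> c) (at 0))) (at 0)"
    using eqn[OF z0] unfolding Let_def geo(3) by blast
  have k: "is_chart euclidean \<kappa>" by (rule manifold_chart[OF manM \<kappa>(1)])
  \<comment> \<open>for small times \<open>cb t\<close> and its inverse lie in the chart, so that \<open>Y\<close> is given by \<open>\<Theta>\<close>\<close>
  define I1 where "I1 = {t \<in> {-\<epsilon>1<..<\<epsilon>1}. cb t \<in> fst \<psi>}"
  have I1: "open I1" unfolding I1_def using lift(2) unfolding smooth_curve_def
    by (intro open_curve_domain[OF _ open_greaterThanLessThan chart_openin[OF \<psi>(3)]]) (rule conjunct1)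
  define a where "a = snd \<psi> \<circ> cb"
  have sa1: "smooth_on a I1" using lift(2) \<psi>(1) unfolding smooth_curve_def I1_def a_def by blast
  define I where "I = I1 \<inter> a -` (V1 \<inter> Vorb \<kappa>)"
  have I: "open I" unfolding I_def
    by (rule continuous_open_preimage[OF smooth_on_continuous[OF sa1] I1 open_Int[OF open_V1 open_Vorb[OF \<kappa>(1)]]])
  have a0: "a 0 = e" by (simp add: a_def lift(3) e_def)
  have I0: "0 \<in> I" using lift(1,3) \<psi>(2) e_V1 e_Vorb[OF \<kappa>(2)] a0 by (simp add: I_def I1_def)
  have sa: "smooth_on a I" by (rule smooth_on_subset[OF sa1]) (simp add: I_def)
  have It: "t \<in> {-\<epsilon>1<..<\<epsilon>1}" "cb t \<in> fst \<psi>" "a t \<in> V1" "a t \<in> Vorb \<kappa>" "a t \<in> V" "gr (a t) = cb t"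
    if "t \<in> I" for t
    using that V1_V gr_\<psi>[of "cb t"] by (auto simp: I_def I1_def a_def)
  define a' where "a' t = D a t 1" for t
  have sa': "smooth_on a' I" unfolding a'_def by (rule smooth_on_D[OF sa])
  have da: "(a has_vector_derivative a' t) (at t)" if "t \<in> I" for t
    unfolding a'_def by (rule smooth_on_has_vector_derivative[OF sa that])
  define Y where "Y t = \<Theta> (a t) (a' t)" for t
  have lv: "left_velocity B cb t = Y t" if "t \<in> I" for t
    using left_velocity_eq[OF lift(2) open_greaterThanLessThan It(1)[OF that] _ It(2)[OF that]] It(3)[OF that]
      vector_derivative_at[OF da[OF that]] by (simp add: a_def Y_def)
  have Ym: "Y t \<in> m" "Y t \<noteq> 0" if "t \<in> I" for t using lift(5)[OF It(1)[OF that]] lv[OF that] by auto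
  have \<theta>Y: "\<theta> (a t) (Y t) = a' t" if "t \<in> I" for t unfolding Y_def by (rule \<theta>_\<Theta>[OF It(3)[OF that]])
  have sY: "smooth_on Y I" unfolding Y_def by (rule smooth_\<Theta>[OF I sa sa' It(3)])
  define Y' where "Y' = D Y 0 1"
  have dY: "(Y has_vector_derivative Y') (at 0)"
    unfolding Y'_def by (rule smooth_on_has_vector_derivative[OF sY I0])
  have "(left_velocity B cb has_vector_derivative Y') (at 0)"
    by (rule has_vector_derivative_transform_within_open[OF dY I I0 lv[symmetric]])
  hence \<eta>: "\<eta> y = - Y'"
    unfolding spray_vector_field_def \<delta>_def[symmetric] c_def[symmetric] cb_def[symmetric]
    by (simp add: vector_derivative_at)
  have Y'm: "Y' \<in> m" by (rule has_vector_derivative_in_m[OF I I0 Ym(1) dY])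
  thus "\<eta> y \<in> m" unfolding \<eta> using subspace_neg[OF reductive_facts(1)] by blast
  \<comment> \<open>the geodesic equation holds at time \<open>0\<close> in some chart \<open>\<kappa>\<close>, possibly not the preferred one\<close>
  have c_orb: "snd \<kappa> (c t) = orb \<kappa> (a t)" "c t \<in> fst \<kappa>" if "t \<in> I" for t
    using lift(4)[OF It(1)[OF that]] It(4,6)[OF that] by (auto simp: orb_def Vorb_def)
  have d\<gamma>: "((snd \<kappa> \<circ> c) has_vector_derivative D (orb \<kappa>) (a t) (a' t)) (at t)" if t: "t \<in> I" for t
  proof -
    have "((\<lambda>t. orb \<kappa> (a t)) has_vector_derivative D (orb \<kappa>) (a t) (a' t)) (at t)"
      by (rule has_vector_derivative_compose[OF da[OF t] orb_has_D[OF \<kappa>(1) It(4)[OF t]]])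
    from has_vector_derivative_transform_within_open[OF this I t] show ?thesis
      using c_orb(1) by simp
  qed
  define \<gamma>' where "\<gamma>' t = D (orb \<kappa>) (a t) (a' t)" for t
  have vd: "vector_derivative (snd \<kappa> \<circ> c) (at t) = \<gamma>' t" if "t \<in> I" for t
    unfolding \<gamma>'_def by (rule vector_derivative_at[OF d\<gamma>[OF that]])
  have Y0: "Y 0 = y"
  proof -
    have e1: "a' 0 = Y 0" using \<theta>Y[OF I0] by (simp add: a0)
    have c0: "c 0 \<in> fst \<kappa>" using geo(3) \<kappa>(2) by simp
    have "coord_change (chart_at A x0) \<kappa> x0 (\<delta> y) = \<gamma>' 0"
      using coord_change_velocity[OF manM sc open_greaterThanLessThan z0 \<kappa>(1) c0] vd[OF I0]
      by (simp add: geo(3,4))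
    also have "\<dots> = coord_change (chart_at A x0) \<kappa> x0 (\<delta> (Y 0))"
      unfolding coord_change_\<delta>[OF \<kappa>] by (simp add: \<gamma>'_def a0 e1)
    finally have "\<delta> y = \<delta> (Y 0)"
      using coord_change_inverse[OF manM \<kappa>0(1) \<kappa>(1) \<kappa>0(2) \<kappa>(2)] unfolding \<kappa>0_def[symmetric] by metis
    thus ?thesis using \<delta>_inj Ym(1)[OF I0] y(1) by (simp add: inj_on_def)
  qed
  define z where "z t = (orb \<kappa> (a t), \<gamma>' t)" for t
  have zs: "z t \<in> slit \<kappa>" if t: "t \<in> I" for t
  proof -
    have "D (orb \<kappa>) e (Y t) \<noteq> 0" using D_orb_eq_0[OF \<kappa>] \<delta>_eq_0 Ym[OF t] by simp
    moreover have "\<gamma>' t = D (act \<kappa>) (a t, snd \<kappa> x0) (0, D (orb \<kappa>) e (Y t))"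
      unfolding \<gamma>'_def \<theta>Y[OF t, symmetric] by (rule D_orb_\<theta>[OF \<kappa> It(4)[OF t]])
    ultimately have "\<gamma>' t \<noteq> 0" using D_act_eq_0[OF \<kappa>(1) \<Omega>act_x0[OF \<kappa> It(4)[OF t]]] by metis
    thus ?thesis using It(4)[OF t] by (auto simp: z_def slit_def orb_def Vorb_def)
  qed
  have dz: "(z has_vector_derivative geodesic_spray A F \<kappa> (z 0)) (at 0)"
  proof -
    have eq: "(snd \<kappa> (c s), vector_derivative (snd \<kappa> \<circ> c) (at s)) = z s" if "s \<in> I" for s
      using c_orb(1)[OF that] vd[OF that] by (simp add: z_def)
    from has_vector_derivative_transform_within_open[OF ez I I0 eq] show ?thesis unfolding eq[OF I0] .
  qed
  \<comment> \<open>by the Euler--Lagrange equation the derivative of the momentum at time \<open>0\<close> is the left-hand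
    side of the Killing equation\<close>
  define P where "P t = D (E \<kappa>) (z t) (0, killing \<kappa> u (fst (z t)))" for t
  have x: "fst (z 0) \<in> snd \<kappa> ` fst \<kappa>" using zs[OF I0] by (auto simp: slit_def)
  have dP: "(P has_vector_derivative 0) (at 0)"
  proof -
    have fz: "((\<lambda>t. fst (z t)) has_vector_derivative \<gamma>' 0) (at 0)"
      using bounded_linear.has_vector_derivative[OF bounded_linear_fst dz]
      by (simp add: geodesic_spray_def z_def)
    have "(killing \<kappa> u has_derivative D (killing \<kappa> u) (fst (z 0))) (at (fst (z 0)))"
      using D_killing[OF \<kappa>(1) x, of u] D_eq[OF D_killing[OF \<kappa>(1) x, of u]] by simp
    from has_vector_derivative_compose[OF fz this]
    have "((\<lambda>t. (0, killing \<kappa> u (fst (z t)))) has_vector_derivative (0, D (killing \<kappa> u) (fst (z 0)) (\<gamma>' 0))) (at 0)"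
      by (rule has_vector_derivative_Pair[OF has_vector_derivative_const])
    from has_vector_derivative_D_apply[OF smooth_E[OF \<kappa>(1)] open_slit[OF \<kappa>(1)] zs[OF I0] dz this]
    have "(P has_vector_derivative
        D (\<lambda>\<zeta>. D (E \<kappa>) \<zeta> (0, killing \<kappa> u (fst (z 0)))) (z 0) (geodesic_spray A F \<kappa> (z 0))
        + D (E \<kappa>) (z 0) (0, D (killing \<kappa> u) (fst (z 0)) (\<gamma>' 0))) (at 0)" unfolding P_def[abs_def] .
    moreover have "D (E \<kappa>) (z 0) (killing \<kappa> u (fst (z 0)), 0)
        + D (E \<kappa>) (z 0) (0, D (killing \<kappa> u) (fst (z 0)) (\<gamma>' 0)) = 0"
      using killing_equation[OF \<kappa>(1), of "fst (z 0)" "\<gamma>' 0" u] zs[OF I0] by (simp add: z_def)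
    ultimately show ?thesis unfolding euler_lagrange[OF \<kappa>(1) zs[OF I0]] by simp
  qed
  \<comment> \<open>\<open>W t\<close> is \<open>Ad (inv (cb t)) u\<close>: its left translate by \<open>cb t\<close> is the right-invariant field of \<open>u\<close>;
    differentiating \<open>\<theta> (a t) (W t) = R t\<close> gives \<open>\<beta> y u + W' = \<beta> u y\<close>\<close>
  define R where "R t = D mul (e, a t) (u, 0)" for t
  define W where "W t = \<Theta> (a t) (R t)" for t
  have \<theta>W: "\<theta> (a t) (W t) = R t" if "t \<in> I" for t unfolding W_def by (rule \<theta>_\<Theta>[OF It(3)[OF that]])
  have sR: "smooth_on R I" unfolding R_def
    by (rule smooth_on_D_apply[OF smooth_mul I smooth_on_Pair[OF I smooth_on_const[OF I] sa]
          smooth_on_const[OF I] \<Omega>_e(2)[OF It(5)]])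
  have sW: "smooth_on W I" unfolding W_def by (rule smooth_\<Theta>[OF I sa sR It(3)])
  define W' where "W' = D W 0 1"
  have dW: "(W has_vector_derivative W') (at 0)"
    unfolding W'_def by (rule smooth_on_has_vector_derivative[OF sW I0])
  have W0: "W 0 = u" using \<theta>W[OF I0] by (simp add: a0 R_def D_mul_e)
  have a'0: "a' 0 = y" using \<theta>Y[OF I0] by (simp add: a0 Y0)
  have W': "W' = lie_bracket B u y"
  proof -
    have ee: "(e, e) \<in> \<Omega>" by (rule \<Omega>_e(1)[OF e_V])
    have da0: "(a has_vector_derivative y) (at 0)" using da[OF I0] by (simp add: a'0)
    have "((\<lambda>t. (a t, e)) has_vector_derivative (y, 0)) (at 0)"
      by (rule has_vector_derivative_Pair[OF da0 has_vector_derivative_const])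
    moreover have "((\<lambda>t. (0, W t)) has_vector_derivative (0, W')) (at 0)"
      by (rule has_vector_derivative_Pair[OF has_vector_derivative_const dW])
    ultimately have "((\<lambda>t. D mul (a t, e) (0, W t)) has_vector_derivative
        D (\<lambda>\<zeta>. D mul \<zeta> (0, W 0)) (a 0, e) (y, 0) + D mul (a 0, e) (0, W')) (at 0)"
      using has_vector_derivative_D_apply[OF smooth_mul open_\<Omega>, of "\<lambda>t. (a t, e)" 0] ee a0 by simp
    hence 1: "((\<lambda>t. \<theta> (a t) (W t)) has_vector_derivative \<beta> y u + W') (at 0)"
      by (simp add: \<theta>_def \<beta>_eq a0 W0 D_mul_e)
    have "((\<lambda>t. (e, a t)) has_vector_derivative (0, y)) (at 0)"
      by (rule has_vector_derivative_Pair[OF has_vector_derivative_const da0])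
    moreover have "((\<lambda>t. (u, 0 :: 'b)) has_vector_derivative (0, 0)) (at 0)"
      by (rule has_vector_derivative_Pair[OF has_vector_derivative_const has_vector_derivative_const])
    ultimately have "((\<lambda>t. D mul (e, a t) (u, 0)) has_vector_derivative
        D (\<lambda>\<zeta>. D mul \<zeta> (u, 0)) (e, a 0) (0, y) + D mul (e, a 0) (0, 0)) (at 0)"
      using has_vector_derivative_D_apply[OF smooth_mul open_\<Omega>, of "\<lambda>t. (e, a t)" 0] ee a0 by simp
    hence "(R has_vector_derivative \<beta> u y) (at 0)" by (simp add: R_def[abs_def] \<beta>_eq' a0 D_mul_e)
    from has_vector_derivative_transform_within_open[OF this I I0 \<theta>W[symmetric]]
    have "((\<lambda>t. \<theta> (a t) (W t)) has_vector_derivative \<beta> u y) (at 0)" .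
    from vector_derivative_unique_at[OF 1 this] show ?thesis by (simp add: lie_bracket_eq algebra_simps)
  qed
  have P: "P t = D q (Y t) (W t)" if t: "t \<in> I" for t
  proof -
    have "D (orb \<kappa>) (a t) (\<theta> (a t) (Y t)) = \<gamma>' t" unfolding \<gamma>'_def \<theta>Y[OF t] ..
    moreover have "D (orb \<kappa>) (a t) (\<theta> (a t) (W t)) = killing \<kappa> u (orb \<kappa> (a t))"
      unfolding \<theta>W[OF t] R_def by (rule D_orb_right[OF \<kappa> It(4)[OF t]])
    ultimately show ?thesis
      using D_E_orb[OF \<kappa> It(4)[OF t] m_Vq[OF Ym[OF t]], of "W t"] zs[OF t] by (simp add: P_def z_def)
  qed
  have yq: "y \<in> Vq" by (rule m_Vq[OF y])
  have "((\<lambda>t. D q (Y t) (W t)) has_vector_derivative D (\<lambda>z. D q z u) y Y' + D q y W') (at 0)"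
    using has_vector_derivative_D_apply[OF smooth_q open_Vq _ dY dW] yq by (simp add: Y0 W0)
  moreover from has_vector_derivative_transform_within_open[OF dP I I0 P]
  have "((\<lambda>t. D q (Y t) (W t)) has_vector_derivative 0) (at 0)" .
  ultimately have "D (\<lambda>z. D q z u) y Y' + D q y W' = 0" by (rule vector_derivative_unique_at)
  thus "D (\<lambda>z. D q z u) y (\<eta> y) = D q y (lie_bracket B u y)"
    unfolding \<eta> W'[symmetric] linear_neg[OF linear_D[OF smooth_on_D[OF smooth_q] yq]] by simp
qed

section \<open>The connection operator\<close>

abbreviation "g \<equiv> fundamental_tensor (norm_m A F B x0)"
abbreviation "C \<equiv> cartan_tensor (norm_m A F B x0)"
abbreviation "br \<equiv> bracket_m G B x0 m"

lemma g_eq: "y \<in> Vq \<Longrightarrow> g y u v = 1/2 * D (\<lambda>z. D q z v) y u"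
  by (rule fundamental_tensor_eq[OF open_Vq smooth_q]) (simp_all add: q_def)

lemma C_eq: "y \<in> Vq \<Longrightarrow> C y u v w = 1/4 * D (\<lambda>z. D (\<lambda>z. D q z w) z v) y u"
  by (rule cartan_tensor_eq[OF open_Vq smooth_q]) (simp_all add: q_def)

lemma br_eq: "br u v = prm (lie_bracket B u v)" by (simp add: bracket_m_def prm_def)

lemma linear_g:
  assumes "y \<in> Vq"
  shows "linear (\<lambda>u. g y u v)"
proof -
  have "linear (D (\<lambda>z. D q z v) y)" by (rule linear_D[OF smooth_on_D[OF smooth_q] assms])
  from linear_compose_scale_right[OF this, of "1/2"] show ?thesis
    unfolding g_eq[OF assms] by simp
qed

text \<open>The defining linear system of \<open>\<eta>\<close> is regular because the fundamental tensor is positive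
  definite, so \<open>\<eta>\<close> is differentiable along lines.\<close>

lemma spray_derivative:
  assumes y: "y \<in> m" "y \<noteq> 0" and v: "v \<in> m"
  obtains \<eta>' where "\<eta>' \<in> m" "((\<lambda>t. \<eta> (y + t *\<^sub>R v)) has_vector_derivative \<eta>') (at 0)"
proof -
  define Y where "Y t = y + t *\<^sub>R v" for t
  define I where "I = Y -` Vq"
  have "continuous_on UNIV Y" unfolding Y_def by (intro continuous_intros)
  hence I: "open I" unfolding I_def using open_vimage[OF open_Vq] by blast
  have I0: "0 \<in> I" using m_Vq[OF y] by (simp add: I_def Y_def)
  have blv: "bounded_linear (\<lambda>t. t *\<^sub>R v)" by (rule bounded_linear_scaleR_left)
  have sY: "smooth_on Y I" unfolding Y_def
    by (rule smooth_on_add[OF I smooth_on_const[OF I] smooth_on_bounded_linear[OF blv I]])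
  have YV: "Y t \<in> Vq" if "t \<in> I" for t using that by (simp add: I_def)
  have Ym: "Y t \<in> m" for t
    using y v subspace_add[OF reductive_facts(1)] subspace_scale[OF reductive_facts(1)] by (simp add: Y_def)
  have Ynz: "Y t \<noteq> 0" if "t \<in> I" for t using YV[OF that] linear_0[OF linear_\<delta>] by (auto simp: Vq_def)
  define h where "h t = \<delta> (\<eta> (Y t))" for t
  have Jh: "J (h t) = \<eta> (Y t)" if "t \<in> I" for t
    unfolding h_def by (rule J_\<delta>[OF spray_equation(1)[OF Ym Ynz[OF that]]])
  define M where "M t = (\<chi> i j. D (\<lambda>z. D q z (J (axis i 1))) (Y t) (J (axis j 1)))" for t
  define r where "r t = (\<chi> i. D q (Y t) (lie_bracket B (J (axis i 1)) (Y t)))" for t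
  have lin: "linear (\<lambda>x. D (\<lambda>z. D q z w) (Y t) (J x))" if "t \<in> I" for t w
    using linear_compose[OF linear_J linear_D[OF smooth_on_D[OF smooth_q] YV[OF that]]] by (simp add: o_def)
  have Mw: "(M t *v w) $ i = D (\<lambda>z. D q z (J (axis i 1))) (Y t) (J w)" if "t \<in> I" for t w i
    unfolding linear_axis_expansion[OF lin[OF that], of "J (axis i 1)" w]
    by (simp add: M_def matrix_vector_mult_def mult.commute)
  have Mh: "M t *v h t = r t" if "t \<in> I" for t
  proof -
    have "(M t *v h t) $ i = r t $ i" for i
      unfolding Mw[OF that] Jh[OF that] spray_equation(2)[OF Ym Ynz[OF that]] by (simp add: r_def)
    thus ?thesis by (simp add: vec_eq_iff)
  qed
  have detM: "det (M t) \<noteq> 0" if t: "t \<in> I" for t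
  proof -
    have "w = 0" if "M t *v w = 0" for w
    proof (rule ccontr)
      assume "w \<noteq> 0"
      hence "0 < D (\<lambda>z. D q z (J w)) (Y t) (J w)"
        by (intro D2_q_positive[OF YV[OF t]]) (simp add: \<delta>_J)
      also have "\<dots> = (\<Sum>i\<in>UNIV. w $ i * D (\<lambda>z. D q z (J w)) (Y t) (J (axis i 1)))"
        by (rule linear_axis_expansion[OF lin[OF t]])
      also have "\<dots> = (\<Sum>i\<in>UNIV. w $ i * (M t *v w) $ i)"
        unfolding Mw[OF t] D2_q_symmetric[OF YV[OF t], of "J w"] ..
      finally show False using that by simp
    qed
    hence "\<exists>B. B ** M t = mat 1" using matrix_left_invertible_ker by blast
    thus ?thesis using invertible_left_inverse invertible_det_nz by blast
  qed
  have sM: "smooth_on (\<lambda>t. M t $ i $ j) I" for i j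
    unfolding M_def vec_lambda_beta
    by (rule smooth_on_compose[OF smooth_on_D[OF smooth_on_D[OF smooth_q]] sY I YV])
  have sr: "smooth_on r I"
  proof (rule smooth_on_vec[OF I])
    fix i
    have "bounded_linear (\<lambda>Y. lie_bracket B (J (axis i 1)) Y)"
      using linear_lie_bracket by (simp add: linear_conv_bounded_linear)
    from smooth_on_D_apply[OF smooth_q I sY smooth_on_linear_compose[OF this I sY] YV]
    show "smooth_on (\<lambda>t. r t $ i) I" unfolding r_def vec_lambda_beta .
  qed
  have "smooth_on h I" by (rule smooth_on_linear_system[OF I sM sr detM Mh])
  from smooth_on_has_vector_derivative[OF this I0]
  have dh: "(h has_vector_derivative D h 0 1) (at 0)" .
  have "bounded_linear J" using linear_J by (simp add: linear_conv_bounded_linear)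
  from bounded_linear.has_vector_derivative[OF this dh]
  have "((\<lambda>t. J (h t)) has_vector_derivative J (D h 0 1)) (at 0)" .
  from has_vector_derivative_transform_within_open[OF this I I0 Jh]
  show thesis using that[of "J (D h 0 1)"] J_m by (simp add: Y_def)
qed

text \<open>By Euler's theorem \<open>D q y = 2 g\<^sub>y(y, \<cdot>)\<close>, and \<open>D q y\<close> ignores isotropy components, so the bracket
  may be projected to \<open>m\<close>.\<close>

lemma spray_formula:
  assumes "y \<in> m" "y \<noteq> 0"
  shows "g y (\<eta> y) u = g y y (br u y)"
proof -
  have y: "y \<in> Vq" by (rule m_Vq[OF assms])
  show ?thesis
    using spray_equation(2)[OF assms, of u] D_q_cong[OF y, of "br u y" "lie_bracket B u y"] prm(2)
    by (simp add: g_eq[OF y] D2_q_euler[OF y] br_eq)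
qed

text \<open>Differentiating \<open>spray_equation\<close> along \<open>y + t v\<close> gives the derivative of \<open>\<eta>\<close>; the third
  derivative of \<open>q\<close> that appears on the left is four times the Cartan tensor. The bracket in the
  connection operator contributes the remaining term.\<close>

lemma connection_formula:
  assumes y: "y \<in> m" "y \<noteq> 0" and v: "v \<in> m"
  shows "2 * g y (connection_operator A F G B x0 m y v) u =
    g y (br u v) y + g y (br u y) v + g y (br v y) u - 2 * C y u v (\<eta> y)"
proof -
  have yq: "y \<in> Vq" by (rule m_Vq[OF y])
  note s1 = smooth_on_D[OF smooth_q] and lin = linear_lie_bracket[of u]
  obtain \<eta>' where \<eta>': "\<eta>' \<in> m" "((\<lambda>t. \<eta> (y + t *\<^sub>R v)) has_vector_derivative \<eta>') (at 0)"
    by (rule spray_derivative[OF y v])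
  have dy: "((\<lambda>t. y + t *\<^sub>R v) has_vector_derivative v) (at 0)"
    unfolding has_vector_derivative_def by (auto intro!: derivative_eq_intros)
  have "bounded_linear (lie_bracket B u)" using lin by (simp add: linear_conv_bounded_linear)
  from bounded_linear.has_vector_derivative[OF this dy]
  have dL: "((\<lambda>t. lie_bracket B u (y + t *\<^sub>R v)) has_vector_derivative lie_bracket B u v) (at 0)" .
  have y0: "y + 0 *\<^sub>R v \<in> Vq" using yq by simp
  have 1: "((\<lambda>t. D (\<lambda>z. D q z u) (y + t *\<^sub>R v) (\<eta> (y + t *\<^sub>R v))) has_vector_derivative
      D (\<lambda>z. D (\<lambda>z. D q z u) z (\<eta> y)) y v + D (\<lambda>z. D q z u) y \<eta>') (at 0)"
    using has_vector_derivative_D_apply[where z="\<lambda>t. y + t *\<^sub>R v", OF s1 open_Vq y0 dy \<eta>'(2)] by simp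
  have 2: "((\<lambda>t. D q (y + t *\<^sub>R v) (lie_bracket B u (y + t *\<^sub>R v))) has_vector_derivative
      D (\<lambda>z. D q z (lie_bracket B u y)) y v + D q y (lie_bracket B u v)) (at 0)"
    using has_vector_derivative_D_apply[where z="\<lambda>t. y + t *\<^sub>R v", OF smooth_q open_Vq y0 dy dL] by simp
  define I where "I = {t. y + t *\<^sub>R v \<in> Vq}"
  have "continuous_on UNIV (\<lambda>t. y + t *\<^sub>R v)" by (intro continuous_intros)
  hence I: "open I" unfolding I_def using open_vimage[OF open_Vq, of "\<lambda>t. y + t *\<^sub>R v"] by (simp add: vimage_def)
  have I0: "0 \<in> I" using yq by (simp add: I_def)
  have eq: "D (\<lambda>z. D q z u) (y + t *\<^sub>R v) (\<eta> (y + t *\<^sub>R v)) = D q (y + t *\<^sub>R v) (lie_bracket B u (y + t *\<^sub>R v))"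
    if "t \<in> I" for t
  proof (rule spray_equation(2))
    show "y + t *\<^sub>R v \<in> m" by (intro subspace_add[OF reductive_facts(1)] subspace_scale[OF reductive_facts(1)] y v)
    show "y + t *\<^sub>R v \<noteq> 0" using that linear_0[OF linear_\<delta>] by (auto simp: I_def Vq_def)
  qed
  have "D (\<lambda>z. D (\<lambda>z. D q z u) z (\<eta> y)) y v + D (\<lambda>z. D q z u) y \<eta>' =
      D (\<lambda>z. D q z (lie_bracket B u y)) y v + D q y (lie_bracket B u v)"
    by (rule vector_derivative_unique_at[OF has_vector_derivative_transform_within_open[OF 1 I I0 eq] 2])
  moreover have "D (\<lambda>z. D (\<lambda>z. D q z u) z (\<eta> y)) y v = 4 * C y u v (\<eta> y)"
  proof -
    have "D (\<lambda>z. D (\<lambda>z. D q z u) z (\<eta> y)) y v = D (\<lambda>z. D (\<lambda>z. D q z (\<eta> y)) z u) y v"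
      by (rule fun_cong[OF D_cong_open[OF open_Vq yq D2_q_symmetric]])
    also have "\<dots> = D (\<lambda>z. D (\<lambda>z. D q z (\<eta> y)) z v) y u"
      by (rule second_derivative_symmetric[OF s1 open_Vq yq])
    finally show ?thesis by (simp add: C_eq[OF yq])
  qed
  moreover have "D (\<lambda>z. D q z (lie_bracket B u y)) y v = 2 * g y (br u y) v"
    using D2_q_cong[OF yq, of "lie_bracket B u y" "br u y" v] D2_q_symmetric[OF yq, of v "br u y"] prm(2)
    by (simp add: g_eq[OF yq] br_eq)
  moreover have "D q y (lie_bracket B u v) = 2 * g y (br u v) y"
    using D_q_cong[OF yq, of "lie_bracket B u v" "br u v"] D2_q_euler[OF yq, of "br u v"]
      D2_q_symmetric[OF yq, of y "br u v"] prm(2)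
    by (simp add: g_eq[OF yq] br_eq)
  moreover have "D (\<lambda>z. D q z u) y \<eta>' = 2 * g y \<eta>' u" by (simp add: g_eq[OF yq])
  ultimately have \<eta>'_eq: "g y \<eta>' u = g y (br u y) v + g y (br u v) y - 2 * C y u v (\<eta> y)" by simp
  have N: "connection_operator A F G B x0 m y v = (1/2) *\<^sub>R \<eta>' - (1/2) *\<^sub>R br y v"
    unfolding connection_operator_def vector_derivative_at[OF \<eta>'(2)] ..
  have "br y v = - br v y"
    unfolding br_eq lie_bracket_minus[of y v] by (rule linear_neg[OF linear_prm])
  hence "connection_operator A F G B x0 m y v = (1/2) *\<^sub>R (\<eta>' + br v y)"
    unfolding N by (simp add: scaleR_add_right)
  hence "2 * g y (connection_operator A F G B x0 m y v) u = g y \<eta>' u + g y (br v y) u"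
    by (simp add: linear_cmul[OF linear_g[OF yq]] linear_add[OF linear_g[OF yq]])
  thus ?thesis using \<eta>'_eq by simp
qed

end

theorem theorem5p7:
  fixes A :: "('m::topological_space, real^'n::finite) chart set"
    and F :: "'m \<Rightarrow> real^'n \<Rightarrow> real"
    and G :: "('m \<Rightarrow> 'm) set"
    and B :: "('m \<Rightarrow> 'm, 'b::euclidean_space) chart set"
    and x0 :: 'm
    and m :: "'b set"
  assumes "smooth_manifold euclidean A"
    and "finsler_metric A F"
    and "closed_isometry_subgroup A F G B"
    and "\<forall>p q. \<exists>g\<in>G. g p = q"
    and "reductive_decomposition G B x0 m"
  defines "g \<equiv> fundamental_tensor (norm_m A F B x0)"
    and "C \<equiv> cartan_tensor (norm_m A F B x0)"
    and "\<eta> \<equiv> spray_vector_field A F G B x0 m"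
    and "N \<equiv> connection_operator A F G B x0 m"
    and "br \<equiv> bracket_m G B x0 m"
  shows "(\<forall>y\<in>m - {0}. \<forall>u\<in>m. g y (\<eta> y) u = g y y (br u y)) \<and>
    (\<forall>y\<in>m - {0}. \<forall>u\<in>m. \<forall>v\<in>m.
       2 * g y (N y v) u =
         g y (br u v) y + g y (br u y) v + g y (br v y) u - 2 * C y u v (\<eta> y))"
proof -
  interpret homogeneous_finsler A F G B x0 m
    by unfold_locales (fact assms)+
  show ?thesis
    unfolding g_def C_def \<eta>_def N_def br_def
    using spray_formula connection_formula by blast
qed

end
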